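(* Let $\Sigma_1,\Sigma_2$ be symmetric positive definite $n\times n$ matrices, $C$ a symmetric positive semidefinite $n\times n$ matrix, and $\lambda>1$. Consider the problem of minimizing $$f(X)=-\log\det(X+\Sigma_1)+\lambda\log\det(X+\Sigma_2)$$ over $\mathcal{C}=\{X\in\mathbb{S}^n : 0\preceq X\preceq C\}$, written as $f=g-h$ with $g(X)=-\log\det(X+\Sigma_1)$ and $h(X)=-\lambda\log\det(X+\Sigma_2)$. Then: (1) The following conditions hold: (a) $g,h$ are closed, convex, and continuously differentiable on their respective domains; (b) $\mathcal{C}$ is bounded, closed and convex, with $\mathcal{C}\subseteq\operatorname{dom} g\cap\operatorname{dom} h$; (c) $f$ has a global minimizer $X^\star$ over $\mathcal{C}$ with finite optimal value $f^\star=f(X^\star)$; (d) for every $X^{(k)}\in\mathcal{C}$, the DCA subproblem $\min_{X\in\mathcal{C}}\big(g(X)-h(X^{(k)})-\langle\nabla h(X^{(k)}),X-X^{(k)}\rangle\big)$ has a solution; (e) there exists $\mu>0$ such that, for some $r>0$, $$\mu\,(f(X)-f^\star)\le d_{h^\ast}\big(\nabla g(X)+Y,\nabla h(X)\big)\quad\text{for all }X\in\mathcal{C},\ Y\in N_{\mathcal{C}}(X)\text{ with }\|Y\|_F\le r.$$ (2) The DCA iteration, started from any $X^{(0)}\in\mathcal{C}$, $$X^{(k+1)}\in\operatorname*{argmin}_{X\in\mathcal{C}}\big(g(X)-h(X^{(k)})-\langle\nabla h(X^{(k)}),X-X^{(k)}\rangle\big),$$ converges to the minimizer of the problem at a linear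 rate: $X^{(k)}\to X^\star$, and there is $\rho\in(0,1)$ such that $f(X^{(k+1)})-f^\star\le\rho\,(f(X^{(k)})-f^\star)$ for all $k$.
   Context: $\mathbb{S}^n$ is the space of symmetric real $n\times n$ matrices with trace inner product $\langle A,B\rangle=\operatorname{tr}(AB)$ and Frobenius norm $\|\cdot\|_F$; $A\preceq B$ means $B-A$ is positive semidefinite. The domains are $\operatorname{dom} g=\{X\in\mathbb{S}^n: X+\Sigma_1\succ0\}$ and $\operatorname{dom} h=\{X\in\mathbb{S}^n: X+\Sigma_2\succ 0\}$ (values $+\infty$ outside). $h^\ast(Y)=\sup_X(\langle X,Y\rangle-h(X))$ is the convex conjugate. $N_{\mathcal{C}}(X)=\{Y\in\mathbb{S}^n:\langle Y,Z-X\rangle\le0\ \text{for all } Z\in\mathcal{C}\}$ is the normal cone. The Bregman distance generated by $h^\ast$ is $d_{h^\ast}(U,V)=h^\ast(U)-h^\ast(V)-\langle\nabla h^\ast(V),U-V\rangle$, where $\nabla h^\ast(\nabla h(X))=X$, with value $+\infty$ if $h^\ast(U)=+\infty$. DCA (difference-of-convex algorithm) is the iteration displayed in the claim. The problem is known to have a unique global minimizer, as the paper recalls from the literature. *)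

theory Defs
  imports "HOL-Analysis.Analysis"
begin

text \<open>
  The space of symmetric matrices is a linear subspace of the type \<open>real^'n^'n\<close>. The library
  inner product and norm of that type are the trace inner product and the Frobenius norm;
  see \<open>inner_eq_trace\<close> and \<open>norm_eq_frobenius\<close> below.
\<close>

definition symm :: "(real^'n^'n) set" where
  "symm = {A. transpose A = A}"

definition pos_semidef :: "real^'n^'n \<Rightarrow> bool" where
  "pos_semidef A \<longleftrightarrow> A \<in> symm \<and> (\<forall>x. 0 \<le> x \<bullet> (A *v x))"

definition pos_def :: "real^'n^'n \<Rightarrow> bool" where
  "pos_def A \<longleftrightarrow> A \<in> symm \<and> (\<forall>x. x \<noteq> 0 \<longrightarrow> 0 < x \<bullet> (A *v x))"

definition loewner_le :: "real^'n^'n \<Rightarrow> real^'n^'n \<Rightarrow> bool" (infix "\<preceq>" 50) where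
  "A \<preceq> B \<longleftrightarrow> pos_semidef (B - A)"

lemma inner_eq_trace:
  fixes A B :: "real^'n^'n"
  assumes "A \<in> symm"
  shows "A \<bullet> B = trace (A ** B)"
proof -
  have t: "A $ i $ j = A $ j $ i" for i j
    using assms by (metis (mono_tags, lifting) symm_def mem_Collect_eq transpose_def vec_lambda_beta)
  have "A \<bullet> B = (\<Sum>i\<in>UNIV. \<Sum>j\<in>UNIV. A $ i $ j * B $ i $ j)"
    by (simp add: inner_vec_def)
  also have "\<dots> = (\<Sum>j\<in>UNIV. \<Sum>i\<in>UNIV. A $ j $ i * B $ i $ j)"
    by (subst sum.swap) (simp add: t)
  also have "\<dots> = trace (A ** B)"
    by (simp add: trace_def matrix_matrix_mult_def)
  finally show ?thesis .
qed

lemma norm_eq_frobenius: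
  fixes A :: "real^'n^'n"
  shows "norm A = sqrt (\<Sum>i\<in>UNIV. \<Sum>j\<in>UNIV. (A $ i $ j)\<^sup>2)"
  by (simp add: norm_eq_sqrt_inner inner_vec_def power2_eq_square)

text \<open>Extended-real-valued functions are only ever considered on \<open>symm\<close>.\<close>

definition eff_dom :: "(real^'n^'n \<Rightarrow> ereal) \<Rightarrow> (real^'n^'n) set" where
  "eff_dom F = {X \<in> symm. F X < \<infinity>}"

definition epi :: "(real^'n^'n \<Rightarrow> ereal) \<Rightarrow> ((real^'n^'n) \<times> real) set" where
  "epi F = {(X, t). X \<in> symm \<and> F X \<le> ereal t}"

definition closed_fun :: "(real^'n^'n \<Rightarrow> ereal) \<Rightarrow> bool" where
  "closed_fun F \<longleftrightarrow> closed (epi F)"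

definition convex_fun :: "(real^'n^'n \<Rightarrow> ereal) \<Rightarrow> bool" where
  "convex_fun F \<longleftrightarrow> convex (epi F)"

text \<open>
  \<open>has_grad F G X\<close>: \<open>F\<close>, as a function on the Euclidean space \<open>symm\<close>, is finite near \<open>X\<close> and
  differentiable at \<open>X\<close>, with gradient the symmetric matrix \<open>G\<close>.
\<close>

definition has_grad :: "(real^'n^'n \<Rightarrow> ereal) \<Rightarrow> real^'n^'n \<Rightarrow> real^'n^'n \<Rightarrow> bool" where
  "has_grad F G X \<longleftrightarrow>
     X \<in> symm \<and> G \<in> symm \<and>
     (\<forall>\<^sub>F Z in nhds X. Z \<in> symm \<longrightarrow> \<bar>F Z\<bar> \<noteq> \<infinity>) \<and>
     ((\<lambda>Z. real_of_ereal (F Z)) has_derivative (\<lambda>H. G \<bullet> H)) (at X within symm)"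

definition grad :: "(real^'n^'n \<Rightarrow> ereal) \<Rightarrow> real^'n^'n \<Rightarrow> real^'n^'n" where
  "grad F X = (THE G. has_grad F G X)"

definition C1_on :: "(real^'n^'n) set \<Rightarrow> (real^'n^'n \<Rightarrow> ereal) \<Rightarrow> bool" where
  "C1_on S F \<longleftrightarrow> (\<exists>D. (\<forall>X\<in>S. has_grad F (D X) X) \<and> continuous_on S D)"

definition conjugate :: "(real^'n^'n \<Rightarrow> ereal) \<Rightarrow> real^'n^'n \<Rightarrow> ereal" where
  "conjugate F Y = (SUP X\<in>symm. ereal (X \<bullet> Y) - F X)"

definition normal_cone :: "(real^'n^'n) set \<Rightarrow> real^'n^'n \<Rightarrow> (real^'n^'n) set" where
  "normal_cone K X = {Y \<in> symm. \<forall>Z\<in>K. Y \<bullet> (Z - X) \<le> 0}"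

text \<open>In \<open>ereal\<close>, \<open>\<infinity> - a = \<infinity>\<close> for all \<open>a\<close>, so this is \<open>\<infinity>\<close> whenever \<open>F U = \<infinity>\<close>.\<close>

definition bregman :: "(real^'n^'n \<Rightarrow> ereal) \<Rightarrow> real^'n^'n \<Rightarrow> real^'n^'n \<Rightarrow> ereal" where
  "bregman F U V = F U - F V - ereal (grad F V \<bullet> (U - V))"

lemma bregman_infinity:
  "F U = \<infinity> \<Longrightarrow> bregman F U V = \<infinity>"
  by (simp add: bregman_def)

lemma symm_subspace: "subspace symm"
proof -
  have "A \<in> symm \<longleftrightarrow> (\<forall>i j. A $ i $ j = A $ j $ i)" for A :: "real^'a^'a"
    by (auto simp: symm_def transpose_def vec_eq_iff)
  then show ?thesis by (simp add: subspace_def)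
qed

lemma has_grad_unique:
  assumes "has_grad F G X" and "has_grad F G' X"
  shows "G = G'"
proof -
  have X: "X \<in> symm" and H: "G - G' \<in> symm"
    using assms by (auto simp: has_grad_def subspace_diff[OF symm_subspace])
  let ?H = "G - G'"
  have *: "((\<lambda>t. real_of_ereal (F (X + t *\<^sub>R ?H))) has_derivative (\<lambda>t. K \<bullet> (t *\<^sub>R ?H))) (at 0)"
    if "has_grad F K X" for K
  proof (rule has_derivative_in_compose[where g = "\<lambda>Z. real_of_ereal (F Z)"])
    show "((\<lambda>t. X + t *\<^sub>R ?H) has_derivative (\<lambda>t. t *\<^sub>R ?H)) (at 0)"
      by (auto intro!: derivative_eq_intros)
    have "range (\<lambda>t. X + t *\<^sub>R ?H) \<subseteq> symm"
      using X H by (auto intro!: subspace_add[OF symm_subspace] subspace_scale[OF symm_subspace])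
    then show "((\<lambda>Z. real_of_ereal (F Z)) has_derivative (\<lambda>H. K \<bullet> H))
        (at (X + 0 *\<^sub>R ?H) within range (\<lambda>t. X + t *\<^sub>R ?H))"
      using that by (auto simp: has_grad_def intro: has_derivative_subset)
  qed
  have "G \<bullet> (1 *\<^sub>R ?H) = G' \<bullet> (1 *\<^sub>R ?H)"
    using has_derivative_unique[OF *[OF assms(1)] *[OF assms(2)]] by meson
  then have "?H \<bullet> ?H = 0"
    by (simp add: inner_diff_left)
  then show ?thesis by simp
qed

lemma grad_eq: "has_grad F G X \<Longrightarrow> grad F X = G"
  unfolding grad_def by (blast intro: has_grad_unique)

definition g_fun :: "real^'n^'n \<Rightarrow> real^'n^'n \<Rightarrow> ereal" where
  "g_fun S1 X = (if pos_def (X + S1) then ereal (- ln (det (X + S1))) else \<infinity>)"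

definition h_fun :: "real \<Rightarrow> real^'n^'n \<Rightarrow> real^'n^'n \<Rightarrow> ereal" where
  "h_fun lam S2 X = (if pos_def (X + S2) then ereal (- lam * ln (det (X + S2))) else \<infinity>)"

definition f_obj :: "real \<Rightarrow> real^'n^'n \<Rightarrow> real^'n^'n \<Rightarrow> real^'n^'n \<Rightarrow> real" where
  "f_obj lam S1 S2 X = - ln (det (X + S1)) + lam * ln (det (X + S2))"

definition feas :: "real^'n^'n \<Rightarrow> (real^'n^'n) set" where
  "feas C = {X \<in> symm. 0 \<preceq> X \<and> X \<preceq> C}"

definition f_opt :: "real \<Rightarrow> real^'n^'n \<Rightarrow> real^'n^'n \<Rightarrow> real^'n^'n \<Rightarrow> ereal" where
  "f_opt lam S1 S2 C = (INF X\<in>feas C. ereal (f_obj lam S1 S2 X))"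

definition dca_sub ::
  "real \<Rightarrow> real^'n^'n \<Rightarrow> real^'n^'n \<Rightarrow> real^'n^'n \<Rightarrow> real^'n^'n \<Rightarrow> ereal" where
  "dca_sub lam S1 S2 Xk X =
     g_fun S1 X - h_fun lam S2 Xk - ereal (grad (h_fun lam S2) Xk \<bullet> (X - Xk))"

definition dca_seq ::
  "real \<Rightarrow> real^'n^'n \<Rightarrow> real^'n^'n \<Rightarrow> real^'n^'n \<Rightarrow> (nat \<Rightarrow> real^'n^'n) \<Rightarrow> bool" where
  "dca_seq lam S1 S2 C X \<longleftrightarrow>
     X 0 \<in> feas C \<and>
     (\<forall>k. is_arg_min (dca_sub lam S1 S2 (X k)) (\<lambda>Z. Z \<in> feas C) (X (Suc k)))"

lemma eff_dom_g_fun: "eff_dom (g_fun S1) = {X \<in> symm. pos_def (X + S1)}"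
  by (auto simp: eff_dom_def g_fun_def)

lemma eff_dom_h_fun: "eff_dom (h_fun lam S2) = {X \<in> symm. pos_def (X + S2)}"
  by (auto simp: eff_dom_def h_fun_def)

lemma f_obj_eq_diff:
  assumes "X \<in> eff_dom (g_fun S1) \<inter> eff_dom (h_fun lam S2)"
  shows "ereal (f_obj lam S1 S2 X) = g_fun S1 X - h_fun lam S2 X"
  using assms by (auto simp: eff_dom_g_fun eff_dom_h_fun f_obj_def g_fun_def h_fun_def)

end

theory Submission
  imports Defs
begin

text \<open>
  Write \<open>f = g - h\<close>. Everything about minimization rests on one inequality,
  \<open>growth_from_nearly_stationary\<close>: if \<open>X\<close> is feasible, \<open>Y\<close> is a bounded normal vector at \<open>X\<close>, and
  the stationarity error \<open>G = \<nabla>f(X) + Y\<close> is small, then every feasible \<open>Z\<close> satisfies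
  \<open>f(Z) - f(X) \<ge> c \<parallel>Z - X\<parallel>\<^sup>2 - \<parallel>G\<parallel> \<parallel>Z - X\<parallel>\<close>, with a constant \<open>c > 0\<close> that depends neither on \<open>X\<close>
  nor on \<open>Z\<close>. The function \<open>f\<close> need not be convex, but near its stationary points it behaves as if
  it were strongly convex.

  The reason is a comparison of curvatures. Put \<open>A = X + S1\<close>, \<open>B = X + S2\<close>, \<open>D = Z - X\<close>,
  \<open>A\<^sub>t = A + t D\<close> and \<open>B\<^sub>t = B + t D\<close>. The distance of \<open>f\<close> from its tangent along the segment from
  \<open>X\<close> to \<open>Z\<close> is the integral of \<open>t\<close> times \<open>A\<^sup>-\<^sup>1 \<bullet> (D A\<^sub>t\<^sup>-\<^sup>1 D) - lam (B\<^sup>-\<^sup>1 \<bullet> (D B\<^sub>t\<^sup>-\<^sup>1 D))\<close>.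
  Suppose that \<open>\<nabla>f(X) \<preceq> 0\<close>, that is \<open>lam B\<^sup>-\<^sup>1 \<preceq> A\<^sup>-\<^sup>1\<close>. Then \<open>lam A \<preceq> B\<close>, so \<open>B\<^sub>t - A\<^sub>t = B - A\<close>
  is positive definite for all \<open>t\<close>, and the second term is at most a proper fraction of the first;
  see \<open>ln_det_difference_above_tangent\<close>.

  At a general stationary point, \<open>A\<^sup>-\<^sup>1 + M1 = lam B\<^sup>-\<^sup>1 + M2\<close> with multipliers \<open>M1\<close> of \<open>0 \<preceq> X\<close>
  and \<open>M2\<close> of \<open>X \<preceq> C\<close>. The multiplier \<open>M1\<close> is absorbed into \<open>S1\<close> by the enhancement argument of
  information theory (\<open>enhanced_noise\<close>), and \<open>M2\<close> enters the tangent term with the favourable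
  sign. If \<open>C\<close> is singular, such multipliers need not exist for the original problem. Therefore
  the substitution \<open>X = R x R\<close> with \<open>R\<^sup>2 = C\<close> first reduces the constraint to \<open>0 \<preceq> x \<preceq> I\<close>
  (\<open>reduced_noise\<close>), where the multipliers are the negative and the positive part of \<open>R Y R\<close>
  (\<open>normal_vector_multipliers\<close>).

  With \<open>G = 0\<close> the inequality gives uniqueness of the minimizer and quadratic growth around it.
  Minimizing its right-hand side over \<open>\<parallel>Z - X\<parallel>\<close> gives \<open>f(X) - f\<^sup>\<star> \<le> \<kappa> \<parallel>G\<parallel>\<^sup>2\<close>
  (\<open>gap_le_stationarity_error\<close>). The error bound for the Bregman distance follows, because that
  distance is at least \<open>\<delta> \<parallel>G\<parallel>\<^sup>2\<close> (\<open>bregman_ge_stationarity_error\<close>). For a DCA step, the optimality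
  condition of the subproblem supplies a normal vector for which \<open>G = \<nabla>h(X\<^sub>k) - \<nabla>h(X\<^sub>k\<^sub>+\<^sub>1)\<close> is of
  the order of the step length, while \<open>f\<close> decreases by a multiple of the squared step length;
  together the two bounds give the linear rate.
\<close>

section \<open>Symmetric matrices and the spectral theorem\<close>

lemma matrix_add_rdistrib: "(A + B) ** C = A ** C + B ** (C :: real^'n^'n)" for A :: "real^'n^'n"
  by (simp add: vec_eq_iff matrix_matrix_mult_def sum.distrib distrib_right)

lemmas matrix_distribs =
  matrix_add_ldistrib matrix_add_rdistrib matrix_scalar_ac scalar_matrix_assoc[symmetric]

lemma matrix_diff_ldistrib: "A ** (B - C) = A ** B - A ** (C :: real^'n^'n)"
  for A :: "real^'n^'n"
  by (simp add: vec_eq_iff matrix_matrix_mult_def sum_subtractf right_diff_distrib)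

lemma matrix_diff_rdistrib: "(A - B) ** C = A ** C - B ** (C :: real^'n^'n)"
  for A :: "real^'n^'n"
  by (simp add: vec_eq_iff matrix_matrix_mult_def sum_subtractf left_diff_distrib)

lemma scaleR_matrix_vector: "(c *\<^sub>R A) *v x = c *\<^sub>R (A *v x)" for A :: "real^'n^'n"
  by (simp add: vec_eq_iff matrix_vector_mult_def sum_distrib_left mult.assoc)

lemma symm_iff: "A \<in> symm \<longleftrightarrow> (\<forall>i j. A $ i $ j = A $ j $ i)" for A :: "real^'n^'n"
  by (auto simp: symm_def transpose_def vec_eq_iff)

lemma symm_add [simp]: "A \<in> symm \<Longrightarrow> B \<in> symm \<Longrightarrow> A + B \<in> symm"
  and symm_diff [simp]: "A \<in> symm \<Longrightarrow> B \<in> symm \<Longrightarrow> A - B \<in> symm"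
  and symm_scaleR [simp]: "A \<in> symm \<Longrightarrow> c *\<^sub>R A \<in> symm"
  and symm_uminus [simp]: "A \<in> symm \<Longrightarrow> - A \<in> symm"
  and symm_0 [simp]: "0 \<in> symm"
  and symm_mat_1 [simp]: "mat 1 \<in> symm"
  for A B :: "real^'n^'n"
  by (auto simp: symm_iff mat_def)

lemma symm_congruence [simp]:
  "R \<in> symm \<Longrightarrow> A \<in> symm \<Longrightarrow> R ** A ** R \<in> symm" for A R :: "real^'n^'n"
  by (simp add: symm_def matrix_transpose_mul matrix_mul_assoc)

lemma symm_adjoint: "A \<in> symm \<Longrightarrow> (A *v x) \<bullet> y = x \<bullet> (A *v y)" for A :: "real^'n^'n"
  using dot_lmul_matrix[of x A y] transpose_matrix_vector[of A x] by (simp add: symm_def)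

lemma closed_symm: "closed (symm :: (real^'n^'n) set)"
  by (rule closed_subspace[OF symm_subspace])

definition diag_mat :: "('n \<Rightarrow> real) \<Rightarrow> real^'n^'n" where
  "diag_mat d = (\<chi> i j. if i = j then d i else 0)"

text \<open>The matrix with eigenvalues \<open>d\<close> and the columns of \<open>Q\<close> as eigenvectors. Square roots,
  positive parts and kernel projections of a symmetric matrix are obtained by changing \<open>d\<close>.\<close>

definition spectral :: "real^'n^'n \<Rightarrow> ('n \<Rightarrow> real) \<Rightarrow> real^'n^'n" where
  "spectral Q d = Q ** diag_mat d ** transpose Q"

text \<open>A maximizer of the Rayleigh quotient over the unit sphere of an invariant subspace is an
  eigenvector: the first-order condition makes \<open>A u\<close> orthogonal to every direction of the subspace
  that is orthogonal to \<open>u\<close>.\<close>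

lemma invariant_subspace_eigenvector:
  fixes A :: "real^'n^'n"
  assumes A: "A \<in> symm" and W: "subspace W" and inv: "\<And>x. x \<in> W \<Longrightarrow> A *v x \<in> W"
    and z: "z \<in> W" "z \<noteq> 0"
  obtains u m where "u \<in> W" "norm u = 1" "A *v u = m *\<^sub>R u"
proof -
  let ?S = "W \<inter> sphere 0 1"
  have "compact ?S"
    using closed_subspace[OF W] by (simp add: closed_Int_compact)
  moreover have "z /\<^sub>R norm z \<in> ?S"
    using z W by (simp add: subspace_scale)
  moreover have "continuous_on ?S (\<lambda>x. x \<bullet> (A *v x))"
    by (intro continuous_intros linear_continuous_on linear_linear[THEN iffD1] matrix_vector_mul_linear)
  ultimately obtain u where u: "u \<in> ?S" and max: "\<And>x. x \<in> ?S \<Longrightarrow> x \<bullet> (A *v x) \<le> u \<bullet> (A *v u)"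
    using continuous_attains_sup[of ?S "\<lambda>x. x \<bullet> (A *v x)"] by (metis empty_iff)
  define m where "m = u \<bullet> (A *v u)"
  have uu: "u \<bullet> u = 1" using u by (simp add: norm_eq_1)
  have max': "x \<bullet> (A *v x) \<le> m * (x \<bullet> x)" if "x \<in> W" for x
  proof (cases "x = 0")
    case False
    have "x /\<^sub>R norm x \<in> ?S" using that False W by (simp add: subspace_scale)
    from max[OF this] have "(x \<bullet> (A *v x)) / (norm x)^2 \<le> m"
      by (simp add: m_def matrix_vector_mult_scaleR power2_eq_square divide_simps)
    then show ?thesis using False
      by (simp add: divide_simps dot_square_norm split: if_splits)
  qed simp
  have orth: "w \<bullet> (A *v u) = 0" if w: "w \<in> W" "w \<bullet> u = 0" for w
  proof (rule ccontr)
    define p where "p = w \<bullet> (A *v u)"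
    define q where "q = m * (w \<bullet> w) - w \<bullet> (A *v w)"
    assume "w \<bullet> (A *v u) \<noteq> 0"
    then have p: "p \<noteq> 0" by (simp add: p_def)
    have ineq: "2 * t * p \<le> t^2 * q" for t
    proof -
      have "u + t *\<^sub>R w \<in> W" using w u W by (simp add: subspace_add subspace_scale)
      from max'[OF this] show ?thesis
        using symm_adjoint[OF A, of u w] uu w(2)
        by (simp add: p_def q_def m_def algebra_simps power2_eq_square inner_commute)
    qed
    have q: "q > 0"
      using ineq[of 1] ineq[of "-1"] p by auto
    from ineq[of "p / q"] have "2 * (p^2 / q) \<le> p^2 / q"
      using q by (simp add: power2_eq_square field_simps)
    moreover have "p^2 / q > 0" using p q by simp
    ultimately show False by linarith
  qed
  let ?w = "A *v u - m *\<^sub>R u"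
  have "?w \<in> W" using u inv W by (simp add: subspace_diff subspace_scale)
  moreover have wu: "?w \<bullet> u = 0"
    using uu inner_commute[of "A *v u" u] by (simp add: inner_diff_left m_def)
  ultimately have "?w \<bullet> (A *v u) = 0" by (rule orth)
  with wu have "?w \<bullet> ?w = 0" by (simp add: inner_diff_right)
  then have "A *v u = m *\<^sub>R u" by simp
  with u that show ?thesis by auto
qed

lemma orthonormal_eigenvectors:
  fixes A :: "real^'n^'n"
  assumes A: "A \<in> symm" and "k \<le> CARD('n)"
  shows "\<exists>B. finite B \<and> card B = k \<and> pairwise orthogonal B \<and> (\<forall>b\<in>B. norm b = 1) \<and>
           (\<forall>b\<in>B. \<exists>m. A *v b = m *\<^sub>R b)"
  using assms(2)
proof (induction k)
  case 0
  show ?case by (rule exI[of _ "{}"]) (simp add: pairwise_def)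
next
  case (Suc k)
  then obtain B where B: "finite B" "card B = k" "pairwise orthogonal B" "\<forall>b\<in>B. norm b = 1"
    "\<forall>b\<in>B. \<exists>m. A *v b = m *\<^sub>R b" by auto
  have "dim B < DIM(real^'n)"
    using dim_le_card'[OF B(1)] B(2) Suc.prems by simp
  then obtain z where z: "z \<noteq> 0" "\<And>y. y \<in> span B \<Longrightarrow> orthogonal z y"
    using orthogonal_to_subspace_exists by blast
  let ?W = "{x. \<forall>b\<in>B. x \<bullet> b = 0}"
  have W: "subspace ?W" by (simp add: subspace_def inner_add_left)
  have inv: "A *v x \<in> ?W" if "x \<in> ?W" for x
  proof -
    have "(A *v x) \<bullet> b = 0" if b: "b \<in> B" for b
    proof -
      obtain m where "A *v b = m *\<^sub>R b" using B(5) b by blast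
      then show ?thesis using \<open>x \<in> ?W\<close> b by (simp add: symm_adjoint[OF A])
    qed
    then show ?thesis by simp
  qed
  have "z \<in> ?W" using z(2) by (auto simp: orthogonal_def span_base)
  from invariant_subspace_eigenvector[OF A W inv this z(1)]
  obtain u m where u: "u \<in> ?W" "norm u = 1" "A *v u = m *\<^sub>R u" .
  have "u \<notin> B" using u(1,2) by (auto simp: norm_eq_1)
  moreover have "orthogonal u b \<and> orthogonal b u" if "b \<in> B" for b
    using u(1) that by (auto simp: orthogonal_def inner_commute)
  ultimately show ?case using B u(2,3)
    by (intro exI[of _ "insert u B"]) (auto simp: pairwise_insert)
qed

theorem spectral_theorem:
  fixes A :: "real^'n^'n"
  assumes A: "A \<in> symm"
  obtains Q d where "orthogonal_matrix Q" "A = spectral Q d"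
proof -
  obtain B where B: "finite B" "card B = CARD('n)" "pairwise orthogonal B" "\<forall>b\<in>B. norm b = 1"
    "\<forall>b\<in>B. \<exists>m. A *v b = m *\<^sub>R b"
    using orthonormal_eigenvectors[OF A order_refl] by blast
  obtain f where f: "bij_betw f (UNIV::'n set) B"
    using B(1,2) by (metis finite_class.finite_UNIV finite_same_card_bij)
  have "\<forall>i. \<exists>m. A *v f i = m *\<^sub>R f i" using B(5) f by (auto simp: bij_betw_def)
  then obtain d where d: "\<And>i. A *v f i = d i *\<^sub>R f i" by metis
  define Q :: "real^'n^'n" where "Q = (\<chi> i j. f j $ i)"
  have col: "column j Q = f j" for j by (simp add: Q_def column_def)
  have Q: "orthogonal_matrix Q"
    using B(3,4) f unfolding orthogonal_matrix_orthonormal_columns col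
    by (metis UNIV_I bij_betwE bij_betw_imp_inj_on inj_onD pairwiseD)
  have "A ** Q = Q ** diag_mat d"
  proof -
    have "(A ** Q) $ i $ j = (Q ** diag_mat d) $ i $ j" for i j
    proof -
      have "(A ** Q) $ i $ j = (A *v f j) $ i"
        by (simp add: matrix_matrix_mult_def matrix_vector_mult_def Q_def)
      also have "\<dots> = (Q ** diag_mat d) $ i $ j"
        by (simp add: d matrix_matrix_mult_def diag_mat_def Q_def if_distrib cong: if_cong)
      finally show ?thesis .
    qed
    then show ?thesis by (simp add: vec_eq_iff)
  qed
  then have "spectral Q d = A ** (Q ** transpose Q)"
    by (simp add: spectral_def matrix_mul_assoc)
  then have "A = spectral Q d" using Q by (simp add: orthogonal_matrix_def)
  with Q that show ?thesis by blast
qed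

lemma diag_mat_mult: "diag_mat d ** diag_mat e = diag_mat (\<lambda>i. d i * e i)"
proof -
  have "(\<Sum>k\<in>UNIV. (if i = k then d i else 0) * (if k = j then e k else 0))
      = (if i = j then d i * e i else 0)" for i j
  proof -
    have 1: "(if i = k then d i else 0) * (if k = j then e k else 0)
        = (if i = k then if i = j then d i * e i else 0 else 0)" for k
      by simp
    show ?thesis unfolding 1 by (rule sum.delta'[OF finite, THEN trans]) simp
  qed
  then show ?thesis
    by (simp only: diag_mat_def matrix_matrix_mult_def vec_eq_iff vec_lambda_beta simp_thms)
qed

lemma diag_mat_vector: "(diag_mat d *v x) $ i = d i * x $ i"
proof -
  have "(if i = k then d i else 0) * x $ k = (if i = k then d i * x $ k else 0)" for k
    by simp
  then show ?thesis
    by (simp only: diag_mat_def matrix_vector_mult_def vec_lambda_beta sum.delta'[OF finite]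
        UNIV_I if_True)
qed

lemma spectral_mult:
  assumes "orthogonal_matrix Q"
  shows "spectral Q d ** spectral Q e = spectral Q (\<lambda>i. d i * e i)"
proof -
  have "spectral Q d ** spectral Q e
      = Q ** diag_mat d ** (transpose Q ** Q) ** diag_mat e ** transpose Q"
    by (simp add: spectral_def matrix_mul_assoc)
  also have "\<dots> = Q ** (diag_mat d ** diag_mat e) ** transpose Q"
    using assms by (simp add: orthogonal_matrix_def matrix_mul_assoc)
  finally show ?thesis by (simp add: diag_mat_mult spectral_def)
qed

lemma spectral_add: "spectral Q d + spectral Q e = spectral Q (\<lambda>i. d i + e i)"
proof -
  have "diag_mat (\<lambda>i. d i + e i) = diag_mat d + diag_mat e"
    by (simp add: diag_mat_def vec_eq_iff)
  then show ?thesis by (simp add: spectral_def matrix_distribs)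
qed

lemma spectral_diff: "spectral Q d - spectral Q e = spectral Q (\<lambda>i. d i - e i)"
proof -
  have "diag_mat (\<lambda>i. d i - e i) = diag_mat d - diag_mat e"
    by (simp add: diag_mat_def vec_eq_iff)
  then show ?thesis by (simp add: spectral_def matrix_diff_ldistrib matrix_diff_rdistrib)
qed

lemma spectral_one: "orthogonal_matrix Q \<Longrightarrow> spectral Q (\<lambda>_. 1) = mat 1"
proof -
  have "diag_mat (\<lambda>_. 1) = (mat 1 :: real^'a^'a)" by (simp add: diag_mat_def mat_def)
  then show "orthogonal_matrix Q \<Longrightarrow> ?thesis" by (simp add: spectral_def orthogonal_matrix_def)
qed

lemma symm_spectral [simp]: "spectral Q d \<in> symm"
proof -
  have "transpose (diag_mat d) = diag_mat d"
    by (auto simp: diag_mat_def transpose_def vec_eq_iff)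
  then show ?thesis by (simp add: symm_def spectral_def matrix_transpose_mul matrix_mul_assoc)
qed

lemma trace_spectral: "orthogonal_matrix Q \<Longrightarrow> trace (spectral Q d) = (\<Sum>i\<in>UNIV. d i)"
proof -
  assume "orthogonal_matrix Q"
  then have "trace (spectral Q d) = trace (diag_mat d)"
    unfolding spectral_def
    by (subst trace_mul_sym) (simp add: matrix_mul_assoc orthogonal_matrix_def)
  then show ?thesis by (simp add: trace_def diag_mat_def)
qed

lemma inner_spectral:
  "orthogonal_matrix Q \<Longrightarrow> spectral Q d \<bullet> spectral Q e = (\<Sum>i\<in>UNIV. d i * e i)"
  by (simp add: inner_eq_trace spectral_mult trace_spectral)

lemma det_spectral: "orthogonal_matrix Q \<Longrightarrow> det (spectral Q d) = (\<Prod>i\<in>UNIV. d i)"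
proof -
  assume Q: "orthogonal_matrix Q"
  have "det (spectral Q d) = det (diag_mat d) * det (transpose Q ** Q)"
    by (simp add: spectral_def det_mul)
  also have "det (diag_mat d) = (\<Prod>i\<in>UNIV. d i)"
    by (subst det_diagonal) (auto simp: diag_mat_def)
  finally show ?thesis using Q by (simp add: orthogonal_matrix_def)
qed

lemma spectral_quadratic:
  "x \<bullet> (spectral Q d *v x) = (\<Sum>i\<in>UNIV. d i * ((transpose Q *v x) $ i)\<^sup>2)"
proof -
  have "x \<bullet> (spectral Q d *v x) = x \<bullet> (Q *v (diag_mat d *v (transpose Q *v x)))"
    by (simp only: spectral_def matrix_vector_mul_assoc matrix_mul_assoc)
  also have "\<dots> = (transpose Q *v x) \<bullet> (diag_mat d *v (transpose Q *v x))"
    by (metis dot_lmul_matrix transpose_matrix_vector)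
  also have "\<dots> = (\<Sum>i\<in>UNIV. d i * ((transpose Q *v x) $ i)\<^sup>2)"
    unfolding inner_vec_def diag_mat_vector by (simp add: power2_eq_square mult_ac)
  finally show ?thesis .
qed

lemma spectral_eigenvalue:
  assumes Q: "orthogonal_matrix Q"
  shows "\<exists>x. x \<noteq> 0 \<and> x \<bullet> (spectral Q d *v x) = d i"
proof -
  let ?x = "Q *v axis i 1"
  have t: "transpose Q *v ?x = axis i 1"
    using Q by (simp add: matrix_vector_mul_assoc orthogonal_matrix_def del: transpose_matrix_vector)
  have "?x \<noteq> 0"
  proof
    assume "?x = 0"
    with t have "(axis i 1 :: real^'a) = 0" by (metis matrix_vector_mult_0_right)
    then show False by (simp add: axis_eq_0_iff)
  qed
  moreover have "?x \<bullet> (spectral Q d *v ?x) = d i"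
  proof -
    have "d j * ((axis i 1 :: real^'a) $ j)\<^sup>2 = (if i = j then d j else 0)" for j
      by (simp add: axis_def)
    then show ?thesis unfolding spectral_quadratic t by simp
  qed
  ultimately show ?thesis by blast
qed

lemma pos_semidef_spectral_iff:
  assumes Q: "orthogonal_matrix Q"
  shows "pos_semidef (spectral Q d) \<longleftrightarrow> (\<forall>i. 0 \<le> d i)"
proof
  assume "pos_semidef (spectral Q d)"
  then show "\<forall>i. 0 \<le> d i"
    using spectral_eigenvalue[OF Q, of d] unfolding pos_semidef_def by metis
next
  assume "\<forall>i. 0 \<le> d i"
  then show "pos_semidef (spectral Q d)"
    by (auto simp: pos_semidef_def spectral_quadratic intro!: sum_nonneg simp del: transpose_matrix_vector)
qed

lemma pos_def_spectral_iff:
  assumes Q: "orthogonal_matrix Q"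
  shows "pos_def (spectral Q d) \<longleftrightarrow> (\<forall>i. 0 < d i)"
proof
  assume "pos_def (spectral Q d)"
  then show "\<forall>i. 0 < d i"
    using spectral_eigenvalue[OF Q, of d] unfolding pos_def_def by metis
next
  assume d: "\<forall>i. 0 < d i"
  have "0 < x \<bullet> (spectral Q d *v x)" if "x \<noteq> 0" for x
  proof -
    have "transpose Q *v x \<noteq> 0"
    proof
      assume "transpose Q *v x = 0"
      then have "Q *v (transpose Q *v x) = 0" by simp
      then show False using Q that
        by (simp add: matrix_vector_mul_assoc orthogonal_matrix_def del: transpose_matrix_vector)
    qed
    then obtain i where "(transpose Q *v x) $ i \<noteq> 0" by (auto simp: vec_eq_iff)
    then have "0 < d i * ((transpose Q *v x) $ i)\<^sup>2" using d by simp
    then show ?thesis unfolding spectral_quadratic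
      using d by (intro sum_pos2[of _ i]) (auto intro!: mult_nonneg_nonneg intro: less_imp_le)
  qed
  then show "pos_def (spectral Q d)" by (simp add: pos_def_def)
qed

section \<open>The Loewner order and the trace inner product\<close>

lemma pos_semidef_symm [simp]: "pos_semidef A \<Longrightarrow> A \<in> symm"
  and pos_def_symm [simp]: "pos_def A \<Longrightarrow> A \<in> symm"
  by (auto simp: pos_semidef_def pos_def_def)

lemma pos_def_imp_semidef: "pos_def A \<Longrightarrow> pos_semidef A"
  unfolding pos_def_def pos_semidef_def by (metis inner_zero_left less_imp_le order_refl)

lemma pos_semidef_0: "pos_semidef 0"
  by (simp add: pos_semidef_def)

lemma pos_def_mat_1: "pos_def (mat 1)"
  by (simp add: pos_def_def)

lemma pos_semidef_add: "pos_semidef A \<Longrightarrow> pos_semidef B \<Longrightarrow> pos_semidef (A + B)"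
  by (auto simp: pos_semidef_def matrix_vector_mult_add_rdistrib inner_add_right)

lemma pos_def_add: "pos_semidef A \<Longrightarrow> pos_def B \<Longrightarrow> pos_def (A + B)"
  unfolding pos_semidef_def pos_def_def
  by (simp add: matrix_vector_mult_add_rdistrib inner_add_right add_nonneg_pos)

lemma pos_semidef_scaleR: "pos_semidef A \<Longrightarrow> 0 \<le> c \<Longrightarrow> pos_semidef (c *\<^sub>R A)"
  by (auto simp: pos_semidef_def scaleR_matrix_vector)

lemma pos_def_scaleR: "pos_def A \<Longrightarrow> 0 < c \<Longrightarrow> pos_def (c *\<^sub>R A)"
  by (auto simp: pos_def_def scaleR_matrix_vector)

lemma congruence_quadratic:
  fixes A R :: "real^'n^'n"
  assumes "R \<in> symm"
  shows "x \<bullet> ((R ** A ** R) *v x) = (R *v x) \<bullet> (A *v (R *v x))"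
  using symm_adjoint[OF assms, of x "A *v (R *v x)"]
  by (simp add: matrix_vector_mul_assoc matrix_mul_assoc)

lemma pos_semidef_congruence:
  "R \<in> symm \<Longrightarrow> pos_semidef A \<Longrightarrow> pos_semidef (R ** A ** R)"
  using symm_congruence[of R A] by (auto simp: pos_semidef_def congruence_quadratic)

lemma loewner_le_iff:
  assumes "A \<in> symm" "B \<in> symm"
  shows "A \<preceq> B \<longleftrightarrow> (\<forall>x. x \<bullet> (A *v x) \<le> x \<bullet> (B *v x))"
  using assms
  by (simp add: loewner_le_def pos_semidef_def matrix_vector_mult_diff_rdistrib inner_diff_right)

lemma loewner_le_quadratic: "A \<preceq> B \<Longrightarrow> x \<bullet> (A *v x) \<le> x \<bullet> (B *v x)"
  by (simp add: loewner_le_def pos_semidef_def matrix_vector_mult_diff_rdistrib inner_diff_right)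

lemma loewner_le_trans [trans]: "A \<preceq> B \<Longrightarrow> B \<preceq> C \<Longrightarrow> A \<preceq> C"
  unfolding loewner_le_def using pos_semidef_add[of "B - A" "C - B"] by simp

lemma loewner_le_refl: "A \<preceq> A"
  by (simp add: loewner_le_def pos_semidef_0)

lemma loewner_le_add: "A \<preceq> B \<Longrightarrow> C \<preceq> D \<Longrightarrow> A + C \<preceq> B + D"
  unfolding loewner_le_def using pos_semidef_add[of "B - A" "D - C"] by (simp add: algebra_simps)

lemma loewner_le_scaleR: "A \<preceq> B \<Longrightarrow> 0 \<le> c \<Longrightarrow> c *\<^sub>R A \<preceq> c *\<^sub>R B"
  unfolding loewner_le_def using pos_semidef_scaleR[of "B - A" c] by (simp add: algebra_simps)

lemma loewner_le_congruence: "R \<in> symm \<Longrightarrow> A \<preceq> B \<Longrightarrow> R ** A ** R \<preceq> R ** B ** R"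
  unfolding loewner_le_def using pos_semidef_congruence[of R "B - A"]
  by (simp add: matrix_diff_ldistrib matrix_diff_rdistrib)

lemma pos_def_loewner_mono: "pos_def A \<Longrightarrow> A \<preceq> B \<Longrightarrow> pos_def B"
  unfolding loewner_le_def using pos_def_add[of "B - A" A] by simp

lemma pos_semidef_sqrt:
  assumes "pos_semidef A"
  obtains F where "pos_semidef F" "F ** F = A"
proof -
  obtain Q d where Q: "orthogonal_matrix Q" and A: "A = spectral Q d"
    using spectral_theorem[of A] assms by auto
  then have d: "\<forall>i. 0 \<le> d i" using assms pos_semidef_spectral_iff by blast
  have "pos_semidef (spectral Q (\<lambda>i. sqrt (d i)))"
    using Q d by (simp add: pos_semidef_spectral_iff)
  moreover have "spectral Q (\<lambda>i. sqrt (d i)) ** spectral Q (\<lambda>i. sqrt (d i)) = A"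
    using Q d by (simp add: spectral_mult A)
  ultimately show ?thesis using that by blast
qed

lemma inner_eq_trace_transpose: "A \<bullet> B = trace (transpose A ** B)" for A B :: "real^'n^'n"
proof -
  have "A \<bullet> B = (\<Sum>i\<in>UNIV. \<Sum>j\<in>UNIV. A $ i $ j * B $ i $ j)"
    by (simp add: inner_vec_def)
  also have "\<dots> = trace (transpose A ** B)"
    by (subst sum.swap) (simp add: trace_def matrix_matrix_mult_def transpose_def)
  finally show ?thesis .
qed

lemma inner_mult_left: "(A ** B) \<bullet> C = B \<bullet> (transpose A ** C)" for A B C :: "real^'n^'n"
  by (simp add: inner_eq_trace_transpose matrix_transpose_mul matrix_mul_assoc)

lemma inner_mult_right: "(A ** B) \<bullet> C = A \<bullet> (C ** transpose B)" for A B C :: "real^'n^'n"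
proof -
  have "trace (transpose B ** (transpose A ** C)) = trace (transpose A ** C ** transpose B)"
    by (rule trace_mul_sym)
  then show ?thesis by (simp add: inner_eq_trace_transpose matrix_transpose_mul matrix_mul_assoc)
qed

lemma inner_congruence:
  fixes A B R :: "real^'n^'n"
  assumes "R \<in> symm"
  shows "(R ** A ** R) \<bullet> B = A \<bullet> (R ** B ** R)"
  using assms inner_mult_left[of R A "B ** R"]
  by (simp add: inner_mult_right[of "R ** A"] symm_def matrix_mul_assoc)

lemma trace_nonneg:
  assumes "pos_semidef A"
  shows "0 \<le> trace A"
proof -
  have "A $ i $ i = axis i 1 \<bullet> (A *v axis i 1)" for i
    by (simp add: matrix_vector_mult_basis column_def inner_axis')
  then show ?thesis using assms by (auto simp: trace_def pos_semidef_def intro!: sum_nonneg)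
qed

lemma inner_pos_semidef:
  assumes A: "pos_semidef A" and B: "pos_semidef B"
  shows "0 \<le> A \<bullet> B"
proof -
  obtain F where F: "pos_semidef F" "F ** F = A" using pos_semidef_sqrt[OF A] .
  have "A \<bullet> B = (F ** mat 1 ** F) \<bullet> B" by (simp add: F)
  also have "\<dots> = mat 1 \<bullet> (F ** B ** F)" using F by (subst inner_congruence) auto
  also have "\<dots> = trace (F ** B ** F)" by (simp add: inner_eq_trace)
  finally show ?thesis
    using trace_nonneg[OF pos_semidef_congruence[OF pos_semidef_symm[OF F(1)] B]] by simp
qed

lemma inner_loewner_mono: "A \<preceq> B \<Longrightarrow> pos_semidef P \<Longrightarrow> A \<bullet> P \<le> B \<bullet> P"
  unfolding loewner_le_def using inner_pos_semidef[of "B - A" P] by (simp add: inner_diff_left)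

text \<open>With \<open>A = F\<^sup>2\<close> and \<open>B = G\<^sup>2\<close> the inner product is the squared norm of \<open>G F\<close>.\<close>

lemma inner_pos_semidef_eq_0:
  assumes A: "pos_semidef A" and B: "pos_semidef B" and 0: "A \<bullet> B = 0"
  shows "A ** B = 0"
proof -
  obtain F where F: "pos_semidef F" "F ** F = A" using pos_semidef_sqrt[OF A] .
  obtain G where G: "pos_semidef G" "G ** G = B" using pos_semidef_sqrt[OF B] .
  have t: "transpose F = F" "transpose G = G"
    using F(1) G(1) pos_semidef_symm by (auto simp: symm_def)
  have "(F ** G) \<bullet> (F ** G) = A \<bullet> B"
  proof -
    have "(F ** G) \<bullet> (F ** G) = G \<bullet> (A ** G)"
      by (simp add: inner_mult_left[of F] t matrix_mul_assoc F(2))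
    also have "\<dots> = A \<bullet> (G ** G)"
      using inner_mult_right[of A G G] by (simp add: t inner_commute)
    finally show ?thesis by (simp add: G(2))
  qed
  then have "F ** G = 0" using 0 by simp
  then have "F ** (F ** G) ** G = 0" by simp
  then show ?thesis by (simp add: matrix_mul_assoc F) (simp add: G flip: matrix_mul_assoc)
qed

lemma norm_loewner_mono:
  assumes A: "pos_semidef A" and AB: "A \<preceq> B"
  shows "norm A \<le> norm B"
proof -
  have B: "pos_semidef B" using pos_semidef_add[OF A AB[unfolded loewner_le_def]] by simp
  have "A \<bullet> A \<le> B \<bullet> A" by (rule inner_loewner_mono[OF AB A])
  also have "\<dots> \<le> B \<bullet> B" using inner_loewner_mono[OF AB B] by (simp add: inner_commute)
  finally show ?thesis by (simp add: norm_eq_sqrt_inner)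
qed

lemma norm_sq_rows: "(norm A)\<^sup>2 = (\<Sum>i\<in>UNIV. (norm (A $ i))\<^sup>2)" for A :: "real^'n^'n"
  unfolding power2_norm_eq_inner by (rule inner_vec_def)

lemma norm_matrix_vector: "norm (A *v x) \<le> norm A * norm x" for A :: "real^'n^'n"
proof -
  have "(norm (A *v x))\<^sup>2 = (\<Sum>i\<in>UNIV. (A $ i \<bullet> x)\<^sup>2)"
    by (simp add: power2_norm_eq_inner inner_vec_def[of "A *v x"] matrix_vector_mul_component)
      (simp add: power2_eq_square)
  also have "\<dots> \<le> (\<Sum>i\<in>UNIV. (norm (A $ i))\<^sup>2 * (norm x)\<^sup>2)"
    by (intro sum_mono) (metis Cauchy_Schwarz_ineq power2_norm_eq_inner)
  also have "\<dots> = (norm A * norm x)\<^sup>2"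
    by (simp add: power_mult_distrib norm_sq_rows sum_distrib_right)
  finally show ?thesis by (rule power2_le_imp_le) simp
qed

lemma norm_transpose: "norm (transpose A) = norm A" for A :: "real^'n^'n"
proof -
  have "transpose A \<bullet> transpose A = A \<bullet> A"
    by (simp add: inner_eq_trace_transpose) (rule trace_mul_sym)
  then show ?thesis by (simp add: norm_eq_sqrt_inner)
qed

lemma norm_matrix_mult: "norm (A ** B) \<le> norm A * norm B" for A B :: "real^'n^'n"
proof -
  have row: "(A ** B) $ i = transpose B *v (A $ i)" for i
    by (simp add: vec_eq_iff matrix_matrix_mult_def vector_matrix_mult_def)
  have "(norm (A ** B))\<^sup>2 = (\<Sum>i\<in>UNIV. (norm (transpose B *v (A $ i)))\<^sup>2)"
    by (simp only: power2_norm_eq_inner inner_vec_def[of "A ** B"] row)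
  also have "\<dots> \<le> (\<Sum>i\<in>UNIV. (norm B * norm (A $ i))\<^sup>2)"
    by (intro sum_mono power_mono) (metis norm_matrix_vector norm_transpose, simp)
  also have "\<dots> = (norm A * norm B)\<^sup>2"
    by (simp add: power_mult_distrib norm_sq_rows[of A] sum_distrib_left mult.commute)
  finally show ?thesis by (rule power2_le_imp_le) simp
qed

lemma quadratic_le_norm: "x \<bullet> (A *v x) \<le> norm A * (x \<bullet> x)" for A :: "real^'n^'n"
proof -
  have "x \<bullet> (A *v x) \<le> norm x * norm (A *v x)" by (rule norm_cauchy_schwarz)
  also have "\<dots> \<le> norm x * (norm A * norm x)" by (intro mult_left_mono norm_matrix_vector) simp
  finally show ?thesis by (simp add: dot_square_norm power2_eq_square mult_ac)
qed

lemma loewner_le_norm: "A \<in> symm \<Longrightarrow> A \<preceq> norm A *\<^sub>R mat 1"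
  by (simp add: loewner_le_iff scaleR_matrix_vector quadratic_le_norm)

lemma pos_def_lower_bound:
  assumes "pos_def A"
  obtains a where "a > 0" "a *\<^sub>R mat 1 \<preceq> A"
proof -
  obtain Q d where Q: "orthogonal_matrix Q" and A: "A = spectral Q d"
    using spectral_theorem[of A] assms by auto
  then have d: "\<forall>i. 0 < d i" using assms pos_def_spectral_iff by blast
  define a where "a = Min (range d)"
  have a: "a > 0" "\<And>i. a \<le> d i" using d by (auto simp: a_def)
  have "a *\<^sub>R mat 1 = spectral Q (\<lambda>_. a)"
  proof -
    have "spectral Q (\<lambda>_. a) = a *\<^sub>R spectral Q (\<lambda>_. 1)"
    proof -
      have "diag_mat (\<lambda>_. a) = (a *\<^sub>R diag_mat (\<lambda>_. 1) :: real^'a^'a)"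
        by (simp add: diag_mat_def vec_eq_iff)
      then show ?thesis by (simp add: spectral_def matrix_distribs)
    qed
    then show ?thesis using Q by (simp add: spectral_one)
  qed
  then have "a *\<^sub>R mat 1 \<preceq> A"
    using a Q by (simp add: loewner_le_def A spectral_diff pos_semidef_spectral_iff)
  with a that show ?thesis by blast
qed

text \<open>Positive definiteness is an open condition within the symmetric matrices.\<close>

lemma pos_def_nearby:
  assumes "pos_def A"
  obtains a where "a > 0"
    "\<forall>Z\<in>symm. norm (Z - A) \<le> a \<longrightarrow> a *\<^sub>R mat 1 \<preceq> Z \<and> pos_def Z"
proof -
  obtain b where b: "b > 0" "b *\<^sub>R mat 1 \<preceq> A" using pos_def_lower_bound[OF assms] .
  have le: "(b/2) *\<^sub>R mat 1 \<preceq> Z" if Z: "Z \<in> symm" "norm (Z - A) \<le> b / 2" for Z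
  proof -
    have "(b/2) * (x \<bullet> x) \<le> x \<bullet> (Z *v x)" for x
    proof -
      have "b * (x \<bullet> x) \<le> x \<bullet> (A *v x)"
        using loewner_le_quadratic[OF b(2), of x] by (simp add: scaleR_matrix_vector)
      moreover have "x \<bullet> ((A - Z) *v x) \<le> (b/2) * (x \<bullet> x)"
        using quadratic_le_norm[of x "A - Z"] Z(2)
        by (smt (verit, best) inner_ge_zero mult_right_mono norm_minus_commute)
      ultimately show ?thesis
        by (simp add: matrix_vector_mult_diff_rdistrib inner_diff_right)
    qed
    then show ?thesis using Z by (simp add: loewner_le_iff scaleR_matrix_vector)
  qed
  moreover have "pos_def ((b/2) *\<^sub>R mat 1)" using b by (intro pos_def_scaleR pos_def_mat_1) simp
  ultimately show ?thesis using that[of "b/2"] b pos_def_loewner_mono by auto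
qed

section \<open>Inverses and log-determinants of positive definite matrices\<close>

lemma matrix_inv_unique: "A ** B = mat 1 \<Longrightarrow> matrix_inv A = B" for A B :: "real^'n^'n"
proof -
  assume AB: "A ** B = mat 1"
  then have BA: "B ** A = mat 1" by (simp add: matrix_left_right_inverse)
  have "A ** matrix_inv A = mat 1 \<and> matrix_inv A ** A = mat 1"
    unfolding matrix_inv_def by (rule someI[of _ B]) (use AB BA in simp)
  then have "B ** (A ** matrix_inv A) = B" by simp
  then show "matrix_inv A = B" by (simp add: matrix_mul_assoc BA)
qed

lemma pos_def_inverse:
  assumes "pos_def A"
  shows pos_def_det: "0 < det A"
    and pos_def_matrix_inv: "pos_def (matrix_inv A)"
    and pos_def_inv_right: "A ** matrix_inv A = mat 1"
    and pos_def_inv_left: "matrix_inv A ** A = mat 1"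
proof -
  obtain Q d where Q: "orthogonal_matrix Q" and A: "A = spectral Q d"
    using spectral_theorem[of A] assms by auto
  then have d: "\<forall>i. 0 < d i" using assms pos_def_spectral_iff by blast
  show "0 < det A" using Q d by (simp add: A det_spectral prod_pos)
  have "d i * inverse (d i) = 1" for i using d[rule_format, of i] by simp
  then have *: "A ** spectral Q (\<lambda>i. inverse (d i)) = mat 1"
    using Q by (simp add: A spectral_mult spectral_one)
  have inv: "matrix_inv A = spectral Q (\<lambda>i. inverse (d i))"
    by (rule matrix_inv_unique[OF *])
  show "pos_def (matrix_inv A)" using Q d by (simp add: inv pos_def_spectral_iff)
  show "A ** matrix_inv A = mat 1" using * inv by simp
  then show "matrix_inv A ** A = mat 1" by (simp add: matrix_left_right_inverse)
qed

lemma pos_def_inv_symm [simp]: "pos_def A \<Longrightarrow> matrix_inv A \<in> symm"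
  by (rule pos_def_symm[OF pos_def_matrix_inv])

lemma matrix_inv_matrix_inv: "pos_def A \<Longrightarrow> matrix_inv (matrix_inv A) = A"
  by (rule matrix_inv_unique) (rule pos_def_inv_left)

lemma pos_semidef_det_nonzero:
  assumes "pos_semidef A" "det A \<noteq> 0"
  shows "pos_def A"
proof -
  obtain Q d where Q: "orthogonal_matrix Q" and A: "A = spectral Q d"
    using spectral_theorem[of A] assms by auto
  then have "\<forall>i. 0 \<le> d i" using assms pos_semidef_spectral_iff by blast
  moreover have "\<forall>i. d i \<noteq> 0" using assms(2) Q by (simp add: A det_spectral)
  ultimately have "\<forall>i. 0 < d i" by (simp add: order_less_le)
  then show ?thesis using Q by (simp add: A pos_def_spectral_iff)
qed

text \<open>Antitonicity of the inverse: expand the square of the \<open>A\<close>-norm of \<open>A\<^sup>-\<^sup>1 v - B\<^sup>-\<^sup>1 v\<close>.\<close>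

lemma matrix_inv_antimono:
  assumes A: "pos_def A" and AB: "A \<preceq> B"
  shows "matrix_inv B \<preceq> matrix_inv A"
proof -
  have B: "pos_def B" using pos_def_loewner_mono[OF A AB] .
  have "v \<bullet> (matrix_inv B *v v) \<le> v \<bullet> (matrix_inv A *v v)" for v
  proof -
    define w where "w = matrix_inv A *v v"
    define u where "u = matrix_inv B *v v"
    have Aw: "A *v w = v" and Bu: "B *v u = v"
      by (simp_all add: w_def u_def matrix_vector_mul_assoc pos_def_inv_right A B)
    have "0 \<le> (w - u) \<bullet> (A *v (w - u))"
      using pos_def_imp_semidef[OF A] by (simp add: pos_semidef_def)
    also have "\<dots> = w \<bullet> v - 2 * (u \<bullet> v) + u \<bullet> (A *v u)"
      using symm_adjoint[OF pos_def_symm[OF A], of w u]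
      by (simp add: algebra_simps Aw inner_commute)
    also have "u \<bullet> (A *v u) \<le> u \<bullet> v"
      using loewner_le_quadratic[OF AB, of u] by (simp add: Bu)
    finally show ?thesis by (simp add: w_def u_def inner_commute)
  qed
  then show ?thesis using A B by (simp add: loewner_le_iff)
qed

lemma matrix_inv_scaleR: "pos_def A \<Longrightarrow> c \<noteq> 0 \<Longrightarrow> matrix_inv (c *\<^sub>R A) = (1/c) *\<^sub>R matrix_inv A"
  by (rule matrix_inv_unique) (simp add: matrix_distribs pos_def_inv_right)

lemma matrix_inv_diff:
  assumes "pos_def A" "pos_def B"
  shows "matrix_inv A - matrix_inv B = matrix_inv A ** (B - A) ** matrix_inv B"
proof -
  have "matrix_inv A ** (B - A) ** matrix_inv B
      = matrix_inv A ** (B ** matrix_inv B) - matrix_inv A ** A ** matrix_inv B"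
    by (simp only: matrix_diff_ldistrib matrix_diff_rdistrib matrix_mul_assoc)
  then show ?thesis using assms by (simp add: pos_def_inv_left pos_def_inv_right)
qed

lemma matrix_inv_tendsto:
  fixes A :: "real^'n^'n"
  assumes A: "pos_def A"
  shows "(matrix_inv \<longlongrightarrow> matrix_inv A) (at A within symm)"
proof -
  obtain a where a: "a > 0"
    and near: "\<forall>Z\<in>symm. norm (Z - A) \<le> a \<longrightarrow> a *\<^sub>R mat 1 \<preceq> Z \<and> pos_def Z"
    using pos_def_nearby[OF A] .
  let ?K = "norm ((1/a) *\<^sub>R (mat 1 :: real^'n^'n))"
  have bound: "norm (matrix_inv Z - matrix_inv A) \<le> ?K * norm (Z - A) * norm (matrix_inv A)"
    if Z: "Z \<in> symm" "norm (Z - A) \<le> a" for Z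
  proof -
    have Z': "a *\<^sub>R mat 1 \<preceq> Z" "pos_def Z" using near Z by auto
    have 1: "pos_def (a *\<^sub>R mat 1 :: real^'n^'n)" using a by (intro pos_def_scaleR pos_def_mat_1)
    have "matrix_inv Z \<preceq> matrix_inv (a *\<^sub>R mat 1)"
      by (rule matrix_inv_antimono[OF 1 Z'(1)])
    also have "matrix_inv (a *\<^sub>R mat 1) = (1/a) *\<^sub>R (mat 1 :: real^'n^'n)"
      using a by (intro matrix_inv_unique) (simp add: matrix_distribs)
    finally have K: "norm (matrix_inv Z) \<le> ?K"
      by (intro norm_loewner_mono pos_def_imp_semidef pos_def_matrix_inv Z')
    have "norm (matrix_inv Z - matrix_inv A)
        \<le> norm (matrix_inv Z ** (A - Z)) * norm (matrix_inv A)"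
      unfolding matrix_inv_diff[OF Z'(2) A] by (rule norm_matrix_mult)
    also have "\<dots> \<le> (norm (matrix_inv Z) * norm (A - Z)) * norm (matrix_inv A)"
      by (intro mult_right_mono norm_matrix_mult) simp
    also have "\<dots> \<le> ?K * norm (Z - A) * norm (matrix_inv A)"
      unfolding norm_minus_commute[of A Z] by (intro mult_right_mono K) simp_all
    finally show ?thesis .
  qed
  have ev: "\<forall>\<^sub>F Z in at A within symm. norm (Z - A) \<le> a"
    unfolding eventually_at using a by (intro exI[of _ a]) (auto simp: dist_norm)
  have sym: "\<forall>\<^sub>F Z in at A within symm. Z \<in> symm"
    by (simp add: eventually_at_filter)
  have "((\<lambda>Z. matrix_inv Z - matrix_inv A) \<longlongrightarrow> 0) (at A within symm)"
  proof (rule Lim_null_comparison)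
    show "\<forall>\<^sub>F Z in at A within symm.
        norm (matrix_inv Z - matrix_inv A) \<le> ?K * norm (Z - A) * norm (matrix_inv A)"
      using eventually_conj[OF ev sym] by (rule eventually_mono) (use bound in blast)
    have "((\<lambda>Z. ?K * norm (Z - A) * norm (matrix_inv A)) \<longlongrightarrow>
        ?K * norm (A - A) * norm (matrix_inv A)) (at A within symm)"
      by (intro tendsto_intros)
    then show "((\<lambda>Z. ?K * norm (Z - A) * norm (matrix_inv A)) \<longlongrightarrow> 0) (at A within symm)"
      by simp
  qed
  then show ?thesis by (simp add: LIM_zero_cancel)
qed

text \<open>Concavity of the log-determinant. Whitening by \<open>F = A\<^sup>-\<^sup>1\<^sup>/\<^sup>2\<close> reduces the tangent
  inequality to \<open>ln t \<le> t - 1\<close> for the eigenvalues of \<open>F B F\<close>.\<close>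

lemma ln_det_concave:
  fixes A B :: "real^'n^'n"
  assumes A: "pos_def A" and B: "pos_def B"
  shows "ln (det B) - ln (det A) \<le> matrix_inv A \<bullet> (B - A)"
proof -
  obtain F where F: "pos_semidef F" "F ** F = matrix_inv A"
    using pos_semidef_sqrt[OF pos_def_imp_semidef[OF pos_def_matrix_inv[OF A]]] .
  have detF: "det F * det F * det A = 1"
    using arg_cong[OF pos_def_inv_left[OF A], of det] by (simp add: det_mul flip: F(2))
  let ?M = "F ** B ** F"
  have psd: "pos_semidef ?M" using F B by (intro pos_semidef_congruence pos_def_imp_semidef) auto
  have detM: "det ?M * det A = det B" using detF
    by (simp add: det_mul)
  then have pM: "pos_def ?M"
    using psd pos_def_det[OF B] by (intro pos_semidef_det_nonzero) auto
  obtain Q d where Q: "orthogonal_matrix Q" and M: "?M = spectral Q d"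
    using spectral_theorem[of ?M] psd by auto
  then have d: "\<And>i. 0 < d i" using pM pos_def_spectral_iff by metis
  have "ln (det B) - ln (det A) = ln (det ?M)"
    using detM pos_def_det[OF A] pos_def_det[OF pM] by (simp add: ln_mult flip: detM)
  also have "\<dots> = (\<Sum>i\<in>UNIV. ln (d i))"
    using d by (subst ln_prod[symmetric]) (auto simp: M det_spectral[OF Q] less_imp_neq[THEN not_sym])
  also have "\<dots> \<le> (\<Sum>i\<in>UNIV. d i - 1)"
    by (intro sum_mono ln_le_minus_one d)
  also have "\<dots> = trace ?M - CARD('n)"
    by (simp add: M trace_spectral[OF Q] sum_subtractf)
  also have "trace ?M = matrix_inv A \<bullet> B"
  proof -
    have "trace ?M = mat 1 \<bullet> ?M" by (simp add: inner_eq_trace)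
    also have "\<dots> = (F ** mat 1 ** F) \<bullet> B" 
      using inner_congruence[OF pos_semidef_symm[OF F(1)], of "mat 1" B] by simp
    finally show ?thesis by (simp add: F)
  qed
  also have "real CARD('n) = matrix_inv A \<bullet> A"
    using A by (simp add: inner_eq_trace pos_def_inv_left trace_I)
  finally show ?thesis by (simp add: inner_diff_right)
qed

lemma ln_det_mono: "pos_def A \<Longrightarrow> A \<preceq> B \<Longrightarrow> ln (det A) \<le> ln (det B)"
proof -
  assume A: "pos_def A" and AB: "A \<preceq> B"
  have B: "pos_def B" using pos_def_loewner_mono[OF A AB] .
  have "0 \<le> (B - A) \<bullet> matrix_inv B"
    using AB pos_def_matrix_inv[OF B]
    by (intro inner_pos_semidef) (auto simp: loewner_le_def pos_def_imp_semidef)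
  then show ?thesis using ln_det_concave[OF B A] by (simp add: inner_diff_right inner_diff_left inner_commute)
qed

section \<open>Derivative of the log-determinant\<close>

lemma continuous_on_det:
  fixes f :: "'a::topological_space \<Rightarrow> real^'n^'n"
  assumes "continuous_on S f"
  shows "continuous_on S (\<lambda>x. det (f x))"
  unfolding det_def using assms by (intro continuous_intros)

text \<open>A continuous selection \<open>G\<close> of subgradients is a gradient: the subgradient inequalities at
  \<open>X\<close> and at \<open>Z\<close> put the remainder between \<open>0\<close> and \<open>(G Z - G X) \<bullet> (Z - X)\<close>. This yields the
  derivatives of \<open>ln det\<close> and of the conjugate of \<open>h\<close>.\<close>

lemma has_derivative_from_subgradients:
  fixes F :: "'a::euclidean_space \<Rightarrow> real" and G :: "'a \<Rightarrow> 'a"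
  assumes G: "(G \<longlongrightarrow> G X) (at X within S)"
    and lo: "\<forall>\<^sub>F Z in at X within S. G X \<bullet> (Z - X) \<le> F Z - F X"
    and up: "\<forall>\<^sub>F Z in at X within S. F Z - F X \<le> G Z \<bullet> (Z - X)"
  shows "(F has_derivative (\<lambda>H. G X \<bullet> H)) (at X within S)"
  unfolding has_derivative_iff_norm
proof (intro conjI)
  show "bounded_linear (\<lambda>H. G X \<bullet> H)" by (rule bounded_linear_inner_right)
  have "((\<lambda>Z. norm (G Z - G X)) \<longlongrightarrow> 0) (at X within S)"
    using G by (simp add: tendsto_norm_zero LIM_zero)
  then show "((\<lambda>Z. norm (F Z - F X - G X \<bullet> (Z - X)) / norm (Z - X)) \<longlongrightarrow> 0) (at X within S)"
  proof (rule Lim_null_comparison[rotated])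
    show "\<forall>\<^sub>F Z in at X within S.
        norm (norm (F Z - F X - G X \<bullet> (Z - X)) / norm (Z - X)) \<le> norm (G Z - G X)"
      using lo up
    proof eventually_elim
      case (elim Z)
      have "norm (F Z - F X - G X \<bullet> (Z - X)) \<le> (G Z - G X) \<bullet> (Z - X)"
        using elim by (simp add: inner_diff_left)
      also have "\<dots> \<le> norm (G Z - G X) * norm (Z - X)" by (rule norm_cauchy_schwarz)
      finally show ?case by (simp add: divide_le_eq)
    qed
  qed
qed

lemma pos_def_eventually:
  assumes "pos_def A"
  shows "\<forall>\<^sub>F Z in at A within symm. pos_def Z"
proof -
  obtain a where a: "a > 0"
    and near: "\<forall>Z\<in>symm. norm (Z - A) \<le> a \<longrightarrow> a *\<^sub>R mat 1 \<preceq> Z \<and> pos_def Z"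
    using pos_def_nearby[OF assms] .
  then show ?thesis
    unfolding eventually_at by (intro exI[of _ a]) (auto simp: dist_norm)
qed

lemma neg_ln_det_has_derivative:
  fixes A :: "real^'n^'n"
  assumes A: "pos_def A"
  shows "((\<lambda>Z. - ln (det Z)) has_derivative (\<lambda>H. (- matrix_inv A) \<bullet> H)) (at A within symm)"
proof (rule has_derivative_from_subgradients[where G = "\<lambda>Z. - matrix_inv Z"])
  show "((\<lambda>Z. - matrix_inv Z) \<longlongrightarrow> - matrix_inv A) (at A within symm)"
    by (intro tendsto_minus matrix_inv_tendsto A)
  show "\<forall>\<^sub>F Z in at A within symm. - matrix_inv A \<bullet> (Z - A) \<le> - ln (det Z) - - ln (det A)"
    using pos_def_eventually[OF A]
  proof eventually_elim
    case (elim Z)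
    show ?case using ln_det_concave[OF A elim] by simp
  qed
  show "\<forall>\<^sub>F Z in at A within symm. - ln (det Z) - - ln (det A) \<le> - matrix_inv Z \<bullet> (Z - A)"
    using pos_def_eventually[OF A]
  proof eventually_elim
    case (elim Z)
    show ?case using ln_det_concave[OF elim A] by (simp add: inner_diff_right)
  qed
qed

lemma ln_det_line_derivative:
  fixes A D :: "real^'n^'n"
  assumes A: "pos_def (A + t *\<^sub>R D)" and AD: "A \<in> symm" "D \<in> symm"
  shows "((\<lambda>t. ln (det (A + t *\<^sub>R D))) has_real_derivative (matrix_inv (A + t *\<^sub>R D) \<bullet> D)) (at t)"
proof -
  have "((\<lambda>Z. - ln (det Z)) has_derivative (\<lambda>H. (- matrix_inv (A + t *\<^sub>R D)) \<bullet> H))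
      (at (A + t *\<^sub>R D) within range (\<lambda>t. A + t *\<^sub>R D))"
    using neg_ln_det_has_derivative[OF A] by (rule has_derivative_subset) (use AD in auto)
  then have "((\<lambda>t. - ln (det (A + t *\<^sub>R D))) has_derivative
      (\<lambda>u. (- matrix_inv (A + t *\<^sub>R D)) \<bullet> (u *\<^sub>R D))) (at t)"
    by (rule has_derivative_in_compose[rotated]) (auto intro!: derivative_eq_intros)
  from has_derivative_minus[OF this] show ?thesis
    by (simp add: has_field_derivative_def mult.commute[of _ "_ \<bullet> _"])
qed

text \<open>First-order necessary condition, in the form of a variational inequality.\<close>

lemma minimizer_variational_inequality:
  fixes F :: "'a::euclidean_space \<Rightarrow> real"
  assumes F: "(F has_derivative (\<lambda>H. G \<bullet> H)) (at X within S)"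
    and S: "convex S" "X \<in> S" "W \<in> S" and min: "\<And>Z. Z \<in> S \<Longrightarrow> F X \<le> F Z"
  shows "0 \<le> G \<bullet> (W - X)"
proof -
  let ?l = "\<lambda>t::real. X + t *\<^sub>R (W - X)"
  have in_S: "?l t \<in> S" if "t \<in> {0..1}" for t
    using that convexD_alt[OF S, of t] by (simp add: algebra_simps)
  have "(F has_derivative (\<lambda>H. G \<bullet> H)) (at (?l 0) within ?l ` {0..1})"
    using F by (simp, elim has_derivative_subset) (use in_S in auto)
  then have "((\<lambda>t. F (?l t)) has_derivative (\<lambda>u. G \<bullet> (u *\<^sub>R (W - X)))) (at 0 within {0..1})"
    by (rule has_derivative_in_compose[rotated]) (auto intro!: derivative_eq_intros)
  then have "((\<lambda>t. F (?l t)) has_real_derivative (G \<bullet> (W - X))) (at 0 within {0..1})"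
    by (simp add: has_field_derivative_def mult.commute[of _ "_ \<bullet> _"])
  then have lim: "((\<lambda>t. (F (?l t) - F X) / t) \<longlongrightarrow> G \<bullet> (W - X)) (at 0 within {0..1})"
    by (simp add: has_field_derivative_iff)
  show ?thesis
  proof (rule tendsto_lowerbound[OF lim])
    show "\<forall>\<^sub>F t in at 0 within {0..1}. 0 \<le> (F (?l t) - F X) / t"
      unfolding eventually_at_filter
      by (rule always_eventually) (use min[OF in_S] in auto)
    show "at (0::real) within {0..1} \<noteq> bot"
      by (simp add: at_within_Icc_at_right)
  qed
qed

section \<open>Comparing two log-determinants along a segment\<close>

text \<open>The form on the right-hand side measures curvature. It is monotone in each of the two
  inverses, so Loewner bounds on them translate into bounds on the distance of \<open>ln det\<close> from its
  tangents.\<close>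

lemma matrix_inv_diff_inner:
  assumes "pos_def A" "pos_def (A + t *\<^sub>R D)" "D \<in> symm"
  shows "(matrix_inv A - matrix_inv (A + t *\<^sub>R D)) \<bullet> D
       = t * (matrix_inv A \<bullet> (D ** matrix_inv (A + t *\<^sub>R D) ** D))"
proof -
  let ?V = "matrix_inv (A + t *\<^sub>R D)"
  have t: "transpose D = D" "transpose ?V = ?V"
    using assms pos_def_inv_symm by (auto simp: symm_def)
  have "matrix_inv A - ?V = t *\<^sub>R (matrix_inv A ** (D ** ?V))"
    using matrix_inv_diff[OF assms(1,2)] by (simp add: matrix_distribs matrix_mul_assoc)
  then have "(matrix_inv A - ?V) \<bullet> D = t * ((matrix_inv A ** (D ** ?V)) \<bullet> D)" by simp
  also have "(matrix_inv A ** (D ** ?V)) \<bullet> D = matrix_inv A \<bullet> (D ** transpose (D ** ?V))"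
    by (rule inner_mult_right)
  also have "D ** transpose (D ** ?V) = D ** ?V ** D"
    by (simp add: matrix_transpose_mul t matrix_mul_assoc)
  finally show ?thesis .
qed

text \<open>If \<open>B\<close> dominates \<open>m A\<close> with \<open>m\<close> close to \<open>lam\<close>, the curvature of \<open>lam ln det\<close> at \<open>B\<close> is a
  proper fraction of the curvature of \<open>ln det\<close> at \<open>A\<close>: one factor \<open>1/m\<close> comes from \<open>B\<^sup>-\<^sup>1\<close>, and a
  further factor from \<open>B\<^sub>t\<^sup>-\<^sup>1\<close>, because \<open>B\<^sub>t\<close> exceeds \<open>A\<^sub>t\<close> by at least \<open>(m - 1) A\<close>. Hence
  \<open>lam ln det (B + \<sqdot>) - ln det (A + \<sqdot>)\<close> lies above its tangent at \<open>0\<close>, quadratically, although it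
  need not be a convex function.\<close>

lemma ln_det_difference_above_tangent:
  fixes A B D :: "real^'n^'n"
  assumes A: "pos_def A" and AD: "pos_def (A + D)" and D: "D \<in> symm"
    and AB: "m *\<^sub>R A \<preceq> B" and m: "1 \<le> m" and K: "1 \<le> K" "A + D \<preceq> K *\<^sub>R A"
    and lam: "0 \<le> lam" "\<theta> \<le> 1" "lam \<le> \<theta> * (m * (1 + (m - 1) / K))"
  shows "(lam *\<^sub>R matrix_inv B - matrix_inv A) \<bullet> D
         + (1 - \<theta>) / (2 * K) * (matrix_inv A \<bullet> (D ** matrix_inv A ** D))
       \<le> lam * (ln (det (B + D)) - ln (det B)) - (ln (det (A + D)) - ln (det A))"
proof -
  define \<kappa> where "\<kappa> = 1 + (m - 1) / K"
  have \<kappa>: "\<kappa> \<ge> 1" using m K by (simp add: \<kappa>_def)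
  define c where "c = (1 - \<theta>) / (2 * K)"
  define q where "q = matrix_inv A \<bullet> (D ** matrix_inv A ** D)"
  define G where "G = (lam *\<^sub>R matrix_inv B - matrix_inv A) \<bullet> D"
  define \<phi> where "\<phi> t = lam * ln (det (B + t *\<^sub>R D)) - ln (det (A + t *\<^sub>R D))
    - (t * G + t\<^sup>2 * (c * q))" for t
  (* \<phi> t is the gap between the two sides of the claim for t D in place of D. It vanishes at t = 0,
     and its derivative is t times a difference of curvatures, hence nonnegative. *)
  have As: "A \<in> symm" using A by simp
  have mA: "pos_def (m *\<^sub>R A)" using A m by (intro pos_def_scaleR) auto
  have B: "pos_def B" by (rule pos_def_loewner_mono[OF mA AB])
  have "\<exists>y. (\<phi> has_real_derivative y) (at t) \<and> 0 \<le> y" if t: "0 \<le> t" "t \<le> 1" for t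
  proof -
    let ?At = "A + t *\<^sub>R D" and ?Bt = "B + t *\<^sub>R D"
    have At_eq: "?At = (1 - t) *\<^sub>R A + t *\<^sub>R (A + D)" by (simp add: algebra_simps)
    have At: "pos_def ?At"
    proof (cases "t = 1")
      case False
      then have "pos_def ((1 - t) *\<^sub>R A)" using t A by (intro pos_def_scaleR) auto
      moreover have "pos_semidef (t *\<^sub>R (A + D))"
        using t AD by (intro pos_semidef_scaleR pos_def_imp_semidef)
      ultimately show ?thesis unfolding At_eq by (metis pos_def_add add.commute)
    qed (use AD in simp)
    have AtK: "?At \<preceq> K *\<^sub>R A"
    proof -
      have "(1 - t) *\<^sub>R A \<preceq> (1 - t) *\<^sub>R (K *\<^sub>R A)"
        using pos_semidef_scaleR[OF pos_def_imp_semidef[OF A], of "K - 1"] K t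
        by (intro loewner_le_scaleR) (auto simp: loewner_le_def algebra_simps)
      from loewner_le_add[OF this loewner_le_scaleR[OF K(2) t(1)]]
      have "?At \<preceq> ((1 - t) * K + t * K) *\<^sub>R A"
        unfolding At_eq by (simp flip: scaleR_left_distrib)
      then show ?thesis by (simp add: left_diff_distrib)
    qed
    have AtBt: "\<kappa> *\<^sub>R ?At \<preceq> ?Bt"
    proof -
      have "((m - 1) / K) *\<^sub>R ?At \<preceq> ((m - 1) / K) *\<^sub>R (K *\<^sub>R A)"
        using m K by (intro loewner_le_scaleR AtK) simp
      then have "((m - 1) / K) *\<^sub>R ?At \<preceq> (m - 1) *\<^sub>R A" using K by simp
      from loewner_le_add[OF loewner_le_refl[of ?At] this]
      have "\<kappa> *\<^sub>R ?At \<preceq> m *\<^sub>R A + t *\<^sub>R D" by (simp add: \<kappa>_def algebra_simps)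
      then show ?thesis
        by (rule loewner_le_trans) (use AB in \<open>simp add: loewner_le_def\<close>)
    qed
    have \<kappa>At: "pos_def (\<kappa> *\<^sub>R ?At)" using At \<kappa> by (intro pos_def_scaleR) auto
    have Bt: "pos_def ?Bt" by (rule pos_def_loewner_mono[OF \<kappa>At AtBt])
    have iB: "matrix_inv B \<preceq> (1/m) *\<^sub>R matrix_inv A"
      using matrix_inv_antimono[OF mA AB] m by (simp add: matrix_inv_scaleR[OF A])
    have iBt: "matrix_inv ?Bt \<preceq> (1/\<kappa>) *\<^sub>R matrix_inv ?At"
      using matrix_inv_antimono[OF \<kappa>At AtBt] \<kappa> by (simp add: matrix_inv_scaleR[OF At])
    have iAt: "(1/K) *\<^sub>R matrix_inv A \<preceq> matrix_inv ?At"
      using matrix_inv_antimono[OF At AtK] K by (simp add: matrix_inv_scaleR[OF A])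
    define p where "p = matrix_inv A \<bullet> (D ** matrix_inv ?At ** D)"
    define r where "r = matrix_inv B \<bullet> (D ** matrix_inv ?Bt ** D)"
    have psd: "pos_semidef (matrix_inv A)" "pos_semidef (matrix_inv ?At)"
        "pos_semidef (matrix_inv ?Bt)" "pos_semidef (D ** matrix_inv ?Bt ** D)"
      by (intro pos_semidef_congruence D pos_def_imp_semidef pos_def_matrix_inv A At Bt)+
    have p0: "0 \<le> p" unfolding p_def
      by (intro inner_pos_semidef psd pos_semidef_congruence D)
    have "r \<le> (1/m) * (matrix_inv A \<bullet> (D ** matrix_inv ?Bt ** D))"
      using inner_loewner_mono[OF iB psd(4)] by (simp add: r_def)
    also have "matrix_inv A \<bullet> (D ** matrix_inv ?Bt ** D) \<le> (1/\<kappa>) * p"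
      using inner_loewner_mono[OF loewner_le_congruence[OF D iBt] psd(1)]
      by (simp add: p_def inner_commute matrix_distribs)
    finally have r: "r \<le> (1/m) * ((1/\<kappa>) * p)" using m by (simp add: divide_right_mono)
    have "lam * r \<le> lam * ((1/m) * ((1/\<kappa>) * p))" by (intro mult_left_mono r lam)
    also have "\<dots> = lam / (m * \<kappa>) * p" by simp
    also have "\<dots> \<le> \<theta> * p"
      using lam(3) m \<kappa> p0 by (intro mult_right_mono) (auto simp: \<kappa>_def divide_le_eq)
    finally have lr: "lam * r \<le> \<theta> * p" .
    have "q \<le> K * p"
      using inner_loewner_mono[OF loewner_le_congruence[OF D iAt] psd(1)] K
      by (simp add: p_def q_def inner_commute matrix_distribs divide_le_eq mult.commute)
    then have "(1 - \<theta>) / K * q \<le> (1 - \<theta>) / K * (K * p)"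
      using K lam(2) by (intro mult_left_mono) auto
    moreover have "(1 - \<theta>) / K = 2 * c" using K by (simp add: c_def field_simps)
    moreover have "(1 - \<theta>) / K * (K * p) = (1 - \<theta>) * p" using K by simp
    ultimately have cq: "2 * c * q \<le> (1 - \<theta>) * p" by (simp only:)
    have dA: "matrix_inv ?At \<bullet> D = matrix_inv A \<bullet> D - t * p"
      using matrix_inv_diff_inner[OF A At D] by (simp add: p_def inner_diff_left)
    have dB: "matrix_inv ?Bt \<bullet> D = matrix_inv B \<bullet> D - t * r"
      using matrix_inv_diff_inner[OF B Bt D] by (simp add: r_def inner_diff_left)
    have "(\<phi> has_real_derivative
        lam * (matrix_inv ?Bt \<bullet> D) - matrix_inv ?At \<bullet> D - (G + 2 * t * (c * q))) (at t)"
      unfolding \<phi>_def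
      by (rule derivative_eq_intros ln_det_line_derivative[OF At As D]
          ln_det_line_derivative[OF Bt pos_def_symm[OF B] D] refl | simp)+
    moreover have "lam * (matrix_inv ?Bt \<bullet> D) - matrix_inv ?At \<bullet> D - (G + 2 * t * (c * q))
        = t * (p - lam * r - 2 * c * q)"
      by (simp add: dA dB G_def inner_diff_left algebra_simps)
    moreover have "0 \<le> t * (p - lam * r - 2 * c * q)"
      using lr cq t by (intro mult_nonneg_nonneg) (auto simp: algebra_simps)
    ultimately show ?thesis by metis
  qed
  note deriv = this
  have "\<phi> 0 \<le> \<phi> 1" by (rule DERIV_nonneg_imp_nondecreasing[OF zero_le_one deriv])
  then have "G + c * q
      \<le> lam * (ln (det (B + D)) - ln (det B)) - (ln (det (A + D)) - ln (det A))"
    by (simp add: \<phi>_def right_diff_distrib)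
  then show ?thesis unfolding G_def c_def q_def .
qed

section \<open>Reduction to the order interval between 0 and the identity\<close>

text \<open>Sylvester's determinant identity. For invertible \<open>F\<close> the two matrices are similar; the
  semidefinite case follows by replacing \<open>F\<close> by \<open>F + e I\<close> and letting \<open>e\<close> tend to \<open>0\<close>.\<close>

lemma det_one_plus_swap:
  fixes F G :: "real^'n^'n"
  assumes F: "pos_semidef F"
  shows "det (mat 1 + F ** G) = det (mat 1 + G ** F)"
proof -
  let ?F = "\<lambda>e::real. F + e *\<^sub>R mat 1"
  have eq: "det (mat 1 + ?F e ** G) = det (mat 1 + G ** ?F e)" if e: "e > 0" for e
  proof -
    have pd: "pos_def (?F e)" using e by (intro pos_def_add F pos_def_scaleR pos_def_mat_1)
    have "(mat 1 + ?F e ** G) ** ?F e = ?F e ** (mat 1 + G ** ?F e)"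
      by (simp only: matrix_add_ldistrib matrix_add_rdistrib matrix_mul_lid matrix_mul_rid
          matrix_mul_assoc add_ac)
    then have "det (mat 1 + ?F e ** G) * det (?F e) = det (?F e) * det (mat 1 + G ** ?F e)"
      by (simp only: flip: det_mul)
    then show ?thesis using pos_def_det[OF pd] by simp
  qed
  have mult_cont: "continuous_on UNIV (\<lambda>e. H ** ?F e)" "continuous_on UNIV (\<lambda>e. ?F e ** H)" for H
    by (simp_all only: matrix_add_ldistrib matrix_add_rdistrib matrix_scalar_ac
        scalar_matrix_assoc[symmetric]) (intro continuous_intros)+
  have c1: "continuous_on UNIV (\<lambda>e. det (mat 1 + ?F e ** G))"
    by (intro continuous_on_det continuous_intros mult_cont)
  have c2: "continuous_on UNIV (\<lambda>e. det (mat 1 + G ** ?F e))"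
    by (intro continuous_on_det continuous_intros mult_cont)
  have l1: "((\<lambda>e. det (mat 1 + ?F e ** G)) \<longlongrightarrow> det (mat 1 + ?F 0 ** G)) (at_right 0)"
    by (rule tendsto_within_subset[OF _ subset_UNIV])
      (use c1 in \<open>unfold continuous_on_def, blast\<close>)
  have l2: "((\<lambda>e. det (mat 1 + G ** ?F e)) \<longlongrightarrow> det (mat 1 + G ** ?F 0)) (at_right 0)"
    by (rule tendsto_within_subset[OF _ subset_UNIV])
      (use c2 in \<open>unfold continuous_on_def, blast\<close>)
  have "((\<lambda>e. det (mat 1 + ?F e ** G)) \<longlongrightarrow> det (mat 1 + G ** ?F 0)) (at_right 0)"
    by (rule Lim_transform_eventually[OF l2])
      (simp add: eventually_at_filter eq)
  then have "det (mat 1 + ?F 0 ** G) = det (mat 1 + G ** ?F 0)"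
    using l1 by (intro tendsto_unique[OF _ l1]) auto
  then show ?thesis by simp
qed

lemma det_add_factor: "pos_def S \<Longrightarrow> det (Z + S) = det S * det (mat 1 + matrix_inv S ** Z)"
proof -
  assume S: "pos_def S"
  have "S ** (mat 1 + matrix_inv S ** Z) = S + (S ** matrix_inv S) ** Z"
    by (simp add: matrix_add_ldistrib matrix_mul_assoc)
  then have "Z + S = S ** (mat 1 + matrix_inv S ** Z)"
    by (simp add: pos_def_inv_right[OF S] add.commute)
  then show ?thesis by (metis det_mul)
qed

lemma ln_det_add_factor:
  assumes "pos_def S" "pos_semidef Z"
  shows "ln (det (Z + S)) - ln (det S) = ln (det (mat 1 + matrix_inv S ** Z))"
proof -
  have "0 < det (Z + S)" by (intro pos_def_det pos_def_add assms)
  then have "0 < det (mat 1 + matrix_inv S ** Z)"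
    using pos_def_det[OF assms(1)] by (simp add: det_add_factor[OF assms(1)] zero_less_mult_iff)
  then show ?thesis
    using pos_def_det[OF assms(1)] by (simp add: det_add_factor[OF assms(1)] ln_mult)
qed

text \<open>A square root \<open>R\<close> of \<open>C\<close>, its pseudo-inverse \<open>T\<close>, and the orthogonal projection \<open>E\<close> onto the
  kernel of \<open>C\<close>.\<close>

lemma sqrt_pseudo_inverse:
  fixes C :: "real^'n^'n"
  assumes C: "pos_semidef C"
  obtains R T E where "pos_semidef R" "T \<in> symm" "pos_semidef E" "R ** R = C"
    "R ** T + E = mat 1" "T ** R + E = mat 1"
    "E ** E = E" "E ** T = 0" "C \<bullet> E = 0" "T ** C ** T + E = mat 1"
proof -
  obtain Q d where Q: "orthogonal_matrix Q" and C_eq: "C = spectral Q d"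
    using spectral_theorem[of C] C by auto
  then have d: "\<And>i. 0 \<le> d i" using C pos_semidef_spectral_iff by blast
  define R where "R = spectral Q (\<lambda>i. sqrt (d i))"
  define T where "T = spectral Q (\<lambda>i. inverse (sqrt (d i)))"
  define E where "E = spectral Q (\<lambda>i. if d i = 0 then 1 else 0)"
  have zero: "spectral Q (\<lambda>_. 0) = 0"
    using spectral_diff[of Q "\<lambda>_. 0" "\<lambda>_. 0"] by simp
  have one: "spectral Q e = mat 1" if "\<And>i. e i = 1" for e
    using spectral_one[OF Q] that by presburger
  note simps = R_def T_def E_def C_eq spectral_mult[OF Q] spectral_add
  show ?thesis
  proof (rule that)
    show "pos_semidef R" "pos_semidef E"
      using d by (simp_all add: R_def E_def pos_semidef_spectral_iff[OF Q])
    show "T \<in> symm" by (simp add: T_def)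
    show "R ** R = C" using d by (simp add: simps)
    have "(\<lambda>i. (if d i = 0 then 1 else 0) * inverse (sqrt (d i))) = (\<lambda>_. 0)" by auto
    then show "E ** T = 0" unfolding simps by (simp only: zero)
    show "R ** T + E = mat 1" "T ** R + E = mat 1"
      unfolding simps by (rule one; simp)+
    show "E ** E = E" unfolding simps by (rule arg_cong[where f = "spectral Q"]) auto
    show "C \<bullet> E = 0" unfolding E_def C_eq inner_spectral[OF Q] by (rule sum.neutral) auto
    have "inverse (sqrt (d i)) * d i * inverse (sqrt (d i)) + (if d i = 0 then 1 else 0) = 1" for i
      using d[of i] by (auto simp: field_simps)
    then show "T ** C ** T + E = mat 1" unfolding simps by (rule one)
  qed
qed

text \<open>The counterpart of the matrix \<open>S\<close> when \<open>X = R x R\<close> is replaced by \<open>x\<close> in the order interval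
  \<open>[0, I]\<close>. For invertible \<open>R\<close> it is \<open>R\<^sup>-\<^sup>1 S R\<^sup>-\<^sup>1\<close>. In general \<open>R S\<^sup>-\<^sup>1 R\<close> lives on the range of
  \<open>R\<close>, and the multiple of the projection \<open>E\<close> makes it invertible; changes of determinants stay
  the same, since \<open>x\<close> vanishes on the kernel.\<close>

definition reduced_noise :: "real^'n^'n \<Rightarrow> real^'n^'n \<Rightarrow> real \<Rightarrow> real^'n^'n \<Rightarrow> real^'n^'n" where
  "reduced_noise R E \<tau> S = matrix_inv (R ** matrix_inv S ** R + \<tau> *\<^sub>R E)"

lemma reduced_noise_pos_def:
  fixes R E T S :: "real^'n^'n"
  assumes R: "pos_semidef R" and E: "pos_semidef E" "E ** E = E" and TR: "T ** R + E = mat 1"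
    and S: "pos_def S" and \<tau>: "0 < \<tau>"
  shows "pos_def (R ** matrix_inv S ** R + \<tau> *\<^sub>R E)"
proof -
  have "0 < u \<bullet> ((R ** matrix_inv S ** R + \<tau> *\<^sub>R E) *v u)" if u: "u \<noteq> 0" for u
  proof -
    have "u \<bullet> (E *v u) = (E *v u) \<bullet> (E *v u)"
      using E symm_adjoint[OF pos_semidef_symm[OF E(1)], of u "E *v u"]
      by (simp add: matrix_vector_mul_assoc)
    then have eq: "u \<bullet> ((R ** matrix_inv S ** R + \<tau> *\<^sub>R E) *v u)
        = (R *v u) \<bullet> (matrix_inv S *v (R *v u)) + \<tau> * ((E *v u) \<bullet> (E *v u))"
      using R by (simp add: matrix_vector_mult_add_rdistrib inner_add_right congruence_quadratic
          scaleR_matrix_vector)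
    have nn: "0 \<le> (R *v u) \<bullet> (matrix_inv S *v (R *v u))"
      using pos_def_imp_semidef[OF pos_def_matrix_inv[OF S]] by (simp add: pos_semidef_def)
    have "u = T *v (R *v u) + E *v u"
      by (metis TR matrix_vector_mul_assoc matrix_vector_mul_lid matrix_vector_mult_add_rdistrib)
    then have "R *v u \<noteq> 0 \<or> E *v u \<noteq> 0" using u by (metis add_0 matrix_vector_mult_0_right)
    then show ?thesis
    proof
      assume "R *v u \<noteq> 0"
      then have "0 < (R *v u) \<bullet> (matrix_inv S *v (R *v u))"
        using pos_def_matrix_inv[OF S] by (simp add: pos_def_def)
      then show ?thesis unfolding eq using \<tau> by (simp add: add_pos_nonneg)
    next
      assume "E *v u \<noteq> 0"
      then have "0 < \<tau> * ((E *v u) \<bullet> (E *v u))" using \<tau> by simp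
      then show ?thesis unfolding eq using nn by linarith
    qed
  qed
  then show ?thesis using R E S by (simp add: pos_def_def)
qed

text \<open>By \<open>ln_det_add_factor\<close> both sides are log-determinants of the form \<open>ln det (I + \<sqdot>)\<close>;
  Sylvester's identity moves the right factor \<open>R\<close> of \<open>R z R\<close> to the left.\<close>

lemma ln_det_reduced_noise:
  fixes R E S z :: "real^'n^'n"
  assumes R: "pos_semidef R" and pd: "pos_def (R ** matrix_inv S ** R + \<tau> *\<^sub>R E)"
    and S: "pos_def S" and z: "pos_semidef z" "E ** z = 0"
  shows "ln (det (R ** z ** R + S)) - ln (det S)
       = ln (det (z + reduced_noise R E \<tau> S)) - ln (det (reduced_noise R E \<tau> S))"
proof -
  have RzR: "pos_semidef (R ** z ** R)" using R z by (intro pos_semidef_congruence) auto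
  have s: "pos_def (reduced_noise R E \<tau> S)"
    unfolding reduced_noise_def by (rule pos_def_matrix_inv[OF pd])
  have "det (mat 1 + matrix_inv S ** (R ** z ** R)) = det (mat 1 + (matrix_inv S ** R ** z) ** R)"
    by (simp add: matrix_mul_assoc)
  also have "\<dots> = det (mat 1 + R ** (matrix_inv S ** R ** z))"
    by (rule det_one_plus_swap[OF R, symmetric])
  also have "R ** (matrix_inv S ** R ** z) = (R ** matrix_inv S ** R + \<tau> *\<^sub>R E) ** z"
    by (simp add: matrix_distribs z(2) matrix_mul_assoc)
  finally show ?thesis
    unfolding ln_det_add_factor[OF S RzR] ln_det_add_factor[OF s z(1)]
    unfolding reduced_noise_def matrix_inv_matrix_inv[OF pd] by simp
qed

text \<open>The resolvent identity for \<open>S\<close> and \<open>R x R + S\<close>, multiplied by \<open>R\<close> on both sides, is the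
  resolvent identity for the reduced matrices.\<close>

lemma inverse_reduced_noise:
  fixes R E S x :: "real^'n^'n"
  assumes R: "pos_semidef R" and pd: "pos_def (R ** matrix_inv S ** R + \<tau> *\<^sub>R E)"
    and S: "pos_def S" and x: "pos_semidef x" "E ** x = 0" "x ** E = 0"
  shows "matrix_inv (x + reduced_noise R E \<tau> S)
       = R ** matrix_inv (R ** x ** R + S) ** R + \<tau> *\<^sub>R E"
proof -
  let ?W = "R ** matrix_inv S ** R + \<tau> *\<^sub>R E" and ?A = "R ** x ** R + S"
  let ?P = "R ** matrix_inv ?A ** R"
  have A: "pos_def ?A" using R x S by (intro pos_def_add pos_semidef_congruence) auto
  have "matrix_inv S - matrix_inv ?A = matrix_inv S ** (R ** x ** R) ** matrix_inv ?A"
    using matrix_inv_diff[OF S A] by simp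
  then have iA: "matrix_inv ?A = matrix_inv S - matrix_inv S ** (R ** x ** R) ** matrix_inv ?A"
    by (simp add: algebra_simps)
  have "?P = R ** (matrix_inv S - matrix_inv S ** (R ** x ** R) ** matrix_inv ?A) ** R"
    using iA by simp
  also have "\<dots> = R ** matrix_inv S ** R - (R ** matrix_inv S ** R) ** (x ** ?P)"
    by (simp only: matrix_diff_ldistrib matrix_diff_rdistrib matrix_mul_assoc)
  also have "(R ** matrix_inv S ** R) ** (x ** ?P) = ?W ** (x ** ?P)"
    by (simp add: matrix_add_rdistrib matrix_mul_assoc x scalar_matrix_assoc[symmetric])
  finally have P: "?P + \<tau> *\<^sub>R E = ?W ** (mat 1 - x ** ?P)"
    by (simp add: matrix_diff_ldistrib)
  have "(x + matrix_inv ?W) ** (?P + \<tau> *\<^sub>R E) = x ** ?P + matrix_inv ?W ** (?P + \<tau> *\<^sub>R E)"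
    by (simp add: matrix_distribs x)
  also have "\<dots> = x ** ?P + (matrix_inv ?W ** ?W) ** (mat 1 - x ** ?P)"
    unfolding P by (simp add: matrix_mul_assoc)
  also have "\<dots> = mat 1" by (simp only: pos_def_inv_left[OF pd] matrix_mul_lid) simp
  finally show ?thesis unfolding reduced_noise_def by (rule matrix_inv_unique)
qed

section \<open>Removing the multiplier of the constraint X >= 0\<close>

text \<open>Let \<open>M\<close> be a multiplier that is complementary to \<open>x\<close>. Replacing the noise \<open>s\<close> by the smaller
  noise \<open>s' = (s\<^sup>-\<^sup>1 + M)\<^sup>-\<^sup>1\<close> adds exactly \<open>M\<close> to the gradient at \<open>x\<close>. Moreover
  \<open>det (z + s) / det s = det (I + s\<^sup>-\<^sup>1 z)\<close> increases with \<open>s\<^sup>-\<^sup>1\<close>, and it keeps its value at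
  \<open>z = x\<close>; so the growth of the log-determinant from \<open>x\<close> to \<open>z\<close> can only increase. This is the
  channel enhancement argument of network information theory.\<close>

lemma enhanced_noise:
  fixes s x M :: "real^'n^'n"
  defines "s' \<equiv> matrix_inv (matrix_inv s + M)"
  assumes s: "pos_def s" and M: "pos_semidef M" and x: "pos_semidef x" and Mx: "M ** x = 0"
  shows enhanced_noise_pos_def: "pos_def s'"
    and enhanced_noise_inverse: "matrix_inv (x + s') = matrix_inv (x + s) + M"
    and enhanced_noise_ln_det: "pos_semidef z \<Longrightarrow>
      ln (det (z + s)) - ln (det (x + s)) \<le> ln (det (z + s')) - ln (det (x + s'))"
proof -
  have pd: "pos_def (matrix_inv s + M)"
    using pos_def_add[OF M pos_def_matrix_inv[OF s]] by (simp add: add.commute)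
  show s': "pos_def s'" unfolding s'_def by (rule pos_def_matrix_inv[OF pd])
  have inv_s': "matrix_inv s' = matrix_inv s + M"
    unfolding s'_def by (rule matrix_inv_matrix_inv[OF pd])
  have xM: "x ** M = 0"
    using arg_cong[OF Mx, of transpose] M x pos_semidef_symm[OF M] pos_semidef_symm[OF x]
    by (simp add: matrix_transpose_mul symm_def) (simp add: transpose_def zero_vec_def)
  let ?a = "x + s"
  have a: "pos_def ?a" by (rule pos_def_add[OF x s])
  have "?a ** M = s ** M" by (simp add: matrix_add_rdistrib xM)
  then have "matrix_inv ?a ** (?a ** M) = matrix_inv ?a ** (s ** M)" by simp
  then have M_eq: "matrix_inv ?a ** s ** M = M"
    by (simp add: matrix_mul_assoc pos_def_inv_left[OF a])
  have "s ** ((matrix_inv s + M) ** s') = s"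
    unfolding s'_def by (simp add: pos_def_inv_right[OF pd])
  then have "s' + s ** M ** s' = s"
    by (simp add: matrix_add_ldistrib matrix_add_rdistrib matrix_mul_assoc pos_def_inv_right[OF s])
  then have xs': "x + s' = ?a - s ** M ** s'" by (simp add: algebra_simps)
  have "(matrix_inv ?a + M) ** (x + s') = matrix_inv ?a ** (x + s') + M ** s'"
    by (simp add: matrix_add_ldistrib matrix_add_rdistrib Mx)
  also have "matrix_inv ?a ** (x + s') = mat 1 - (matrix_inv ?a ** s ** M) ** s'"
    unfolding xs' by (simp add: matrix_diff_ldistrib matrix_mul_assoc pos_def_inv_left[OF a])
  also have "\<dots> + M ** s' = mat 1" unfolding M_eq by simp
  finally have "(x + s') ** (matrix_inv ?a + M) = mat 1" by (simp add: matrix_left_right_inverse)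
  then show "matrix_inv (x + s') = matrix_inv ?a + M" by (rule matrix_inv_unique)
  show "ln (det (z + s)) - ln (det (x + s)) \<le> ln (det (z + s')) - ln (det (x + s'))"
    if z: "pos_semidef z"
  proof -
    have "matrix_inv s' ** x = matrix_inv s ** x"
      by (simp add: inv_s' matrix_add_rdistrib Mx)
    then have at_x: "ln (det (x + s)) - ln (det s) = ln (det (x + s')) - ln (det s')"
      by (simp add: ln_det_add_factor[OF s x] ln_det_add_factor[OF s' x])
    obtain F where F: "pos_semidef F" "F ** F = z" using pos_semidef_sqrt[OF z] .
    have swap: "det (mat 1 + G ** z) = det (mat 1 + F ** G ** F)" for G
      using det_one_plus_swap[OF F(1), of "G ** F"]
      by (simp add: matrix_mul_assoc) (simp add: F(2) flip: matrix_mul_assoc)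
    have pd1: "pos_def (mat 1 + F ** matrix_inv s ** F)"
      using F s pos_def_add[OF pos_semidef_congruence pos_def_mat_1, of F "matrix_inv s"]
      by (simp add: pos_def_imp_semidef pos_def_matrix_inv add.commute)
    have "mat 1 + F ** matrix_inv s ** F \<preceq> mat 1 + F ** matrix_inv s' ** F"
      using pos_semidef_congruence[OF pos_semidef_symm[OF F(1)] M]
      by (simp add: loewner_le_def inv_s' matrix_add_ldistrib matrix_add_rdistrib)
    from ln_det_mono[OF pd1 this]
    have "ln (det (z + s)) - ln (det s) \<le> ln (det (z + s')) - ln (det s')"
      by (simp add: ln_det_add_factor[OF s z] ln_det_add_factor[OF s' z] swap)
    with at_x show ?thesis by linarith
  qed
qed

text \<open>The matrix \<open>w\<close> is the projection onto the eigenspaces of \<open>Y\<close> with positive eigenvalues; it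
  maximizes the linear functional \<open>Y\<close> over \<open>[0, I]\<close>, and the maximum is the trace of the positive
  part \<open>M2\<close>.\<close>

lemma positive_negative_parts:
  fixes Y :: "real^'n^'n"
  assumes Y: "Y \<in> symm"
  obtains M1 M2 w where "pos_semidef M1" "pos_semidef M2" "Y = M2 - M1"
    "pos_semidef w" "w \<preceq> mat 1" "Y \<bullet> w = M2 \<bullet> mat 1" "norm M1 \<le> norm Y"
proof -
  obtain Q d where Q: "orthogonal_matrix Q" and Y_eq: "Y = spectral Q d"
    using spectral_theorem[OF Y] .
  define M1 where "M1 = spectral Q (\<lambda>i. max (- d i) 0)"
  define M2 where "M2 = spectral Q (\<lambda>i. max (d i) 0)"
  define w where "w = spectral Q (\<lambda>i. if 0 < d i then 1 else 0)"
  show ?thesis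
  proof (rule that)
    show "pos_semidef M1" "pos_semidef M2" "pos_semidef w"
      by (simp_all add: M1_def M2_def w_def pos_semidef_spectral_iff[OF Q])
    show "Y = M2 - M1" unfolding Y_eq M1_def M2_def spectral_diff
      by (rule arg_cong[where f = "spectral Q"]) auto
    show "w \<preceq> mat 1"
      unfolding loewner_le_def w_def spectral_one[OF Q, symmetric] spectral_diff
      by (simp add: pos_semidef_spectral_iff[OF Q])
    show "Y \<bullet> w = M2 \<bullet> mat 1"
      unfolding Y_eq M2_def w_def spectral_one[OF Q, symmetric] inner_spectral[OF Q]
      by (rule sum.cong) auto
    have "M1 \<bullet> M1 \<le> Y \<bullet> Y"
      unfolding Y_eq M1_def inner_spectral[OF Q]
      by (intro sum_mono) (auto simp: max_def)
    then show "norm M1 \<le> norm Y" by (simp add: norm_eq_sqrt_inner)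
  qed
qed

section \<open>Growth of the objective from nearly stationary points\<close>

lemma feas_iff: "X \<in> feas C \<longleftrightarrow> pos_semidef X \<and> X \<preceq> C"
  by (auto simp: feas_def loewner_le_def)

lemma feas_symm: "X \<in> feas C \<Longrightarrow> X \<in> symm"
  by (simp add: feas_def)

lemma feas_norm: "X \<in> feas C \<Longrightarrow> norm X \<le> norm C"
  by (simp add: feas_iff norm_loewner_mono)

lemma feas_pos_def: "pos_def S \<Longrightarrow> X \<in> feas C \<Longrightarrow> pos_def (X + S)"
  by (simp add: feas_iff pos_def_add)

lemma feas_inverse_norm:
  assumes S: "pos_def S" and X: "X \<in> feas C"
  shows "norm (matrix_inv (X + S)) \<le> norm (matrix_inv S)"
proof (rule norm_loewner_mono)
  show "pos_semidef (matrix_inv (X + S))"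
    by (rule pos_def_imp_semidef[OF pos_def_matrix_inv[OF feas_pos_def[OF S X]]])
  show "matrix_inv (X + S) \<preceq> matrix_inv S"
    using X by (intro matrix_inv_antimono S) (simp add: loewner_le_def feas_iff)
qed

lemma matrix_inv_scaled_identity:
  "c \<noteq> 0 \<Longrightarrow> matrix_inv (c *\<^sub>R mat 1) = (1/c) *\<^sub>R (mat 1 :: real^'n^'n)"
  by (rule matrix_inv_unique) (simp add: matrix_distribs)

lemma inverse_lower_bound:
  fixes A :: "real^'n^'n"
  assumes A: "pos_def A" and k: "0 < k" "A \<preceq> k *\<^sub>R mat 1"
  shows "(1/k) *\<^sub>R mat 1 \<preceq> matrix_inv A"
  using matrix_inv_antimono[OF A k(2)] k(1) by (simp add: matrix_inv_scaled_identity)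

lemma feas_inverse_lower_bound:
  assumes S: "pos_def S" and X: "X \<in> feas C" and k: "norm (C + S) + 1 = k"
  shows "(1/k) *\<^sub>R mat 1 \<preceq> matrix_inv (X + S)"
proof (rule inverse_lower_bound)
  show "pos_def (X + S)" by (rule feas_pos_def[OF S X])
  show "0 < k" using norm_ge_zero[of "C + S"] k by linarith
  have C: "pos_semidef C"
    using X pos_semidef_add[of X "C - X"] by (simp add: feas_iff loewner_le_def)
  have "X + S \<preceq> C + S" using X by (simp add: feas_iff loewner_le_def)
  also have "C + S \<preceq> norm (C + S) *\<^sub>R mat 1" using C S by (intro loewner_le_norm) auto
  also have "\<dots> \<preceq> k *\<^sub>R mat 1"
    unfolding k[symmetric] by (simp add: loewner_le_def algebra_simps pos_def_imp_semidef pos_def_mat_1)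
  finally show "X + S \<preceq> k *\<^sub>R mat 1" .
qed

text \<open>A feasible \<open>X\<close> vanishes on the kernel of \<open>C\<close>, because \<open>X \<bullet> E \<le> C \<bullet> E = 0\<close>; hence it is
  recovered from \<open>T X T\<close>.\<close>

lemma feas_factor:
  fixes C R T E X :: "real^'n^'n"
  assumes T: "T \<in> symm" and E: "pos_semidef E"
    and RT: "R ** T + E = mat 1" "T ** R + E = mat 1" and ET: "E ** T = 0" "C \<bullet> E = 0"
    and TCT: "T ** C ** T + E = mat 1" and X: "X \<in> feas C"
  defines "x \<equiv> T ** X ** T"
  shows "pos_semidef x" "x \<preceq> mat 1" "E ** x = 0" "x ** E = 0" "R ** x ** R = X"
proof -
  have X': "pos_semidef X" "X \<preceq> C" using X by (auto simp: feas_iff)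
  have "X \<bullet> E \<le> 0" using inner_loewner_mono[OF X'(2) E] ET by simp
  then have 0: "X \<bullet> E = 0" using inner_pos_semidef[OF X'(1) E] by simp
  then have XE: "X ** E = 0" "E ** X = 0"
    using inner_pos_semidef_eq_0[OF X'(1) E] inner_pos_semidef_eq_0[OF E X'(1)]
    by (auto simp: inner_commute)
  have "transpose (E ** T) = T ** E"
    using T pos_semidef_symm[OF E] by (simp add: matrix_transpose_mul symm_def)
  then have TE: "T ** E = 0" using ET by (simp add: transpose_def zero_vec_def)
  show "pos_semidef x" unfolding x_def by (rule pos_semidef_congruence[OF T X'(1)])
  have "x \<preceq> T ** C ** T" unfolding x_def by (rule loewner_le_congruence[OF T X'(2)])
  also have "T ** C ** T \<preceq> mat 1" using E by (simp add: loewner_le_def flip: TCT)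
  finally show "x \<preceq> mat 1" .
  show "E ** x = 0" by (simp add: x_def matrix_mul_assoc ET)
  show "x ** E = 0" by (simp add: x_def TE flip: matrix_mul_assoc)
  have "R ** x ** R = (R ** T) ** X ** (T ** R)" by (simp add: x_def matrix_mul_assoc)
  moreover have "R ** T = mat 1 - E" "T ** R = mat 1 - E" using RT by (simp_all add: eq_diff_eq)
  ultimately show "R ** x ** R = X"
    by (simp add: matrix_diff_ldistrib matrix_diff_rdistrib XE)
qed

definition objective_gradient :: "real \<Rightarrow> real^'n^'n \<Rightarrow> real^'n^'n \<Rightarrow> real^'n^'n \<Rightarrow> real^'n^'n" where
  "objective_gradient lam S1 S2 X = lam *\<^sub>R matrix_inv (X + S2) - matrix_inv (X + S1)"

text \<open>Complementary slackness: normality tested with \<open>R w R\<close>, where \<open>w\<close> maximizes the functional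
  \<open>R Y R\<close> over \<open>[0, I]\<close>, makes both \<open>M1 \<bullet> x\<close> and \<open>M2 \<bullet> (I - x)\<close> vanish for \<open>x = T X T\<close>.\<close>

lemma normal_vector_multipliers:
  fixes C R T E X Y :: "real^'n^'n"
  assumes R: "pos_semidef R" "R ** R = C" and T: "T \<in> symm" and E: "pos_semidef E"
    and RT: "R ** T + E = mat 1" "T ** R + E = mat 1" and ET: "E ** T = 0" "C \<bullet> E = 0"
    and TCT: "T ** C ** T + E = mat 1" and X: "X \<in> feas C" and Y: "Y \<in> normal_cone (feas C) X"
  obtains M1 M2 where "pos_semidef M1" "pos_semidef M2" "R ** Y ** R = M2 - M1"
    "M1 ** (T ** X ** T) = 0" "norm M1 \<le> norm (R ** Y ** R)" "\<forall>z. z \<preceq> mat 1 \<longrightarrow> M2 \<bullet> (z - T ** X ** T) \<le> 0"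
proof -
  let ?x = "T ** X ** T"
  note x = feas_factor[OF T E RT ET TCT X]
  have Rs: "R \<in> symm" using R by simp
  have "R ** Y ** R \<in> symm" using Y Rs by (simp add: normal_cone_def)
  then obtain M1 M2 w where M: "pos_semidef M1" "pos_semidef M2" "R ** Y ** R = M2 - M1"
    and w: "pos_semidef w" "w \<preceq> mat 1" "(R ** Y ** R) \<bullet> w = M2 \<bullet> mat 1"
    and nM: "norm M1 \<le> norm (R ** Y ** R)"
    by (rule positive_negative_parts)
  have "R ** w ** R \<in> feas C"
    using pos_semidef_congruence[OF Rs w(1)] loewner_le_congruence[OF Rs w(2)] R(2)
    by (simp add: feas_iff)
  then have "Y \<bullet> (R ** w ** R - X) \<le> 0" using Y by (simp add: normal_cone_def)
  also have "R ** w ** R - X = R ** (w - ?x) ** R"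
    by (simp add: matrix_diff_ldistrib matrix_diff_rdistrib x(5))
  finally have "(R ** Y ** R) \<bullet> (w - ?x) \<le> 0" by (simp add: inner_congruence[OF Rs])
  then have sum: "M2 \<bullet> (mat 1 - ?x) + M1 \<bullet> ?x \<le> 0"
    using w(3) by (simp add: inner_diff_right inner_diff_left M(3))
  have nn: "0 \<le> M2 \<bullet> (mat 1 - ?x)" "0 \<le> M1 \<bullet> ?x"
    using x(1,2) M by (auto simp: loewner_le_def intro!: inner_pos_semidef)
  have M1x: "M1 ** ?x = 0"
    using sum nn by (intro inner_pos_semidef_eq_0 M x) linarith
  have "M2 \<bullet> (z - ?x) \<le> 0" if z: "z \<preceq> mat 1" for z
  proof -
    have "z \<bullet> M2 \<le> mat 1 \<bullet> M2" by (rule inner_loewner_mono[OF z M(2)])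
    then show ?thesis using sum nn by (simp add: inner_diff_right inner_commute)
  qed
  with M M1x nM that show ?thesis by blast
qed

text \<open>After the reduction to \<open>[0, I]\<close> and the enhancement by the multiplier \<open>M1\<close> of the lower
  constraint, approximate stationarity says that \<open>(x + s')\<^sup>-\<^sup>1\<close> dominates \<open>m (x + u)\<^sup>-\<^sup>1\<close> for some
  \<open>m\<close> slightly below \<open>lam\<close>: the error costs the difference \<open>lam - m\<close>, and the multiplier \<open>M2\<close> of
  the upper constraint only helps. So \<open>ln_det_difference_above_tangent\<close> applies on the segment to
  any other feasible point. Up to the error, the tangent term is nonnegative because \<open>M2\<close> is
  complementary.\<close>

lemma growth_from_nearly_stationary:
  fixes C S1 S2 :: "real^'n^'n"
  assumes S1: "pos_def S1" and S2: "pos_def S2" and C: "pos_semidef C" and lam: "1 < lam"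
    and r: "0 \<le> r"
  shows "\<exists>\<epsilon>>0. \<exists>c>0. \<forall>X\<in>feas C. \<forall>Z\<in>feas C. \<forall>Y\<in>normal_cone (feas C) X.
    norm Y \<le> r \<longrightarrow> norm (objective_gradient lam S1 S2 X + Y) \<le> \<epsilon> \<longrightarrow>
    c * (norm (Z - X))\<^sup>2 - norm (objective_gradient lam S1 S2 X + Y) * norm (Z - X)
      \<le> f_obj lam S1 S2 Z - f_obj lam S1 S2 X"
proof -
  obtain R T E where R: "pos_semidef R" and T: "T \<in> symm" and E: "pos_semidef E"
    and RR: "R ** R = C"
    and RT: "R ** T + E = mat 1" "T ** R + E = mat 1"
    and EE: "E ** E = E" and ET: "E ** T = 0" "C \<bullet> E = 0" and TCT: "T ** C ** T + E = mat 1"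
    using sqrt_pseudo_inverse[OF C] .
  have Rs: "R \<in> symm" using R by simp
  (* k bounds the norm of the enhanced inverse N, so that K bounds the ratio of the two ends of the
     segment. The slack \<tau> is chosen so small that m = lam - \<tau> still satisfies
     lam < m (1 + (m - 1) / K); the quotient of the two sides is \<theta>. *)
  define k where "k = norm R * norm (matrix_inv S1) * norm R + norm R * r * norm R + norm E + 1"
  have k: "k \<ge> 1" using r by (simp add: k_def)
  define K where "K = 1 + k"
  define \<tau> where "\<tau> = (lam - 1) / (4 * K)"
  have K: "K \<ge> 1" using k by (simp add: K_def)
  have \<tau>: "0 < \<tau>" "\<tau> \<le> (lam - 1) / 2"
    using lam K divide_left_mono[of 2 "4 * K" "lam - 1"] by (auto simp: \<tau>_def)
  define m where "m = lam - \<tau>"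
  have m: "1 \<le> m" "0 < m" using \<tau> lam by (auto simp: m_def field_simps)
  define \<kappa> where "\<kappa> = m * (1 + (m - 1) / K)"
  have \<kappa>: "lam < \<kappa>"
  proof -
    have "(lam - 1) / 2 \<le> m * (m - 1)"
    proof -
      have "(lam - 1) / 2 \<le> m - 1" using \<tau> by (simp add: m_def field_simps)
      also have "\<dots> \<le> m * (m - 1)" using m by (simp add: mult_le_cancel_right1)
      finally show ?thesis .
    qed
    then have "(lam - 1) / 2 / K \<le> m * (m - 1) / K" using K by (intro divide_right_mono) auto
    moreover have "2 * \<tau> = (lam - 1) / 2 / K" using K by (simp add: \<tau>_def field_simps)
    ultimately have "2 * \<tau> \<le> m * (m - 1) / K" by linarith
    then show ?thesis using \<tau> by (simp add: \<kappa>_def m_def distrib_left)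
  qed
  define \<theta> where "\<theta> = lam / \<kappa>"
  have \<theta>: "\<theta> < 1" "lam = \<theta> * \<kappa>" using \<kappa> lam by (auto simp: \<theta>_def)
  (* 1 / kA and 1 / kB bound the inverses of X + S1 and X + S2 from below on the feasible set. *)
  define kB where "kB = norm (C + S2) + 1"
  have kB: "kB > 0" using norm_ge_zero[of "C + S2"] unfolding kB_def by linarith
  define kA where "kA = norm (C + S1) + 1"
  have kA: "kA > 0" using norm_ge_zero[of "C + S1"] unfolding kA_def by linarith
  define c where "c = (1 - \<theta>) / (2 * K) * (1 / kA)\<^sup>2"
  have c: "c > 0" using \<theta> K kA by (simp add: c_def)
  have growth: "c * (norm (Z - X))\<^sup>2 - norm (objective_gradient lam S1 S2 X + Y) * norm (Z - X)
      \<le> f_obj lam S1 S2 Z - f_obj lam S1 S2 X"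
    if X: "X \<in> feas C" and Z: "Z \<in> feas C" and Y: "Y \<in> normal_cone (feas C) X" "norm Y \<le> r"
      and small: "norm (objective_gradient lam S1 S2 X + Y) \<le> \<tau> / kB" for X Y Z
  proof -
    define x where "x = T ** X ** T"
    define z where "z = T ** Z ** T"
    note x = feas_factor[OF T E RT ET TCT X, folded x_def]
    note z = feas_factor[OF T E RT ET TCT Z, folded z_def]
    obtain M1 M2 where M1: "pos_semidef M1" "M1 ** x = 0" "norm M1 \<le> norm (R ** Y ** R)"
      and M2psd: "pos_semidef M2"
      and M: "R ** Y ** R = M2 - M1" and M2: "\<forall>z. z \<preceq> mat 1 \<longrightarrow> M2 \<bullet> (z - x) \<le> 0"
      using normal_vector_multipliers[OF R RR T E RT ET TCT X Y(1)] unfolding x_def by metis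
    define G where "G = objective_gradient lam S1 S2 X + Y"
    define D where "D = z - x"
    have D: "D \<in> symm" using x z by (simp add: D_def)
    have RDR: "R ** D ** R = Z - X"
      by (simp add: D_def matrix_diff_ldistrib matrix_diff_rdistrib x z)
    define iA where "iA = matrix_inv (X + S1)"
    define iB where "iB = matrix_inv (X + S2)"
    have G_eq: "G = lam *\<^sub>R iB - iA + Y" by (simp add: G_def objective_gradient_def iA_def iB_def)
    have Gs: "G \<in> symm"
      using Y(1) feas_pos_def[OF S1 X] feas_pos_def[OF S2 X]
      by (simp add: G_eq iA_def iB_def normal_cone_def)
    have pd1: "pos_def (R ** matrix_inv S1 ** R + 1 *\<^sub>R E)"
      by (rule reduced_noise_pos_def[OF R E EE RT(2) S1]) simp
    have pd2: "pos_def (R ** matrix_inv S2 ** R + (1/lam) *\<^sub>R E)"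
      by (rule reduced_noise_pos_def[OF R E EE RT(2) S2]) (use lam in simp)
    define s where "s = reduced_noise R E 1 S1"
    define u where "u = reduced_noise R E (1/lam) S2"
    have s: "pos_def s" unfolding s_def reduced_noise_def by (rule pos_def_matrix_inv[OF pd1])
    have u: "pos_def u" unfolding u_def reduced_noise_def by (rule pos_def_matrix_inv[OF pd2])
    have inv_s: "matrix_inv (x + s) = R ** iA ** R + E"
      using inverse_reduced_noise[OF R pd1 S1 x(1,3,4)] by (simp add: s_def iA_def x(5))
    have inv_u: "matrix_inv (x + u) = R ** iB ** R + (1/lam) *\<^sub>R E"
      using inverse_reduced_noise[OF R pd2 S2 x(1,3,4)] by (simp add: u_def iB_def x(5))
    define s' where "s' = matrix_inv (matrix_inv s + M1)"
    have s': "pos_def s'" unfolding s'_def by (rule enhanced_noise_pos_def[OF s M1(1) x(1) M1(2)])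
    define N where "N = R ** iA ** R + E + M1"
    have inv_s': "matrix_inv (x + s') = N"
      unfolding s'_def using enhanced_noise_inverse[OF s M1(1) x(1) M1(2)] by (simp add: inv_s N_def)
    define a where "a = x + s'"
    define b where "b = x + u"
    have a: "pos_def a" unfolding a_def by (rule pos_def_add[OF x(1) s'])
    have b: "pos_def b" unfolding b_def by (rule pos_def_add[OF x(1) u])
    have inv_a: "matrix_inv a = N" and inv_b: "matrix_inv b = R ** iB ** R + (1/lam) *\<^sub>R E"
      by (simp_all add: a_def b_def inv_s' inv_u)
    have N: "pos_def N" using pos_def_matrix_inv[OF a] by (simp add: inv_a)
    have aD: "a + D = z + s'" "b + D = z + u" by (simp_all add: a_def b_def D_def)
    have objective: "- (ln (det (a + D)) - ln (det a)) + lam * (ln (det (b + D)) - ln (det b))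
        \<le> f_obj lam S1 S2 Z - f_obj lam S1 S2 X"
    proof -
      have "ln (det (Z + S1)) - ln (det (X + S1)) = ln (det (z + s)) - ln (det (x + s))"
        using ln_det_reduced_noise[OF R pd1 S1 z(1,3)] ln_det_reduced_noise[OF R pd1 S1 x(1,3)]
        by (simp add: x(5) z(5) s_def)
      also have "\<dots> \<le> ln (det (a + D)) - ln (det a)"
        unfolding aD(1) unfolding a_def s'_def
        by (rule enhanced_noise_ln_det[OF s M1(1) x(1) M1(2) z(1)])
      finally have 1: "ln (det (Z + S1)) - ln (det (X + S1)) \<le> ln (det (a + D)) - ln (det a)" .
      have "ln (det (Z + S2)) - ln (det (X + S2)) = ln (det (b + D)) - ln (det b)"
        unfolding aD(2) unfolding b_def
        using ln_det_reduced_noise[OF R pd2 S2 z(1,3)] ln_det_reduced_noise[OF R pd2 S2 x(1,3)]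
        by (simp add: x(5) z(5) u_def)
      then have "lam * (ln (det (b + D)) - ln (det b))
          = lam * (ln (det (Z + S2)) - ln (det (X + S2)))"
        by simp
      also have "\<dots> = lam * ln (det (Z + S2)) - lam * ln (det (X + S2))"
        by (rule right_diff_distrib)
      finally show ?thesis using 1 by (simp add: f_obj_def)
    qed
    have N_eq: "N = lam *\<^sub>R matrix_inv b + M2 - R ** G ** R"
    proof -
      have "R ** G ** R = lam *\<^sub>R (R ** iB ** R) - R ** iA ** R + R ** Y ** R"
        by (simp add: G_eq matrix_distribs matrix_diff_ldistrib matrix_diff_rdistrib)
      then show ?thesis using lam by (simp add: N_def inv_b M scaleR_right_distrib)
    qed
    have GB: "G \<preceq> \<tau> *\<^sub>R iB"
    proof -
      have "G \<preceq> norm G *\<^sub>R mat 1" by (rule loewner_le_norm[OF Gs])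
      also have "\<dots> \<preceq> (\<tau> / kB) *\<^sub>R mat 1"
        using small pos_semidef_scaleR[OF pos_def_imp_semidef[OF pos_def_mat_1], of "\<tau> / kB - norm G"]
        by (simp add: G_def loewner_le_def algebra_simps)
      also have "(\<tau> / kB) *\<^sub>R mat 1 \<preceq> \<tau> *\<^sub>R iB"
        using loewner_le_scaleR[OF feas_inverse_lower_bound[OF S2 X kB_def[symmetric]], of \<tau>] \<tau>
        by (simp add: iB_def)
      finally show ?thesis .
    qed
    have mN: "m *\<^sub>R matrix_inv b \<preceq> N"
    proof -
      have "pos_semidef (R ** (\<tau> *\<^sub>R iB - G) ** R)"
        using GB by (intro pos_semidef_congruence Rs) (simp add: loewner_le_def)
      moreover have "pos_semidef ((\<tau> / lam) *\<^sub>R E)"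
        using \<tau> lam by (intro pos_semidef_scaleR E) simp
      moreover have "N - m *\<^sub>R matrix_inv b
          = R ** (\<tau> *\<^sub>R iB - G) ** R + ((\<tau> / lam) *\<^sub>R E + M2)"
      proof -
        have "N - m *\<^sub>R matrix_inv b = \<tau> *\<^sub>R matrix_inv b + M2 - R ** G ** R"
          by (simp add: N_eq m_def scaleR_left_diff_distrib)
        then show ?thesis
          by (simp add: inv_b matrix_distribs matrix_diff_ldistrib matrix_diff_rdistrib
              scaleR_right_distrib)
      qed
      ultimately show ?thesis
        using M2psd by (simp add: loewner_le_def pos_semidef_add)
    qed
    have mab: "m *\<^sub>R a \<preceq> b"
    proof -
      have mb: "pos_def (m *\<^sub>R matrix_inv b)" using m b by (intro pos_def_scaleR pos_def_matrix_inv)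
      have "matrix_inv N \<preceq> matrix_inv (m *\<^sub>R matrix_inv b)" by (rule matrix_inv_antimono[OF mb mN])
      then have "a \<preceq> (1/m) *\<^sub>R b"
        using m by (simp add: matrix_inv_scaleR[OF pos_def_matrix_inv[OF b]]
            matrix_inv_matrix_inv[OF b] matrix_inv_matrix_inv[OF a] flip: inv_a)
      from loewner_le_scaleR[OF this, of m] show ?thesis using m by simp
    qed
    have aDK: "a + D \<preceq> K *\<^sub>R a"
    proof -
      have "norm N \<le> norm (R ** iA ** R) + norm E + norm M1"
        unfolding N_def by (intro order_trans[OF norm_triangle_ineq] add_right_mono norm_triangle_ineq)
      moreover have "norm (R ** iA ** R) \<le> norm R * norm (matrix_inv S1) * norm R"
        by (intro order_trans[OF norm_matrix_mult] mult_right_mono mult_left_mono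
            feas_inverse_norm[OF S1 X, folded iA_def] norm_ge_zero)
      moreover have "norm M1 \<le> norm R * r * norm R"
        by (rule order_trans[OF M1(3)])
          (intro order_trans[OF norm_matrix_mult] mult_right_mono mult_left_mono Y(2) norm_ge_zero)
      ultimately have Nk: "norm N \<le> k" by (simp add: k_def)
      have "N \<preceq> norm N *\<^sub>R mat 1" by (rule loewner_le_norm[OF pos_def_symm[OF N]])
      also have "\<dots> \<preceq> k *\<^sub>R mat 1"
        using Nk pos_semidef_scaleR[OF pos_def_imp_semidef[OF pos_def_mat_1], of "k - norm N"]
        by (simp add: loewner_le_def algebra_simps)
      finally have "N \<preceq> k *\<^sub>R mat 1" .
      then have "(1/k) *\<^sub>R mat 1 \<preceq> a"
        using inverse_lower_bound[OF N, of k] k by (simp add: matrix_inv_matrix_inv[OF a] flip: inv_a)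
      from loewner_le_scaleR[OF this, of k] k have "mat 1 \<preceq> k *\<^sub>R a" by simp
      moreover have "D \<preceq> mat 1"
        using pos_semidef_add[OF x(1) z(2)[unfolded loewner_le_def]]
        by (simp add: loewner_le_def D_def algebra_simps)
      ultimately have "D \<preceq> k *\<^sub>R a" by (rule loewner_le_trans[rotated])
      from loewner_le_add[OF loewner_le_refl[of a] this] show ?thesis
        by (simp add: K_def scaleR_left_distrib)
    qed
    have quad: "(1/kA)\<^sup>2 * (norm (Z - X))\<^sup>2 \<le> N \<bullet> (D ** N ** D)"
    proof -
      have "(1/kA) *\<^sub>R mat 1 \<preceq> iA"
        unfolding iA_def by (rule feas_inverse_lower_bound[OF S1 X kA_def[symmetric]])
      from loewner_le_congruence[OF Rs this]
      have "(1/kA) *\<^sub>R C \<preceq> R ** iA ** R" by (simp add: matrix_distribs RR)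
      also have "\<dots> \<preceq> N"
        using pos_semidef_add[OF E M1(1)] by (simp add: loewner_le_def N_def)
      finally have CN: "(1/kA) *\<^sub>R C \<preceq> N" .
      have "(1/kA) * (C \<bullet> (D ** N ** D)) \<le> N \<bullet> (D ** N ** D)"
        using inner_loewner_mono[OF CN pos_semidef_congruence[OF D pos_def_imp_semidef[OF N]]] by simp
      moreover have "(1/kA) * ((1/kA) * (C \<bullet> (D ** C ** D))) \<le> (1/kA) * (C \<bullet> (D ** N ** D))"
        using inner_loewner_mono[OF loewner_le_congruence[OF D CN] C] kA
        by (intro mult_left_mono) (simp_all add: inner_commute matrix_distribs)
      moreover have "C \<bullet> (D ** C ** D) = (norm (Z - X))\<^sup>2"
      proof -
        have t: "transpose R = R" "transpose D = D" using Rs D by (auto simp: symm_def)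
        have "(R ** D ** R) \<bullet> (R ** D ** R) = D \<bullet> (R ** (R ** D ** R) ** R)"
          by (rule inner_congruence[OF Rs])
        also have "\<dots> = D \<bullet> (C ** D ** C)" 
          by (simp add: RR matrix_mul_assoc) (simp add: RR flip: matrix_mul_assoc)
        also have "\<dots> = (D ** C) \<bullet> (C ** D)"
          using inner_mult_right[of D C "C ** D"] C by (simp add: symm_def pos_semidef_def)
        also have "\<dots> = C \<bullet> (D ** C ** D)"
          using inner_mult_left[of D C "C ** D"] by (simp add: t matrix_mul_assoc)
        finally show ?thesis by (simp add: RDR power2_norm_eq_inner)
      qed
      ultimately show ?thesis by (simp add: power2_eq_square)
    qed
    have tangent: "- (norm G * norm (Z - X)) \<le> (lam *\<^sub>R matrix_inv b - N) \<bullet> D"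
    proof -
      have "(lam *\<^sub>R matrix_inv b - N) \<bullet> D = (R ** G ** R) \<bullet> D - M2 \<bullet> D"
        by (simp add: N_eq inner_diff_left inner_add_left)
      also have "(R ** G ** R) \<bullet> D = G \<bullet> (Z - X)" by (simp add: inner_congruence[OF Rs] RDR)
      finally have "(lam *\<^sub>R matrix_inv b - N) \<bullet> D = G \<bullet> (Z - X) - M2 \<bullet> D" .
      moreover have "M2 \<bullet> D \<le> 0" using M2 z(2) by (simp add: D_def)
      moreover have "- (norm G * norm (Z - X)) \<le> G \<bullet> (Z - X)"
        using Cauchy_Schwarz_ineq2[of G "Z - X"] by linarith
      ultimately show ?thesis by linarith
    qed
    have "(lam *\<^sub>R matrix_inv b - N) \<bullet> D + (1 - \<theta>) / (2 * K) * (N \<bullet> (D ** N ** D))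
        \<le> lam * (ln (det (b + D)) - ln (det b)) - (ln (det (a + D)) - ln (det a))"
      using ln_det_difference_above_tangent[OF a _ D mab m(1) K aDK, of lam \<theta>]
        pos_def_add[OF z(1) s'] lam \<theta> by (simp add: aD(1) inv_a \<kappa>_def)
    moreover have "(1 - \<theta>) / (2 * K) * ((1/kA)\<^sup>2 * (norm (Z - X))\<^sup>2)
        \<le> (1 - \<theta>) / (2 * K) * (N \<bullet> (D ** N ** D))"
      using \<theta> K by (intro mult_left_mono quad) auto
    moreover have "(1 - \<theta>) / (2 * K) * ((1/kA)\<^sup>2 * (norm (Z - X))\<^sup>2) = c * (norm (Z - X))\<^sup>2"
      by (simp add: c_def)
    ultimately show ?thesis using tangent objective by (simp add: G_def)
  qed
  have "0 < \<tau> / kB" using \<tau> kB by simp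
  with c growth show ?thesis by blast
qed

section \<open>Convexity and smoothness of the two log-determinant functions\<close>

lemma g_fun_eq_h_fun: "g_fun S = h_fun 1 S"
  by (rule ext) (simp add: g_fun_def h_fun_def)

lemma closed_pos_semidef: "closed {A :: real^'n^'n. pos_semidef A}"
proof -
  have cont: "continuous_on UNIV (\<lambda>A :: real^'n^'n. x \<bullet> (A *v x))" for x
    by (simp add: matrix_vector_mult_def inner_vec_def) (intro continuous_intros)
  have "closed {A :: real^'n^'n. \<forall>x. 0 \<le> x \<bullet> (A *v x)}"
    by (intro closed_Collect_all closed_Collect_le continuous_on_const cont)
  from closed_Int[OF closed_symm this] show ?thesis
    by (simp add: pos_semidef_def Collect_conj_eq)
qed

text \<open>In the epigraph the determinant is at least \<open>exp (- t / lam)\<close>. This closed condition keeps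
  limits of epigraph points away from the singular matrices, so the open condition of positive
  definiteness may be replaced by semidefiniteness.\<close>

lemma closed_h_fun:
  fixes S :: "real^'n^'n"
  assumes S: "S \<in> symm" and lam: "0 < lam"
  shows "closed_fun (h_fun lam S)"
proof -
  have "epi (h_fun lam S)
      = {p. pos_semidef (fst p + S)} \<inter> {p. exp (- snd p / lam) \<le> det (fst p + S)}"
  proof -
    have "(X \<in> symm \<and> h_fun lam S X \<le> ereal t)
        \<longleftrightarrow> pos_semidef (X + S) \<and> exp (- t / lam) \<le> det (X + S)" for X t
    proof -
      have ineq: "- lam * ln (det (X + S)) \<le> t \<longleftrightarrow> exp (- t / lam) \<le> det (X + S)"
        if "pos_def (X + S)"
      proof -
        have "- lam * ln (det (X + S)) \<le> t \<longleftrightarrow> - t / lam \<le> ln (det (X + S))"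
          using lam by (auto simp: field_simps)
        then show ?thesis using pos_def_det[OF that] by (simp add: ln_ge_iff)
      qed
      have sym: "X \<in> symm" if "pos_semidef (X + S)"
        using symm_diff[OF pos_semidef_symm[OF that] S] by simp
      have pd: "pos_def (X + S)" if "pos_semidef (X + S)" "exp (- t / lam) \<le> det (X + S)"
      proof -
        have "0 < det (X + S)" using that(2) by (rule less_le_trans[OF exp_gt_zero])
        then show ?thesis using that(1) by (intro pos_semidef_det_nonzero less_imp_neq[THEN not_sym])
      qed
      show ?thesis
        using ineq sym pd pos_def_imp_semidef[of "X + S"] by (auto simp: h_fun_def)
    qed
    then show ?thesis by (auto simp: epi_def)
  qed
  moreover have "closed {p :: (real^'n^'n) \<times> real. pos_semidef (fst p + S)}"
    using closed_vimage[OF closed_pos_semidef, of "\<lambda>p :: (real^'n^'n) \<times> real. fst p + S"]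
    by (simp add: vimage_def continuous_intros)
  moreover have "closed {p :: (real^'n^'n) \<times> real. exp (- snd p / lam) \<le> det (fst p + S)}"
    using lam by (intro closed_Collect_le continuous_on_det continuous_intros) auto
  ultimately show ?thesis by (simp add: closed_fun_def closed_Int)
qed

lemma ln_det_concave_combination:
  fixes A B :: "real^'n^'n"
  assumes A: "pos_def A" and B: "pos_def B" and uv: "0 \<le> u" "0 \<le> v" "u + v = 1"
  shows "pos_def (u *\<^sub>R A + v *\<^sub>R B)"
    and "u * ln (det A) + v * ln (det B) \<le> ln (det (u *\<^sub>R A + v *\<^sub>R B))"
proof -
  let ?M = "u *\<^sub>R A + v *\<^sub>R B"
  show M: "pos_def ?M"
  proof (cases "v = 0")
    case True
    then show ?thesis using uv A by simp
  next
    case False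
    then show ?thesis using uv A B
      by (intro pos_def_add pos_def_scaleR pos_semidef_scaleR pos_def_imp_semidef) auto
  qed
  have "u * (ln (det A) - ln (det ?M)) + v * (ln (det B) - ln (det ?M))
      \<le> u * (matrix_inv ?M \<bullet> (A - ?M)) + v * (matrix_inv ?M \<bullet> (B - ?M))"
    by (intro add_mono mult_left_mono ln_det_concave M A B uv)
  also have "\<dots> = matrix_inv ?M \<bullet> (u *\<^sub>R A + v *\<^sub>R B - (u + v) *\<^sub>R ?M)"
    by (simp add: inner_diff_right inner_add_right algebra_simps)
  also have "\<dots> = 0" by (simp only: uv scaleR_one diff_self inner_zero_right)
  finally have "u * ln (det A) + v * ln (det B) \<le> (u + v) * ln (det ?M)"
    by (simp add: algebra_simps)
  then show "u * ln (det A) + v * ln (det B) \<le> ln (det ?M)" by (simp only: uv mult_1)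
qed

lemma convex_h_fun:
  fixes S :: "real^'n^'n"
  assumes lam: "0 < lam"
  shows "convex_fun (h_fun lam S)"
  unfolding convex_fun_def
proof (rule convexI)
  fix p q :: "(real^'n^'n) \<times> real" and u v :: real
  assume p: "p \<in> epi (h_fun lam S)" and q: "q \<in> epi (h_fun lam S)"
    and uv: "0 \<le> u" "0 \<le> v" "u + v = 1"
  obtain X t where p_eq: "p = (X, t)" by (cases p)
  obtain Z w where q_eq: "q = (Z, w)" by (cases q)
  have X: "X \<in> symm" "pos_def (X + S)" "- lam * ln (det (X + S)) \<le> t"
    using p by (auto simp: p_eq epi_def h_fun_def split: if_splits)
  have Z: "Z \<in> symm" "pos_def (Z + S)" "- lam * ln (det (Z + S)) \<le> w"
    using q by (auto simp: q_eq epi_def h_fun_def split: if_splits)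
  have M_eq: "u *\<^sub>R X + v *\<^sub>R Z + S = u *\<^sub>R (X + S) + v *\<^sub>R (Z + S)"
  proof -
    have "u *\<^sub>R (X + S) + v *\<^sub>R (Z + S) = u *\<^sub>R X + v *\<^sub>R Z + (u + v) *\<^sub>R S"
      by (simp add: algebra_simps)
    then show ?thesis by (simp only: uv scaleR_one)
  qed
  note comb = ln_det_concave_combination[OF X(2) Z(2) uv, folded M_eq]
  have "- lam * ln (det (u *\<^sub>R X + v *\<^sub>R Z + S))
      \<le> - lam * (u * ln (det (X + S)) + v * ln (det (Z + S)))"
    using comb(2) lam by simp
  also have "\<dots> = u * (- lam * ln (det (X + S))) + v * (- lam * ln (det (Z + S)))"
    by (simp add: algebra_simps)
  also have "\<dots> \<le> u * t + v * w" by (intro add_mono mult_left_mono X Z uv)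
  finally show "u *\<^sub>R p + v *\<^sub>R q \<in> epi (h_fun lam S)"
    using X(1) Z(1) comb(1) by (simp add: p_eq q_eq epi_def h_fun_def)
qed

lemma shifted_neg_ln_det_has_derivative:
  fixes X S :: "real^'n^'n"
  assumes "S \<in> symm" "pos_def (X + S)"
  shows "((\<lambda>Z. - ln (det (Z + S))) has_derivative (\<lambda>H. (- matrix_inv (X + S)) \<bullet> H))
    (at X within symm)"
proof (rule has_derivative_in_compose[where g = "\<lambda>Z. - ln (det Z)"])
  show "((\<lambda>Z. Z + S) has_derivative (\<lambda>H. H)) (at X within symm)"
    by (auto intro!: derivative_eq_intros)
  show "((\<lambda>Z. - ln (det Z)) has_derivative (\<bullet>) (- matrix_inv (X + S)))
      (at (X + S) within (\<lambda>Z. Z + S) ` symm)"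
    using neg_ln_det_has_derivative[OF assms(2)]
    by (rule has_derivative_subset) (use assms(1) in auto)
qed

lemma shifted_pos_def_nearby:
  fixes X S :: "real^'n^'n"
  assumes S: "S \<in> symm" and X: "pos_def (X + S)"
  obtains a where "a > 0" "\<forall>Z\<in>symm. dist Z X < a \<longrightarrow> pos_def (Z + S)"
proof -
  obtain a where a: "a > 0"
    and near: "\<forall>Z\<in>symm. norm (Z - (X + S)) \<le> a \<longrightarrow> a *\<^sub>R mat 1 \<preceq> Z \<and> pos_def Z"
    using pos_def_nearby[OF X] .
  have "pos_def (Z + S)" if "Z \<in> symm" "dist Z X < a" for Z
    using near[rule_format, of "Z + S"] that S by (simp add: dist_norm)
  with a that show ?thesis by blast
qed

lemma h_fun_has_grad:
  fixes X S :: "real^'n^'n"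
  assumes S: "S \<in> symm" and X: "X \<in> symm" "pos_def (X + S)"
  shows "has_grad (h_fun lam S) (- lam *\<^sub>R matrix_inv (X + S)) X"
proof -
  obtain a where a: "a > 0" and near: "\<forall>Z\<in>symm. dist Z X < a \<longrightarrow> pos_def (Z + S)"
    using shifted_pos_def_nearby[OF S X(2)] .
  have "\<forall>\<^sub>F Z in nhds X. Z \<in> symm \<longrightarrow> \<bar>h_fun lam S Z\<bar> \<noteq> \<infinity>"
    unfolding eventually_nhds_metric using a near by (intro exI[of _ a]) (auto simp: h_fun_def)
  moreover have "((\<lambda>Z. real_of_ereal (h_fun lam S Z)) has_derivative
      (\<lambda>H. (- lam *\<^sub>R matrix_inv (X + S)) \<bullet> H)) (at X within symm)"
  proof (rule has_derivative_transform_within[OF _ a X(1)])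
    show "((\<lambda>Z. lam * (- ln (det (Z + S)))) has_derivative
        (\<lambda>H. (- lam *\<^sub>R matrix_inv (X + S)) \<bullet> H)) (at X within symm)"
      using has_derivative_mult_right[OF shifted_neg_ln_det_has_derivative[OF S X(2)], of lam]
      by simp
    show "lam * (- ln (det (Z + S))) = real_of_ereal (h_fun lam S Z)"
      if "Z \<in> symm" "dist Z X < a" for Z
      using near that by (simp add: h_fun_def)
  qed
  ultimately show ?thesis using X by (simp add: has_grad_def)
qed

lemma continuous_on_matrix_inv: "continuous_on {A :: real^'n^'n. pos_def A} matrix_inv"
  unfolding continuous_on_def
  by (auto intro: tendsto_within_subset[OF matrix_inv_tendsto])

lemma h_fun_C1:
  assumes S: "S \<in> symm"
  shows "C1_on (eff_dom (h_fun lam S)) (h_fun lam S)"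
  unfolding C1_on_def eff_dom_h_fun
proof (intro exI conjI)
  show "\<forall>X\<in>{X \<in> symm. pos_def (X + S)}. has_grad (h_fun lam S) (- lam *\<^sub>R matrix_inv (X + S)) X"
    using h_fun_has_grad[OF S] by blast
  show "continuous_on {X \<in> symm. pos_def (X + S)} (\<lambda>X. - lam *\<^sub>R matrix_inv (X + S))"
    by (intro continuous_intros continuous_on_compose2[OF continuous_on_matrix_inv]) auto
qed

section \<open>The conjugate and its Bregman distance\<close>

text \<open>The solution \<open>X\<close> of \<open>\<nabla>h(X) = U\<close> for negative definite \<open>U\<close>, where the supremum that defines
  the conjugate is attained. These maximizers are subgradients of the conjugate and depend
  continuously on \<open>U\<close>, so they are its gradients.\<close>

definition conj_point :: "real \<Rightarrow> real^'n^'n \<Rightarrow> real^'n^'n \<Rightarrow> real^'n^'n" where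
  "conj_point lam S U = lam *\<^sub>R matrix_inv (- U) - S"

lemma conjugate_ge:
  assumes "Z \<in> symm" "pos_def (Z + S)"
  shows "ereal (Z \<bullet> U + lam * ln (det (Z + S))) \<le> conjugate (h_fun lam S) U"
  unfolding conjugate_def using assms
  by (intro SUP_upper2[of Z]) (auto simp: h_fun_def)

lemma conj_point_pos_def:
  assumes "0 < lam" "pos_def (- U)"
  shows "pos_def (conj_point lam S U + S)"
  using assms by (simp add: conj_point_def pos_def_scaleR pos_def_matrix_inv)

lemma conjugate_at_neg_def:
  fixes S U :: "real^'n^'n"
  assumes lam: "0 < lam" and S: "S \<in> symm" and U: "pos_def (- U)"
  shows "conjugate (h_fun lam S) U
    = ereal (conj_point lam S U \<bullet> U + lam * ln (det (conj_point lam S U + S)))"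
proof (rule antisym)
  let ?p = "conj_point lam S U"
  have A: "pos_def (?p + S)" by (rule conj_point_pos_def[OF lam U])
  have p: "?p \<in> symm" using symm_diff[OF pos_def_symm[OF A] S] by simp
  have inv: "matrix_inv (?p + S) = (1/lam) *\<^sub>R (- U)"
    using lam by (simp add: conj_point_def matrix_inv_scaleR[OF pos_def_matrix_inv[OF U]]
        matrix_inv_matrix_inv[OF U])
  show "ereal (?p \<bullet> U + lam * ln (det (?p + S))) \<le> conjugate (h_fun lam S) U"
    by (rule conjugate_ge[OF p A])
  show "conjugate (h_fun lam S) U \<le> ereal (?p \<bullet> U + lam * ln (det (?p + S)))"
    unfolding conjugate_def
  proof (rule SUP_least)
    fix Z :: "real^'n^'n" assume Z: "Z \<in> symm"
    show "ereal (Z \<bullet> U) - h_fun lam S Z \<le> ereal (?p \<bullet> U + lam * ln (det (?p + S)))"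
    proof (cases "pos_def (Z + S)")
      case True
      have "ln (det (Z + S)) - ln (det (?p + S)) \<le> matrix_inv (?p + S) \<bullet> ((Z + S) - (?p + S))"
        by (rule ln_det_concave[OF A True])
      also have "\<dots> = (1/lam) * (?p \<bullet> U - Z \<bullet> U)"
        by (simp add: inv inner_diff_right inner_commute diff_divide_distrib)
      finally have "lam * (ln (det (Z + S)) - ln (det (?p + S))) \<le> ?p \<bullet> U - Z \<bullet> U"
        using lam by (simp add: field_simps)
      then show ?thesis using True by (simp add: h_fun_def algebra_simps)
    qed (simp add: h_fun_def)
  qed
qed

lemma conjugate_has_grad:
  fixes S X :: "real^'n^'n"
  assumes lam: "0 < lam" and S: "S \<in> symm" and X: "X \<in> symm" "pos_def (X + S)"
  defines "V \<equiv> - lam *\<^sub>R matrix_inv (X + S)"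
  shows "conjugate (h_fun lam S) V = ereal (X \<bullet> V + lam * ln (det (X + S)))"
    and "has_grad (conjugate (h_fun lam S)) X V"
proof -
  let ?F = "conjugate (h_fun lam S)" and ?p = "conj_point lam S"
  have V: "pos_def (- V)"
    using X lam by (simp add: V_def pos_def_scaleR pos_def_matrix_inv)
  have Vs: "V \<in> symm" using symm_uminus[OF pos_def_symm[OF V]] by simp
  have pV: "?p V = X"
    using lam by (simp add: conj_point_def V_def matrix_inv_scaleR[OF pos_def_matrix_inv[OF X(2)]]
        matrix_inv_matrix_inv[OF X(2)])
  show "?F V = ereal (X \<bullet> V + lam * ln (det (X + S)))"
    using conjugate_at_neg_def[OF lam S V] by (simp add: pV)
  have V0: "pos_def (- V + 0)" using V by simp
  obtain a where a: "a > 0" and near: "\<forall>Z\<in>symm. dist Z (- V) < a \<longrightarrow> pos_def (Z + 0)"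
    using shifted_pos_def_nearby[OF symm_0 V0] .
  have nd: "pos_def (- U)" if "U \<in> symm" "dist U V < a" for U
    using near[rule_format, of "- U"] that by (simp add: dist_norm norm_minus_commute)
  have ps: "?p U \<in> symm" if "pos_def (- U)" for U
    using symm_diff[OF pos_def_symm[OF conj_point_pos_def[OF lam that, of S]] S] by simp
  have sub: "?p U \<bullet> (W - U) \<le> real_of_ereal (?F W) - real_of_ereal (?F U)"
    if U: "pos_def (- U)" and W: "pos_def (- W)" for U W
  proof -
    have "ereal (?p U \<bullet> W + lam * ln (det (?p U + S))) \<le> ?F W"
      by (rule conjugate_ge[OF ps[OF U] conj_point_pos_def[OF lam U]])
    then show ?thesis
      by (simp add: conjugate_at_neg_def[OF lam S U] conjugate_at_neg_def[OF lam S W] inner_diff_right)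
  qed
  have "\<forall>\<^sub>F U in nhds V. U \<in> symm \<longrightarrow> \<bar>?F U\<bar> \<noteq> \<infinity>"
    unfolding eventually_nhds_metric
    using a nd by (intro exI[of _ a]) (auto simp: conjugate_at_neg_def[OF lam S])
  moreover have "((\<lambda>U. real_of_ereal (?F U)) has_derivative (\<lambda>H. ?p V \<bullet> H)) (at V within symm)"
  proof (rule has_derivative_from_subgradients)
    have ev: "\<forall>\<^sub>F U in at V within symm. pos_def (- U)"
      unfolding eventually_at using a nd by blast
    show "\<forall>\<^sub>F U in at V within symm. ?p V \<bullet> (U - V) \<le> real_of_ereal (?F U) - real_of_ereal (?F V)"
      using ev by eventually_elim (rule sub[OF V])
    show "\<forall>\<^sub>F U in at V within symm. real_of_ereal (?F U) - real_of_ereal (?F V) \<le> ?p U \<bullet> (U - V)"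
      using ev
    proof eventually_elim
      case (elim U)
      show ?case using sub[OF elim V] by (simp add: inner_diff_right)
    qed
    have "filterlim uminus (at (- V) within symm) (at V within symm)"
      unfolding filterlim_at
      by (auto simp: eventually_at_filter intro!: tendsto_intros)
    from filterlim_compose[OF matrix_inv_tendsto[OF V] this]
    show "(?p \<longlongrightarrow> ?p V) (at V within symm)"
      unfolding conj_point_def by (intro tendsto_intros) simp
  qed
  ultimately show "has_grad ?F X V" using X Vs by (simp add: has_grad_def pV)
qed

text \<open>Every \<open>Z\<close> in the domain of \<open>h\<close> is a candidate in the supremum that defines the conjugate at
  \<open>U\<close>. The bound holds for arbitrary \<open>U\<close>, also where the conjugate is infinite.\<close>

lemma bregman_conjugate_ge:
  fixes S X U Z :: "real^'n^'n"
  assumes lam: "0 < lam" and S: "S \<in> symm" and X: "X \<in> symm" "pos_def (X + S)"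
    and Z: "Z \<in> symm" "pos_def (Z + S)"
  defines "V \<equiv> - lam *\<^sub>R matrix_inv (X + S)"
  shows "ereal ((Z - X) \<bullet> (U - V)
        + lam * (ln (det (Z + S)) - ln (det (X + S)) - matrix_inv (X + S) \<bullet> (Z - X)))
      \<le> bregman (conjugate (h_fun lam S)) U V"
proof -
  let ?F = "conjugate (h_fun lam S)"
  note c = conjugate_has_grad[OF lam S X, folded V_def]
  have "ereal (Z \<bullet> U + lam * ln (det (Z + S))) - ?F V - ereal (X \<bullet> (U - V)) \<le> bregman ?F U V"
    unfolding bregman_def grad_eq[OF c(2)]
    by (intro ereal_minus_mono conjugate_ge Z order_refl)
  moreover have "matrix_inv (X + S) \<bullet> (Z - X) * lam = - (V \<bullet> (Z - X))" by (simp add: V_def)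
  then have "(Z - X) \<bullet> (U - V)
        + lam * (ln (det (Z + S)) - ln (det (X + S)) - matrix_inv (X + S) \<bullet> (Z - X))
      = Z \<bullet> U + lam * ln (det (Z + S)) - (X \<bullet> V + lam * ln (det (X + S))) - X \<bullet> (U - V)"
    by (simp add: algebra_simps inner_commute)
  ultimately show ?thesis by (simp add: c(1))
qed

text \<open>The tangent inequality at \<open>A + D\<close>, with its gradient replaced by the one at \<open>A\<close>.\<close>

lemma ln_det_second_order_lower:
  fixes A D :: "real^'n^'n"
  assumes A: "pos_def A" and AD: "pos_def (A + D)" and D: "D \<in> symm"
  shows "matrix_inv A \<bullet> D - norm (matrix_inv A) * norm (matrix_inv (A + D)) * (norm D)\<^sup>2
    \<le> ln (det (A + D)) - ln (det A)"
proof -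
  have AD': "pos_def (A + 1 *\<^sub>R D)" using AD by simp
  have "(matrix_inv A - matrix_inv (A + D)) \<bullet> D = matrix_inv A \<bullet> (D ** matrix_inv (A + D) ** D)"
    using matrix_inv_diff_inner[OF A AD' D] by simp
  also have "\<dots> \<le> norm (matrix_inv A) * norm (D ** matrix_inv (A + D) ** D)"
    by (rule norm_cauchy_schwarz)
  also have "\<dots> \<le> norm (matrix_inv A) * (norm D * norm (matrix_inv (A + D)) * norm D)"
    by (intro mult_left_mono order_trans[OF norm_matrix_mult] mult_right_mono norm_matrix_mult
        norm_ge_zero)
  also have "\<dots> = norm (matrix_inv A) * norm (matrix_inv (A + D)) * (norm D)\<^sup>2"
    by (simp add: power2_eq_square)
  finally have "matrix_inv A \<bullet> D - norm (matrix_inv A) * norm (matrix_inv (A + D)) * (norm D)\<^sup>2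
      \<le> matrix_inv (A + D) \<bullet> D"
    by (simp add: inner_diff_left)
  also have "\<dots> \<le> ln (det (A + D)) - ln (det A)"
    using ln_det_concave[OF AD A] by simp
  finally show ?thesis .
qed

text \<open>Strong concavity: add the tangent inequalities at \<open>A\<close> and at the midpoint.\<close>

lemma ln_det_strongly_concave:
  fixes A D :: "real^'n^'n"
  assumes A: "pos_def A" and AD: "pos_def (A + D)" and D: "D \<in> symm" and b: "0 \<le> b"
    and lo: "b *\<^sub>R mat 1 \<preceq> matrix_inv A" "b *\<^sub>R mat 1 \<preceq> matrix_inv (A + (1/2) *\<^sub>R D)"
  shows "ln (det (A + D)) - ln (det A) \<le> matrix_inv A \<bullet> D - b\<^sup>2 / 4 * (norm D)\<^sup>2"
proof -
  let ?M = "A + (1/2) *\<^sub>R D"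
  have M_eq: "?M = (1/2) *\<^sub>R A + (1/2) *\<^sub>R (A + D)"
  proof -
    have "(1/2) *\<^sub>R A + (1/2) *\<^sub>R A = A" by (simp flip: scaleR_left_distrib)
    then show ?thesis by (simp add: scaleR_right_distrib flip: add.assoc)
  qed
  have M: "pos_def ?M"
    unfolding M_eq by (rule ln_det_concave_combination(1)[OF A AD]) auto
  have "ln (det (A + D)) - ln (det ?M) \<le> matrix_inv ?M \<bullet> ((A + D) - ?M)"
    by (rule ln_det_concave[OF M AD])
  also have "(A + D) - ?M = (1/2) *\<^sub>R D"
    using scaleR_left_diff_distrib[of 1 "1/2" D] by simp
  finally have 1: "ln (det (A + D)) - ln (det ?M) \<le> (1/2) * (matrix_inv ?M \<bullet> D)" by simp
  have 2: "ln (det ?M) - ln (det A) \<le> (1/2) * (matrix_inv A \<bullet> D)"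
    using ln_det_concave[OF A M] by simp
  have 3: "matrix_inv A \<bullet> D - matrix_inv ?M \<bullet> D
      = (1/2) * (matrix_inv A \<bullet> (D ** matrix_inv ?M ** D))"
    using matrix_inv_diff_inner[OF A M D] by (simp add: inner_diff_left)
  have "b * (mat 1 \<bullet> (D ** matrix_inv ?M ** D)) \<le> matrix_inv A \<bullet> (D ** matrix_inv ?M ** D)"
    using inner_loewner_mono[OF lo(1) pos_semidef_congruence[OF D
      pos_def_imp_semidef[OF pos_def_matrix_inv[OF M]]]] by simp
  moreover have "b * (b * (norm D)\<^sup>2) \<le> b * (mat 1 \<bullet> (D ** matrix_inv ?M ** D))"
  proof (intro mult_left_mono b)
    have "(D ** (b *\<^sub>R mat 1) ** D) \<bullet> mat 1 \<le> (D ** matrix_inv ?M ** D) \<bullet> mat 1"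
      by (intro inner_loewner_mono loewner_le_congruence D lo pos_def_imp_semidef pos_def_mat_1)
    moreover have "(D ** mat 1 ** D) \<bullet> mat 1 = (norm D)\<^sup>2"
      using inner_mult_left[of D D "mat 1"] D by (simp add: symm_def power2_norm_eq_inner)
    ultimately show "b * (norm D)\<^sup>2 \<le> mat 1 \<bullet> (D ** matrix_inv ?M ** D)"
      by (simp add: inner_commute matrix_distribs)
  qed
  ultimately show ?thesis using 1 2 3 by (simp add: power2_eq_square)
qed

section \<open>The feasible set and the minimizer\<close>

lemma feas_compact: "compact (feas C)" for C :: "real^'n^'n"
proof -
  have "feas C = {X. pos_semidef X} \<inter> (\<lambda>X. C - X) -` {X. pos_semidef X}"
    by (auto simp: feas_iff loewner_le_def)
  then have "closed (feas C)"
    using closed_Int[OF closed_pos_semidef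
        closed_vimage[OF closed_pos_semidef, of "\<lambda>X. C - X"]]
    by (simp add: continuous_intros)
  moreover have "bounded (feas C)" using feas_norm by (auto simp: bounded_iff)
  ultimately show ?thesis by (simp add: compact_eq_bounded_closed)
qed

lemma feas_convex: "convex (feas C)" for C :: "real^'n^'n"
proof (rule convexI)
  fix X Z :: "real^'n^'n" and u v :: real
  assume X: "X \<in> feas C" and Z: "Z \<in> feas C" and uv: "0 \<le> u" "0 \<le> v" "u + v = 1"
  have "C - (u *\<^sub>R X + v *\<^sub>R Z) = (u + v) *\<^sub>R C - (u *\<^sub>R X + v *\<^sub>R Z)" using uv by simp
  also have "\<dots> = u *\<^sub>R (C - X) + v *\<^sub>R (C - Z)" by (simp add: algebra_simps)
  finally have "pos_semidef (C - (u *\<^sub>R X + v *\<^sub>R Z))"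
    using X Z uv by (auto simp: feas_iff loewner_le_def intro!: pos_semidef_add pos_semidef_scaleR)
  then show "u *\<^sub>R X + v *\<^sub>R Z \<in> feas C"
    using X Z uv by (auto simp: feas_iff loewner_le_def intro!: pos_semidef_add pos_semidef_scaleR)
qed

lemma feas_zero: "pos_semidef C \<Longrightarrow> 0 \<in> feas C"
  by (simp add: feas_iff loewner_le_def pos_semidef_0)

lemma continuous_on_ln_det_shift:
  fixes S :: "real^'n^'n"
  assumes "pos_def S"
  shows "continuous_on (feas C) (\<lambda>X. ln (det (X + S)))"
proof (intro continuous_on_ln continuous_on_det continuous_intros ballI)
  show "det (X + S) \<noteq> 0" if "X \<in> feas C" for X
    using pos_def_det[OF feas_pos_def[OF assms that]] by (rule less_imp_neq[THEN not_sym])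
qed

lemma continuous_on_f_obj:
  fixes S1 S2 :: "real^'n^'n"
  assumes "pos_def S1" "pos_def S2"
  shows "continuous_on (feas C) (f_obj lam S1 S2)"
  unfolding f_obj_def by (intro continuous_intros continuous_on_ln_det_shift assms)

lemma minimizer_exists:
  fixes S1 S2 C :: "real^'n^'n"
  assumes "pos_def S1" "pos_def S2" "pos_semidef C"
  shows "\<exists>Xs. is_arg_min (f_obj lam S1 S2) (\<lambda>X. X \<in> feas C) Xs"
  using continuous_attains_inf[OF feas_compact _ continuous_on_f_obj[OF assms(1,2)], of C lam]
    feas_zero[OF assms(3)] by (auto simp: is_arg_min_linorder)

lemma f_opt_eq:
  assumes "is_arg_min (f_obj lam S1 S2) (\<lambda>X. X \<in> feas C) Xs"
  shows "f_opt lam S1 S2 C = ereal (f_obj lam S1 S2 Xs)"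
  unfolding f_opt_def using assms
  by (intro antisym INF_lower INF_greatest) (auto simp: is_arg_min_linorder)

lemma f_obj_has_derivative:
  fixes S1 S2 X :: "real^'n^'n"
  assumes S1: "pos_def S1" and S2: "pos_def S2" and X: "X \<in> feas C"
  shows "(f_obj lam S1 S2 has_derivative (\<lambda>H. objective_gradient lam S1 S2 X \<bullet> H))
    (at X within feas C)"
proof -
  have d: "((\<lambda>Z. - ln (det (Z + S))) has_derivative (\<lambda>H. (- matrix_inv (X + S)) \<bullet> H))
      (at X within feas C)" if "pos_def S" for S
    using shifted_neg_ln_det_has_derivative[OF pos_def_symm[OF that] feas_pos_def[OF that X]]
    by (rule has_derivative_subset) (use feas_symm in blast)
  have "((\<lambda>Z. - ln (det (Z + S1)) - lam * (- ln (det (Z + S2)))) has_derivative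
      (\<lambda>H. (- matrix_inv (X + S1)) \<bullet> H - lam * ((- matrix_inv (X + S2)) \<bullet> H)))
      (at X within feas C)"
    by (intro has_derivative_diff has_derivative_mult_right d S1 S2)
  then show ?thesis
    by (simp add: f_obj_def[abs_def] objective_gradient_def inner_diff_left)
qed

lemma objective_gradient_symm:
  assumes "pos_def S1" "pos_def S2" "X \<in> feas C"
  shows "objective_gradient lam S1 S2 X \<in> symm"
  using feas_pos_def[OF assms(1,3)] feas_pos_def[OF assms(2,3)]
  by (simp add: objective_gradient_def)

lemma objective_gradient_norm:
  assumes "pos_def S1" "pos_def S2" "X \<in> feas C" "0 \<le> lam"
  shows "norm (objective_gradient lam S1 S2 X) \<le> lam * norm (matrix_inv S2) + norm (matrix_inv S1)"
  unfolding objective_gradient_def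
  using norm_triangle_ineq4[of "lam *\<^sub>R matrix_inv (X + S2)" "matrix_inv (X + S1)"]
    feas_inverse_norm[OF assms(1,3)] mult_left_mono[OF feas_inverse_norm[OF assms(2,3)] assms(4)]
    assms(4)
  by simp

text \<open>At a global minimizer the stationarity error vanishes, so the growth estimate holds without
  its error term. In particular the minimizer is unique.\<close>

lemma minimizer_quadratic_growth:
  fixes S1 S2 C :: "real^'n^'n"
  assumes S1: "pos_def S1" and S2: "pos_def S2" and C: "pos_semidef C" and lam: "1 < lam"
    and Xs: "is_arg_min (f_obj lam S1 S2) (\<lambda>X. X \<in> feas C) Xs"
  shows "\<exists>c>0. \<forall>Z\<in>feas C. c * (norm (Z - Xs))\<^sup>2 \<le> f_obj lam S1 S2 Z - f_obj lam S1 S2 Xs"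
proof -
  let ?G = "objective_gradient lam S1 S2 Xs"
  have X: "Xs \<in> feas C" "\<And>Z. Z \<in> feas C \<Longrightarrow> f_obj lam S1 S2 Xs \<le> f_obj lam S1 S2 Z"
    using Xs by (auto simp: is_arg_min_linorder)
  have "0 \<le> ?G \<bullet> (Z - Xs)" if "Z \<in> feas C" for Z
    by (rule minimizer_variational_inequality[OF f_obj_has_derivative[OF S1 S2 X(1)]
          feas_convex X(1) that X(2)])
  then have N: "- ?G \<in> normal_cone (feas C) Xs"
    using objective_gradient_symm[OF S1 S2 X(1)] by (simp add: normal_cone_def)
  obtain \<epsilon> c where "\<epsilon> > 0" and c: "c > 0"
    and growth: "\<forall>X\<in>feas C. \<forall>Z\<in>feas C. \<forall>Y\<in>normal_cone (feas C) X.
      norm Y \<le> norm ?G \<longrightarrow> norm (objective_gradient lam S1 S2 X + Y) \<le> \<epsilon> \<longrightarrow>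
      c * (norm (Z - X))\<^sup>2 - norm (objective_gradient lam S1 S2 X + Y) * norm (Z - X)
        \<le> f_obj lam S1 S2 Z - f_obj lam S1 S2 X"
    using growth_from_nearly_stationary[OF S1 S2 C lam norm_ge_zero[of ?G]] by blast
  have "c * (norm (Z - Xs))\<^sup>2 \<le> f_obj lam S1 S2 Z - f_obj lam S1 S2 Xs" if "Z \<in> feas C" for Z
    using growth[rule_format, OF X(1) that N] \<open>\<epsilon> > 0\<close> by simp
  with c show ?thesis by blast
qed

section \<open>The error bound\<close>

text \<open>If the stationarity error \<open>e\<close> is small, the growth estimate bounds the gap by the maximum of
  \<open>e d - c d\<^sup>2\<close> over the distance \<open>d\<close>, which is \<open>e\<^sup>2 / (4 c)\<close>. Otherwise it is enough that the gap
  is bounded on the compact feasible set.\<close>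

lemma gap_le_stationarity_error:
  fixes S1 S2 C :: "real^'n^'n"
  assumes S1: "pos_def S1" and S2: "pos_def S2" and C: "pos_semidef C" and lam: "1 < lam"
    and r: "0 \<le> r"
  shows "\<exists>\<kappa>>0. \<forall>X\<in>feas C. \<forall>Z\<in>feas C. \<forall>Y\<in>normal_cone (feas C) X. norm Y \<le> r \<longrightarrow>
    f_obj lam S1 S2 X - f_obj lam S1 S2 Z
      \<le> \<kappa> * (norm (objective_gradient lam S1 S2 X + Y))\<^sup>2"
proof -
  let ?f = "f_obj lam S1 S2" and ?E = "\<lambda>X Y. norm (objective_gradient lam S1 S2 X + Y)"
  obtain \<epsilon> c where \<epsilon>: "\<epsilon> > 0" and c: "c > 0"
    and growth: "\<forall>X\<in>feas C. \<forall>Z\<in>feas C. \<forall>Y\<in>normal_cone (feas C) X.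
      norm Y \<le> r \<longrightarrow> ?E X Y \<le> \<epsilon> \<longrightarrow> c * (norm (Z - X))\<^sup>2 - ?E X Y * norm (Z - X) \<le> ?f Z - ?f X"
    using growth_from_nearly_stationary[OF S1 S2 C lam r] by blast
  have "bounded (?f ` feas C)"
    by (intro compact_imp_bounded compact_continuous_image continuous_on_f_obj feas_compact S1 S2)
  then obtain B where B: "\<And>X. X \<in> feas C \<Longrightarrow> \<bar>?f X\<bar> \<le> B" by (auto simp: bounded_iff)
  have B0: "0 \<le> B" using B[OF feas_zero[OF C]] by linarith
  define \<kappa> where "\<kappa> = 1 / (4 * c) + 2 * B / \<epsilon>\<^sup>2"
  have \<kappa>: "\<kappa> > 0" using c B0 \<epsilon> by (simp add: \<kappa>_def add_pos_nonneg)
  have "?f X - ?f Z \<le> \<kappa> * (?E X Y)\<^sup>2"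
    if X: "X \<in> feas C" and Z: "Z \<in> feas C" and Y: "Y \<in> normal_cone (feas C) X" "norm Y \<le> r"
    for X Y Z
  proof -
    define e where "e = ?E X Y"
    have e0: "0 \<le> e" by (simp add: e_def)
    show ?thesis
    proof (cases "e \<le> \<epsilon>")
      case True
      define d where "d = norm (Z - X)"
      have "?f X - ?f Z \<le> e * d - c * d\<^sup>2"
        using growth[rule_format, OF X Z Y] True by (simp add: e_def d_def)
      also have "\<dots> = 1 / (4 * c) * e\<^sup>2 - c * (d - e / (2 * c))\<^sup>2"
        using c by (simp add: power2_eq_square field_simps)
      also have "\<dots> \<le> 1 / (4 * c) * e\<^sup>2" using c by simp
      also have "\<dots> \<le> \<kappa> * e\<^sup>2"
        using B0 \<epsilon> by (intro mult_right_mono) (simp_all add: \<kappa>_def)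
      finally show ?thesis by (simp add: e_def)
    next
      case False
      have "?f X - ?f Z \<le> 2 * B" using B[OF X] B[OF Z] by linarith
      also have "\<dots> = 2 * B / \<epsilon>\<^sup>2 * \<epsilon>\<^sup>2" using \<epsilon> by simp
      also have "\<dots> \<le> 2 * B / \<epsilon>\<^sup>2 * e\<^sup>2"
        using False \<epsilon> B0 by (intro mult_left_mono power_mono) auto
      also have "\<dots> \<le> \<kappa> * e\<^sup>2" using c by (intro mult_right_mono) (simp_all add: \<kappa>_def)
      finally show ?thesis by (simp add: e_def)
    qed
  qed
  with \<kappa> show ?thesis by blast
qed

text \<open>Take \<open>Z = X + t G\<close> in \<open>bregman_conjugate_ge\<close>, where \<open>G\<close> is the difference of the two
  arguments of the Bregman distance. The linear term is \<open>t \<parallel>G\<parallel>\<^sup>2\<close>, and for a small fixed step \<open>t\<close>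
  it outweighs twice the second-order term.\<close>

lemma bregman_ge_stationarity_error:
  fixes S1 S2 C :: "real^'n^'n"
  assumes S1: "pos_def S1" and S2: "pos_def S2" and lam: "0 < lam" and r: "0 \<le> r"
  shows "\<exists>\<delta>>0. \<forall>X\<in>feas C. \<forall>Y\<in>symm. norm Y \<le> r \<longrightarrow>
    ereal (\<delta> * (norm (objective_gradient lam S1 S2 X + Y))\<^sup>2)
      \<le> bregman (conjugate (h_fun lam S2)) (grad (g_fun S1) X + Y) (grad (h_fun lam S2) X)"
proof -
  (* M bounds norm G. A step with t M \<le> a keeps S2 + t G above a times the identity, and L bounds the
     second-order term there. *)
  define M where "M = lam * norm (matrix_inv S2) + norm (matrix_inv S1) + r + 1"
  have M: "M \<ge> 1" using lam r by (simp add: M_def)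
  obtain a where a: "a > 0" "\<forall>Z\<in>symm. norm (Z - S2) \<le> a \<longrightarrow> a *\<^sub>R mat 1 \<preceq> Z \<and> pos_def Z"
    using pos_def_nearby[OF S2] .
  let ?I = "(1/a) *\<^sub>R (mat 1 :: real^'n^'n)"
  define L where "L = lam * (norm (matrix_inv S2) * norm ?I) + 1"
  have L: "L \<ge> 1" using lam by (simp add: L_def)
  define t where "t = min (a / M) (1 / (2 * L))"
  have t: "t > 0" "t * M \<le> a" "t * L \<le> 1/2"
  proof -
    show "t > 0" using a M L by (simp add: t_def)
    have "t \<le> a / M" by (simp add: t_def)
    then show "t * M \<le> a" using M by (simp add: field_simps)
    have "t \<le> 1 / (2 * L)" by (simp add: t_def)
    then show "t * L \<le> 1/2" using L by (simp add: field_simps)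
  qed
  have "ereal (t / 2 * (norm (objective_gradient lam S1 S2 X + Y))\<^sup>2)
      \<le> bregman (conjugate (h_fun lam S2)) (grad (g_fun S1) X + Y) (grad (h_fun lam S2) X)"
    if X: "X \<in> feas C" and Y: "Y \<in> symm" "norm Y \<le> r" for X Y
  proof -
    define G where "G = objective_gradient lam S1 S2 X + Y"
    have Xs: "X \<in> symm" by (rule feas_symm[OF X])
    have X2: "pos_def (X + S2)" by (rule feas_pos_def[OF S2 X])
    have grad_h: "grad (h_fun lam S2) X = - lam *\<^sub>R matrix_inv (X + S2)"
      by (rule grad_eq[OF h_fun_has_grad[OF pos_def_symm[OF S2] Xs X2]])
    have grad_g: "grad (g_fun S1) X = - matrix_inv (X + S1)"
      using grad_eq[OF h_fun_has_grad[OF pos_def_symm[OF S1] Xs feas_pos_def[OF S1 X]], of 1]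
      by (simp add: g_fun_eq_h_fun)
    have G_diff: "grad (g_fun S1) X + Y - grad (h_fun lam S2) X = G"
      by (simp add: grad_g grad_h G_def objective_gradient_def)
    have Gs: "G \<in> symm" using objective_gradient_symm[OF S1 S2 X] Y by (simp add: G_def)
    have "norm G \<le> M"
      using norm_triangle_ineq[of "objective_gradient lam S1 S2 X" Y]
        objective_gradient_norm[OF S1 S2 X less_imp_le[OF lam]] Y by (simp add: G_def M_def)
    then have tG: "norm (t *\<^sub>R G) \<le> a"
      using order_trans[OF mult_left_mono[of "norm G" M t] t(2)] t(1) by simp
    let ?Z = "X + t *\<^sub>R G"
    have near: "a *\<^sub>R mat 1 \<preceq> S2 + t *\<^sub>R G"
      using a(2) tG Gs S2 by simp
    have "S2 + t *\<^sub>R G \<preceq> X + S2 + t *\<^sub>R G" using X by (simp add: loewner_le_def feas_iff)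
    from loewner_le_trans[OF near this] have le: "a *\<^sub>R mat 1 \<preceq> X + S2 + t *\<^sub>R G" .
    have pI: "pos_def (a *\<^sub>R mat 1 :: real^'n^'n)" using a by (intro pos_def_scaleR pos_def_mat_1)
    have Z2: "pos_def (X + S2 + t *\<^sub>R G)" by (rule pos_def_loewner_mono[OF pI le])
    have "matrix_inv (X + S2 + t *\<^sub>R G) \<preceq> ?I"
      using matrix_inv_antimono[OF pI le] a by (simp add: matrix_inv_scaled_identity)
    then have inv_Z: "norm (matrix_inv (X + S2 + t *\<^sub>R G)) \<le> norm ?I"
      by (intro norm_loewner_mono pos_def_imp_semidef pos_def_matrix_inv Z2)
    have "lam * (norm (matrix_inv (X + S2)) * norm (matrix_inv (X + S2 + t *\<^sub>R G)))
        \<le> lam * (norm (matrix_inv S2) * norm ?I)"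
      using lam by (intro mult_left_mono mult_mono feas_inverse_norm[OF S2 X] inv_Z) auto
    then have "lam * (norm (matrix_inv (X + S2)) * norm (matrix_inv (X + S2 + t *\<^sub>R G))) \<le> L"
      by (simp add: L_def)
    then have "lam * (norm (matrix_inv (X + S2)) * norm (matrix_inv (X + S2 + t *\<^sub>R G)))
          * (norm (t *\<^sub>R G))\<^sup>2 \<le> L * (norm (t *\<^sub>R G))\<^sup>2"
      by (rule mult_right_mono) simp
    moreover define q where "q = norm (matrix_inv (X + S2)) * norm (matrix_inv (X + S2 + t *\<^sub>R G))
      * (norm (t *\<^sub>R G))\<^sup>2"
    ultimately have lq: "lam * q \<le> L * (norm (t *\<^sub>R G))\<^sup>2" by (simp only: q_def mult.assoc)
    define w where "w = ln (det (X + S2 + t *\<^sub>R G)) - ln (det (X + S2))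
      - matrix_inv (X + S2) \<bullet> (t *\<^sub>R G)"
    have "- q \<le> w"
      using ln_det_second_order_lower[OF X2 Z2 symm_scaleR[OF Gs]]
      unfolding q_def w_def by linarith
    then have "lam * (- q) \<le> lam * w" using lam by (intro mult_left_mono) auto
    moreover have "L * (norm (t *\<^sub>R G))\<^sup>2 \<le> t / 2 * (norm G)\<^sup>2"
    proof -
      have "L * (norm (t *\<^sub>R G))\<^sup>2 = (t * L) * (t * (norm G)\<^sup>2)"
        by (simp add: power2_eq_square)
      also have "\<dots> \<le> 1/2 * (t * (norm G)\<^sup>2)" using t by (intro mult_right_mono) auto
      finally show ?thesis by simp
    qed
    moreover have "(t *\<^sub>R G) \<bullet> G = t * (norm G)\<^sup>2" by (simp add: power2_norm_eq_inner)
    ultimately have "t / 2 * (norm G)\<^sup>2 \<le> (t *\<^sub>R G) \<bullet> G + lam * w"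
      using lq by linarith
    moreover have Z_eq: "?Z + S2 = X + S2 + t *\<^sub>R G" by (simp add: add_ac)
    ultimately have "ereal (t / 2 * (norm G)\<^sup>2)
        \<le> ereal ((?Z - X) \<bullet> (grad (g_fun S1) X + Y - grad (h_fun lam S2) X)
          + lam * (ln (det (?Z + S2)) - ln (det (X + S2)) - matrix_inv (X + S2) \<bullet> (?Z - X)))"
      unfolding G_diff Z_eq w_def by simp
    also have "\<dots> \<le> bregman (conjugate (h_fun lam S2)) (grad (g_fun S1) X + Y) (grad (h_fun lam S2) X)"
      unfolding grad_h
      by (rule bregman_conjugate_ge[OF lam pos_def_symm[OF S2] Xs X2])
        (use Xs Gs Z2 in \<open>simp_all add: add_ac\<close>)
    finally show ?thesis by (simp add: G_def)
  qed
  with t(1) show ?thesis by (intro exI[of _ "t / 2"]) auto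
qed

section \<open>The DCA iteration\<close>

lemma dca_sub_eq:
  fixes S1 S2 C :: "real^'n^'n"
  assumes S1: "pos_def S1" and S2: "pos_def S2" and Xk: "Xk \<in> feas C" and Z: "Z \<in> feas C"
  shows "dca_sub lam S1 S2 Xk Z = ereal (- ln (det (Z + S1)) + lam * ln (det (Xk + S2))
    + lam * (matrix_inv (Xk + S2) \<bullet> (Z - Xk)))"
proof -
  have X2: "pos_def (Xk + S2)" by (rule feas_pos_def[OF S2 Xk])
  have "grad (h_fun lam S2) Xk = - lam *\<^sub>R matrix_inv (Xk + S2)"
    by (rule grad_eq[OF h_fun_has_grad[OF pos_def_symm[OF S2] feas_symm[OF Xk] X2]])
  then show ?thesis
    using X2 feas_pos_def[OF S1 Z] by (simp add: dca_sub_def g_fun_def h_fun_def)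
qed

lemma dca_sub_minimizer_exists:
  fixes S1 S2 C :: "real^'n^'n"
  assumes S1: "pos_def S1" and S2: "pos_def S2" and C: "pos_semidef C" and Xk: "Xk \<in> feas C"
  shows "\<exists>X. is_arg_min (dca_sub lam S1 S2 Xk) (\<lambda>Z. Z \<in> feas C) X"
proof -
  let ?\<phi> = "\<lambda>Z. - ln (det (Z + S1)) + lam * ln (det (Xk + S2))
    + lam * (matrix_inv (Xk + S2) \<bullet> (Z - Xk))"
  have "continuous_on (feas C) ?\<phi>"
    by (intro continuous_intros continuous_on_ln_det_shift S1)
  then obtain X where X: "X \<in> feas C" "\<And>Z. Z \<in> feas C \<Longrightarrow> ?\<phi> X \<le> ?\<phi> Z"
    using continuous_attains_inf[OF feas_compact, of C ?\<phi>] feas_zero[OF C] by blast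
  then have "is_arg_min (dca_sub lam S1 S2 Xk) (\<lambda>Z. Z \<in> feas C) X"
    by (simp add: is_arg_min_linorder dca_sub_eq[OF S1 S2 Xk])
  then show ?thesis by blast
qed

text \<open>The normal vector in the optimality condition of the subproblem turns the stationarity error
  at the new iterate into the change of \<open>\<nabla>h\<close> over the step.\<close>

lemma dca_step_normal_vector:
  fixes S1 S2 C :: "real^'n^'n"
  assumes S1: "pos_def S1" and S2: "pos_def S2" and Xk: "Xk \<in> feas C"
    and X: "is_arg_min (dca_sub lam S1 S2 Xk) (\<lambda>Z. Z \<in> feas C) X"
  shows "matrix_inv (X + S1) - lam *\<^sub>R matrix_inv (Xk + S2) \<in> normal_cone (feas C) X"
proof -
  let ?\<phi> = "\<lambda>Z. - ln (det (Z + S1)) + lam * ln (det (Xk + S2))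
    + lam * (matrix_inv (Xk + S2) \<bullet> (Z - Xk))"
  have X': "X \<in> feas C" using X by (simp add: is_arg_min_linorder)
  have min: "?\<phi> X \<le> ?\<phi> Z" if "Z \<in> feas C" for Z
  proof -
    have "dca_sub lam S1 S2 Xk X \<le> dca_sub lam S1 S2 Xk Z"
      using X that by (simp add: is_arg_min_linorder)
    then show ?thesis by (simp add: dca_sub_eq[OF S1 S2 Xk] X' that)
  qed
  have d: "((\<lambda>Z. - ln (det (Z + S1))) has_derivative (\<lambda>H. (- matrix_inv (X + S1)) \<bullet> H))
      (at X within feas C)"
    using shifted_neg_ln_det_has_derivative[OF pos_def_symm[OF S1] feas_pos_def[OF S1 X']]
    by (rule has_derivative_subset) (use feas_symm in blast)
  have "(?\<phi> has_derivative (\<lambda>H. (lam *\<^sub>R matrix_inv (Xk + S2) - matrix_inv (X + S1)) \<bullet> H))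
      (at X within feas C)"
    by (rule derivative_eq_intros d refl | simp add: inner_diff_left)+
  from minimizer_variational_inequality[OF this feas_convex X' _ min]
  have "0 \<le> (lam *\<^sub>R matrix_inv (Xk + S2) - matrix_inv (X + S1)) \<bullet> (Z - X)" if "Z \<in> feas C" for Z
    using that by blast
  moreover have "matrix_inv (X + S1) - lam *\<^sub>R matrix_inv (Xk + S2) \<in> symm"
    using feas_pos_def[OF S1 X'] feas_pos_def[OF S2 Xk] by simp
  ultimately show ?thesis by (auto simp: normal_cone_def inner_diff_left)
qed

text \<open>Each step decreases \<open>f\<close> at least by the Bregman gap of \<open>h\<close>, which is quadratic in the step
  length because \<open>h\<close> is strongly convex on the feasible set.\<close>

lemma dca_step_descent:
  fixes S1 S2 C :: "real^'n^'n"
  assumes S1: "pos_def S1" and S2: "pos_def S2" and lam: "0 < lam" and Xk: "Xk \<in> feas C"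
    and X: "is_arg_min (dca_sub lam S1 S2 Xk) (\<lambda>Z. Z \<in> feas C) X"
  shows "lam * (1 / (norm (C + S2) + 1))\<^sup>2 / 4 * (norm (X - Xk))\<^sup>2
    \<le> f_obj lam S1 S2 Xk - f_obj lam S1 S2 X"
proof -
  define b where "b = 1 / (norm (C + S2) + 1)"
  have b: "0 \<le> b" by (simp add: b_def)
  have X': "X \<in> feas C" using X by (simp add: is_arg_min_linorder)
  have "Xk + (1/2) *\<^sub>R (X - Xk) = (1/2) *\<^sub>R Xk + (1/2) *\<^sub>R X"
    using scaleR_left_diff_distrib[of 1 "1/2" Xk] by (simp add: scaleR_right_diff_distrib)
  then have mid: "Xk + (1/2) *\<^sub>R (X - Xk) \<in> feas C"
    using convexD[OF feas_convex Xk X', of "1/2" "1/2"] by simp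
  have mid_eq: "Xk + S2 + (1/2) *\<^sub>R (X - Xk) = Xk + (1/2) *\<^sub>R (X - Xk) + S2" by (simp add: add_ac)
  have end_eq: "Xk + S2 + (X - Xk) = X + S2" by simp
  have "ln (det (X + S2)) - ln (det (Xk + S2))
      \<le> matrix_inv (Xk + S2) \<bullet> (X - Xk) - b\<^sup>2 / 4 * (norm (X - Xk))\<^sup>2"
  proof (rule ln_det_strongly_concave[of "Xk + S2" "X - Xk" b, unfolded mid_eq end_eq])
    show "pos_def (Xk + S2)" "pos_def (X + S2)" using feas_pos_def[OF S2] Xk X' by auto
    show "X - Xk \<in> symm" using feas_symm Xk X' by (intro symm_diff)
    show "b *\<^sub>R mat 1 \<preceq> matrix_inv (Xk + S2)"
      "b *\<^sub>R mat 1 \<preceq> matrix_inv (Xk + (1/2) *\<^sub>R (X - Xk) + S2)"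
      unfolding b_def
      by (rule feas_inverse_lower_bound[OF S2 Xk refl], rule feas_inverse_lower_bound[OF S2 mid refl])
  qed (rule b)
  then have "lam * (ln (det (X + S2)) - ln (det (Xk + S2)))
      \<le> lam * (matrix_inv (Xk + S2) \<bullet> (X - Xk) - b\<^sup>2 / 4 * (norm (X - Xk))\<^sup>2)"
    using lam by (intro mult_left_mono) auto
  moreover have "- ln (det (X + S1)) + lam * (matrix_inv (Xk + S2) \<bullet> (X - Xk)) \<le> - ln (det (Xk + S1))"
  proof -
    have "dca_sub lam S1 S2 Xk X \<le> dca_sub lam S1 S2 Xk Xk"
      using X Xk by (simp add: is_arg_min_linorder)
    then show ?thesis by (simp add: dca_sub_eq[OF S1 S2 Xk] X' Xk)
  qed
  ultimately have "lam * (b\<^sup>2 / 4 * (norm (X - Xk))\<^sup>2) \<le> f_obj lam S1 S2 Xk - f_obj lam S1 S2 X"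
    unfolding f_obj_def right_diff_distrib by linarith
  then show ?thesis by (simp add: b_def)
qed

text \<open>The gap after a step is at most a constant \<open>A\<close> times the decrease in that step, since both
  are compared with the squared step length. This is a contraction of the gap by the factor
  \<open>A / (1 + A)\<close>.\<close>

lemma dca_linear_rate:
  fixes S1 S2 C :: "real^'n^'n"
  assumes S1: "pos_def S1" and S2: "pos_def S2" and C: "pos_semidef C" and lam: "1 < lam"
    and X: "dca_seq lam S1 S2 C X"
    and Xs: "is_arg_min (f_obj lam S1 S2) (\<lambda>X. X \<in> feas C) Xs"
  shows "\<exists>\<rho>. 0 < \<rho> \<and> \<rho> < 1 \<and> (\<forall>k. f_obj lam S1 S2 (X (Suc k)) - f_obj lam S1 S2 Xs
    \<le> \<rho> * (f_obj lam S1 S2 (X k) - f_obj lam S1 S2 Xs))"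
proof -
  let ?f = "f_obj lam S1 S2"
  have Xs': "Xs \<in> feas C" using Xs by (simp add: is_arg_min_linorder)
  have step: "is_arg_min (dca_sub lam S1 S2 (X k)) (\<lambda>Z. Z \<in> feas C) (X (Suc k))" for k
    using X by (simp add: dca_seq_def)
  have feas: "X k \<in> feas C" for k
    using X step by (cases k) (auto simp: dca_seq_def is_arg_min_linorder)
  define r where "r = norm (matrix_inv S1) + lam * norm (matrix_inv S2)"
  have r: "0 \<le> r" using lam by (simp add: r_def)
  obtain \<kappa> where \<kappa>: "\<kappa> > 0" and gap: "\<forall>X\<in>feas C. \<forall>Z\<in>feas C. \<forall>Y\<in>normal_cone (feas C) X.
      norm Y \<le> r \<longrightarrow> ?f X - ?f Z \<le> \<kappa> * (norm (objective_gradient lam S1 S2 X + Y))\<^sup>2"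
    using gap_le_stationarity_error[OF S1 S2 C lam r] by blast
  define L where "L = lam * (norm (matrix_inv S2))\<^sup>2"
  define c where "c = lam * (1 / (norm (C + S2) + 1))\<^sup>2 / 4"
  have c: "c > 0"
    using lam norm_ge_zero[of "C + S2"] by (simp add: c_def zero_less_power2 add_nonneg_eq_0_iff)
  define A where "A = \<kappa> * L\<^sup>2 / c + 1"
  have A: "A > 0" using \<kappa> c by (simp add: A_def add_nonneg_pos)
  have rate: "?f (X (Suc k)) - ?f Xs \<le> A / (1 + A) * (?f (X k) - ?f Xs)" for k
  proof -
    let ?Y = "matrix_inv (X (Suc k) + S1) - lam *\<^sub>R matrix_inv (X k + S2)"
    let ?d = "norm (X (Suc k) - X k)"
    have "norm ?Y \<le> norm (matrix_inv (X (Suc k) + S1)) + lam * norm (matrix_inv (X k + S2))"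
      using norm_triangle_ineq4[of "matrix_inv (X (Suc k) + S1)" "lam *\<^sub>R matrix_inv (X k + S2)"] lam
      by simp
    also have "\<dots> \<le> r"
      unfolding r_def using lam
      by (intro add_mono mult_left_mono feas_inverse_norm[OF S1 feas] feas_inverse_norm[OF S2 feas]) auto
    finally have Yr: "norm ?Y \<le> r" .
    have "objective_gradient lam S1 S2 (X (Suc k)) + ?Y
        = lam *\<^sub>R (matrix_inv (X (Suc k) + S2) - matrix_inv (X k + S2))"
      by (simp add: objective_gradient_def scaleR_right_diff_distrib)
    also have "\<dots> = lam *\<^sub>R (matrix_inv (X (Suc k) + S2) ** (X k - X (Suc k)) ** matrix_inv (X k + S2))"
      using matrix_inv_diff[OF feas_pos_def[OF S2 feas[of "Suc k"]] feas_pos_def[OF S2 feas[of k]]]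
      by simp
    finally have "norm (objective_gradient lam S1 S2 (X (Suc k)) + ?Y)
        = lam * norm (matrix_inv (X (Suc k) + S2) ** (X k - X (Suc k)) ** matrix_inv (X k + S2))"
      using lam by simp
    also have "\<dots> \<le> lam * (norm (matrix_inv S2) * ?d * norm (matrix_inv S2))"
      unfolding norm_minus_commute[of "X (Suc k)"] using lam
      by (intro mult_left_mono order_trans[OF norm_matrix_mult] mult_mono
          feas_inverse_norm[OF S2 feas]) auto
    also have "\<dots> = L * ?d" by (simp add: L_def power2_eq_square)
    finally have "(norm (objective_gradient lam S1 S2 (X (Suc k)) + ?Y))\<^sup>2 \<le> (L * ?d)\<^sup>2"
      by (intro power_mono) auto
    then have change: "\<kappa> * (norm (objective_gradient lam S1 S2 (X (Suc k)) + ?Y))\<^sup>2 \<le> \<kappa> * (L * ?d)\<^sup>2"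
      using \<kappa> by (intro mult_left_mono) auto
    have descent: "c * ?d\<^sup>2 \<le> ?f (X k) - ?f (X (Suc k))"
      unfolding c_def using lam by (intro dca_step_descent[OF S1 S2 _ feas step]) simp
    have "0 \<le> c * ?d\<^sup>2" using c by simp
    then have decrease: "0 \<le> ?f (X k) - ?f (X (Suc k))" using descent by linarith
    have "?f (X (Suc k)) - ?f Xs \<le> \<kappa> * (norm (objective_gradient lam S1 S2 (X (Suc k)) + ?Y))\<^sup>2"
      using gap[rule_format, OF feas[of "Suc k"] Xs'
          dca_step_normal_vector[OF S1 S2 feas step] Yr] .
    also note change
    also have "\<kappa> * (L * ?d)\<^sup>2 = \<kappa> * L\<^sup>2 / c * (c * ?d\<^sup>2)"
      using c by (simp add: power_mult_distrib)
    also have "\<dots> \<le> \<kappa> * L\<^sup>2 / c * (?f (X k) - ?f (X (Suc k)))"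
      using \<kappa> c by (intro mult_left_mono descent) auto
    also have "\<dots> \<le> A * (?f (X k) - ?f (X (Suc k)))"
      using decrease by (intro mult_right_mono) (simp_all add: A_def)
    finally have "?f (X (Suc k)) - ?f Xs \<le> A * (?f (X k) - ?f (X (Suc k)))" .
    then have "(1 + A) * (?f (X (Suc k)) - ?f Xs) \<le> A * (?f (X k) - ?f Xs)"
      by (simp add: algebra_simps)
    then show ?thesis using A by (simp add: field_simps)
  qed
  have "0 < A / (1 + A)" "A / (1 + A) < 1" using A by auto
  with rate show ?thesis by blast
qed

lemma dca_converges:
  fixes S1 S2 C :: "real^'n^'n"
  assumes S1: "pos_def S1" and S2: "pos_def S2" and C: "pos_semidef C" and lam: "1 < lam"
    and X: "dca_seq lam S1 S2 C X"
    and Xs: "is_arg_min (f_obj lam S1 S2) (\<lambda>X. X \<in> feas C) Xs"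
  shows "X \<longlonglongrightarrow> Xs"
proof -
  let ?gap = "\<lambda>k. f_obj lam S1 S2 (X k) - f_obj lam S1 S2 Xs"
  have feas: "X k \<in> feas C" for k
    using X by (cases k) (auto simp: dca_seq_def is_arg_min_linorder)
  obtain \<rho> where \<rho>: "0 < \<rho>" "\<rho> < 1" and rate: "\<And>k. ?gap (Suc k) \<le> \<rho> * ?gap k"
    using dca_linear_rate[OF assms] by blast
  obtain c where c: "c > 0"
    and growth: "\<forall>Z\<in>feas C. c * (norm (Z - Xs))\<^sup>2 \<le> f_obj lam S1 S2 Z - f_obj lam S1 S2 Xs"
    using minimizer_quadratic_growth[OF S1 S2 C lam Xs] by blast
  have "?gap k \<le> \<rho> ^ k * ?gap 0" for k
  proof (induction k)
    case (Suc k)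
    have "?gap (Suc k) \<le> \<rho> * ?gap k" by (rule rate)
    also have "\<dots> \<le> \<rho> * (\<rho> ^ k * ?gap 0)" using \<rho> by (intro mult_left_mono Suc.IH) auto
    finally show ?case by (simp add: mult.assoc)
  qed simp
  then have "c * (norm (X k - Xs))\<^sup>2 \<le> \<rho> ^ k * ?gap 0" for k
    using growth[rule_format, OF feas[of k]] by (rule order_trans[rotated])
  then have bound: "norm ((norm (X k - Xs))\<^sup>2) \<le> \<rho> ^ k * (?gap 0 / c)" for k
    using c by (simp add: pos_le_divide_eq mult.commute)
  have "(\<lambda>k. \<rho> ^ k * (?gap 0 / c)) \<longlonglongrightarrow> 0"
    using \<rho> by (intro tendsto_mult_left_zero LIMSEQ_power_zero) simp
  then have "(\<lambda>k. (norm (X k - Xs))\<^sup>2) \<longlonglongrightarrow> 0"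
    by (rule Lim_null_comparison[rotated]) (intro always_eventually allI bound)
  then have "(\<lambda>k. norm (X k - Xs)) \<longlonglongrightarrow> 0" by (simp add: tendsto_null_power)
  then have "(\<lambda>k. X k - Xs) \<longlonglongrightarrow> 0" by (rule tendsto_norm_zero_cancel)
  then show ?thesis by (rule LIM_zero_cancel)
qed

section \<open>Error bound and convergence for the log-determinant problem\<close>

theorem proposition1:
  fixes S1 S2 C :: "real^'n^'n" and lam :: real
  assumes "pos_def S1" and "pos_def S2" and "pos_semidef C" and "lam > 1"
  shows
    "(\<comment> \<open>(1a)\<close>
       closed_fun (g_fun S1) \<and> convex_fun (g_fun S1) \<and> C1_on (eff_dom (g_fun S1)) (g_fun S1) \<and>
       closed_fun (h_fun lam S2) \<and> convex_fun (h_fun lam S2) \<and>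
       C1_on (eff_dom (h_fun lam S2)) (h_fun lam S2)) \<and>
     (\<comment> \<open>(1b)\<close>
       bounded (feas C) \<and> closed (feas C) \<and> convex (feas C) \<and>
       feas C \<subseteq> eff_dom (g_fun S1) \<inter> eff_dom (h_fun lam S2)) \<and>
     (\<comment> \<open>(1c)\<close>
       \<exists>Xs. is_arg_min (f_obj lam S1 S2) (\<lambda>X. X \<in> feas C) Xs \<and>
         \<bar>f_opt lam S1 S2 C\<bar> \<noteq> \<infinity> \<and> f_opt lam S1 S2 C = ereal (f_obj lam S1 S2 Xs)) \<and>
     (\<comment> \<open>(1d)\<close>
       \<forall>Xk\<in>feas C. \<exists>X. is_arg_min (dca_sub lam S1 S2 Xk) (\<lambda>Z. Z \<in> feas C) X) \<and>
     (\<comment> \<open>(1e)\<close>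
       \<exists>\<mu>>0. \<exists>r>0. \<forall>X\<in>feas C. \<forall>Y\<in>normal_cone (feas C) X. norm Y \<le> r \<longrightarrow>
         ereal \<mu> * (ereal (f_obj lam S1 S2 X) - f_opt lam S1 S2 C)
           \<le> bregman (conjugate (h_fun lam S2))
                (grad (g_fun S1) X + Y) (grad (h_fun lam S2) X)) \<and>
     (\<comment> \<open>(2)\<close>
       \<forall>X Xs. dca_seq lam S1 S2 C X \<longrightarrow>
         is_arg_min (f_obj lam S1 S2) (\<lambda>X. X \<in> feas C) Xs \<longrightarrow>
         X \<longlonglongrightarrow> Xs \<and>
         (\<exists>\<rho>. 0 < \<rho> \<and> \<rho> < 1 \<and>
           (\<forall>k. ereal (f_obj lam S1 S2 (X (Suc k))) - f_opt lam S1 S2 C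
             \<le> ereal \<rho> * (ereal (f_obj lam S1 S2 (X k)) - f_opt lam S1 S2 C))))"
proof -
  let ?f = "f_obj lam S1 S2" and ?opt = "f_opt lam S1 S2 C"
  note S1 = assms(1) and S2 = assms(2) and C = assms(3) and lam = assms(4)
  have lam0: "0 < lam" "0 < (1::real)" using lam by auto
  note sym = pos_def_symm[OF S1] pos_def_symm[OF S2]
  obtain Xs where Xs: "is_arg_min ?f (\<lambda>X. X \<in> feas C) Xs"
    using minimizer_exists[OF S1 S2 C] by blast
  have Xs_feas: "Xs \<in> feas C" using Xs by (simp add: is_arg_min_linorder)
  have 1: "closed_fun (g_fun S1) \<and> convex_fun (g_fun S1) \<and> C1_on (eff_dom (g_fun S1)) (g_fun S1) \<and>
       closed_fun (h_fun lam S2) \<and> convex_fun (h_fun lam S2) \<and>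
       C1_on (eff_dom (h_fun lam S2)) (h_fun lam S2)"
    unfolding g_fun_eq_h_fun by (intro conjI closed_h_fun convex_h_fun h_fun_C1 sym lam0)
  have 2: "bounded (feas C) \<and> closed (feas C) \<and> convex (feas C) \<and>
       feas C \<subseteq> eff_dom (g_fun S1) \<inter> eff_dom (h_fun lam S2)"
    using feas_pos_def[OF S1] feas_pos_def[OF S2] feas_symm
    by (auto simp: eff_dom_g_fun eff_dom_h_fun compact_imp_bounded compact_imp_closed
        feas_compact feas_convex)
  have 3: "\<exists>Xs. is_arg_min ?f (\<lambda>X. X \<in> feas C) Xs \<and> \<bar>?opt\<bar> \<noteq> \<infinity> \<and> ?opt = ereal (?f Xs)"
    using Xs f_opt_eq[OF Xs] by auto
  have 4: "\<forall>Xk\<in>feas C. \<exists>X. is_arg_min (dca_sub lam S1 S2 Xk) (\<lambda>Z. Z \<in> feas C) X"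
    using dca_sub_minimizer_exists[OF S1 S2 C] by blast
  have 5: "\<exists>\<mu>>0. \<exists>r>0. \<forall>X\<in>feas C. \<forall>Y\<in>normal_cone (feas C) X. norm Y \<le> r \<longrightarrow>
         ereal \<mu> * (ereal (?f X) - ?opt)
           \<le> bregman (conjugate (h_fun lam S2)) (grad (g_fun S1) X + Y) (grad (h_fun lam S2) X)"
  proof -
    let ?E = "\<lambda>X Y. norm (objective_gradient lam S1 S2 X + Y)"
    obtain \<kappa> where \<kappa>: "\<kappa> > 0" and gap: "\<forall>X\<in>feas C. \<forall>Z\<in>feas C. \<forall>Y\<in>normal_cone (feas C) X.
        norm Y \<le> 1 \<longrightarrow> ?f X - ?f Z \<le> \<kappa> * (?E X Y)\<^sup>2"
      using gap_le_stationarity_error[OF S1 S2 C lam zero_le_one] by blast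
    obtain \<delta> where \<delta>: "\<delta> > 0" and breg: "\<forall>X\<in>feas C. \<forall>Y\<in>symm. norm Y \<le> 1 \<longrightarrow>
        ereal (\<delta> * (?E X Y)\<^sup>2)
          \<le> bregman (conjugate (h_fun lam S2)) (grad (g_fun S1) X + Y) (grad (h_fun lam S2) X)"
      using bregman_ge_stationarity_error[OF S1 S2 lam0(1) zero_le_one] by blast
    have "ereal (\<delta> / \<kappa>) * (ereal (?f X) - ?opt)
        \<le> bregman (conjugate (h_fun lam S2)) (grad (g_fun S1) X + Y) (grad (h_fun lam S2) X)"
      if X: "X \<in> feas C" and Y: "Y \<in> normal_cone (feas C) X" "norm Y \<le> 1" for X Y
    proof -
      have "\<delta> / \<kappa> * (?f X - ?f Xs) \<le> \<delta> / \<kappa> * (\<kappa> * (?E X Y)\<^sup>2)"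
        using gap[rule_format, OF X Xs_feas Y] \<delta> \<kappa> by (intro mult_left_mono) auto
      also have "\<dots> = \<delta> * (?E X Y)\<^sup>2" using \<kappa> by simp
      finally have "ereal (\<delta> / \<kappa>) * (ereal (?f X) - ?opt) \<le> ereal (\<delta> * (?E X Y)\<^sup>2)"
        by (simp add: f_opt_eq[OF Xs])
      also have "\<dots> \<le> bregman (conjugate (h_fun lam S2)) (grad (g_fun S1) X + Y) (grad (h_fun lam S2) X)"
        using breg X Y by (simp add: normal_cone_def)
      finally show ?thesis .
    qed
    moreover have "0 < \<delta> / \<kappa>" using \<delta> \<kappa> by simp
    ultimately show ?thesis using zero_less_one by blast
  qed
  have 6: "X \<longlonglongrightarrow> Xs \<and> (\<exists>\<rho>. 0 < \<rho> \<and> \<rho> < 1 \<and>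
           (\<forall>k. ereal (?f (X (Suc k))) - ?opt \<le> ereal \<rho> * (ereal (?f (X k)) - ?opt)))"
    if "dca_seq lam S1 S2 C X" "is_arg_min ?f (\<lambda>X. X \<in> feas C) Xs" for X Xs
    using dca_converges[OF S1 S2 C lam that] dca_linear_rate[OF S1 S2 C lam that]
    by (simp add: f_opt_eq[OF that(2)])
  show ?thesis using 1 2 3 4 5 6 by blast
qed

end
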